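(* Let $\mathcal{V}$ and $\mathcal{W}$ be symmetric monoidal model categories. Any weak monoidal Quillen adjunction $F\colon\mathcal{W}\rightleftarrows\mathcal{V}\colon G$ (with $F$ left adjoint) lifts to a weak $\mathcal{W}$-adjunction $F\colon\mathcal{W}\rightleftarrows G_*\mathcal{V}\colon G$; that is, there is a natural map $\underline{G_*\mathcal{V}}(Fw,v)=G\,\underline{\mathcal{V}}(Fw,v)\to\underline{\mathcal{W}}(w,Gv)$ in $\mathcal{W}$ (for $w\in\mathcal{W}$, $v\in\mathcal{V}$) that is a weak equivalence whenever $w\in\mathcal{W}$ is cofibrant and $v\in\mathcal{V}$ is fibrant.
   Context: A monoidal model category is a model category with a closed monoidal structure $(\otimes,\mathbb{1})$ satisfying the pushout-product axiom (for cofibrations $i\colon a\to b$, $k\colon x\to y$, the map $(a\otimes y)\amalg_{a\otimes x}(b\otimes x)\to b\otimes y$ is a cofibration, acyclic if $i$ or $k$ is) and the unit axiom (for $x$ cofibrant and every cofibrant replacement $q\colon Q\mathbb{1}\to\mathbb{1}$, the map $x\otimes Q\mathbb{1}\to x\otimes\mathbb{1}\cong x$ is a weak equivalence). It is symmetric if the structure is closed symmetric monoidal. Internal homs are written $\underline{\mathcal{V}}(-,-)$, $\underline{\mathcal{W}}(-,-)$. A weak monoidal Quillen adjunction is a Quillen adjunction $F\colon\mathcal{W}\rightleftarrows\mathcal{V}\colon G$ between monoidal model categories with a lax monoidal structure on $G$ such that for the corresponding oplax structure $\delta_{x,y}\colon F(x\otimes y)\to F(x)\otimes F(y)$, $\varepsilon\colon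 F(\mathbb{1}_{\mathcal{W}})\to\mathbb{1}_{\mathcal{V}}$ on $F$: (i) $\delta_{x,y}$ is a weak equivalence for all cofibrant $x,y\in\mathcal{W}$; (ii) for some (hence any) cofibrant replacement $q\colon Q\mathbb{1}_{\mathcal{W}}\to\mathbb{1}_{\mathcal{W}}$, the composite $F(Q\mathbb{1}_{\mathcal{W}})\xrightarrow{F(q)}F(\mathbb{1}_{\mathcal{W}})\xrightarrow{\varepsilon}\mathbb{1}_{\mathcal{V}}$ is a weak equivalence. $G_*\mathcal{V}$ is the $\mathcal{W}$-category with the objects of $\mathcal{V}$ and hom-objects $G\underline{\mathcal{V}}(v,v')$. A weak $\mathcal{W}$-adjunction $F\colon\mathcal{C}\rightleftarrows\mathcal{D}\colon G$ consists of a natural map $\underline{\mathcal{D}}(Fc,d)\to\underline{\mathcal{C}}(c,Gd)$ in $\mathcal{W}$ that is a weak equivalence for any cofibrant $c\in\mathcal{C}$ and fibrant $d\in\mathcal{D}$; here cofibrancy and fibrancy are in the given model structures on $\mathcal{W}$ and $\mathcal{V}$. *)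

theory Defs
  imports Main
begin

section \<open>Categories, functors, adjunctions\<close>

record ('o, 'a) cat =
  Obj :: "'o set"
  Arr :: "'a set"
  Dm :: "'a \<Rightarrow> 'o"
  Cd :: "'a \<Rightarrow> 'o"
  Idt :: "'o \<Rightarrow> 'a"
  Comp :: "'a \<Rightarrow> 'a \<Rightarrow> 'a"  (infixr "\<cdot>\<index>" 70)

definition Hom :: "('o, 'a, 'm) cat_scheme \<Rightarrow> 'o \<Rightarrow> 'o \<Rightarrow> 'a set" where
  "Hom C x y = {f \<in> Arr C. Dm C f = x \<and> Cd C f = y}"

locale category =
  fixes C :: "('o, 'a, 'm) cat_scheme" (structure)
  assumes Dm_closed: "f \<in> Arr C \<Longrightarrow> Dm C f \<in> Obj C"
    and Cd_closed: "f \<in> Arr C \<Longrightarrow> Cd C f \<in> Obj C"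
    and Idt_closed: "x \<in> Obj C \<Longrightarrow> Idt C x \<in> Hom C x x"
    and Comp_closed: "f \<in> Hom C x y \<Longrightarrow> g \<in> Hom C y z \<Longrightarrow> g \<cdot> f \<in> Hom C x z"
    and Comp_Idt: "f \<in> Hom C x y \<Longrightarrow> f \<cdot> Idt C x = f"
    and Idt_Comp: "f \<in> Hom C x y \<Longrightarrow> Idt C y \<cdot> f = f"
    and Comp_assoc: "f \<in> Hom C w x \<Longrightarrow> g \<in> Hom C x y \<Longrightarrow> h \<in> Hom C y z \<Longrightarrow>
           (h \<cdot> g) \<cdot> f = h \<cdot> (g \<cdot> f)"

definition inverse_arrows :: "('o, 'a, 'm) cat_scheme \<Rightarrow> 'a \<Rightarrow> 'a \<Rightarrow> bool" where
  "inverse_arrows C f g \<longleftrightarrow> f \<in> Arr C \<and> g \<in> Hom C (Cd C f) (Dm C f) \<and>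
     g \<cdot>\<^bsub>C\<^esub> f = Idt C (Dm C f) \<and> f \<cdot>\<^bsub>C\<^esub> g = Idt C (Cd C f)"

definition iso :: "('o, 'a, 'm) cat_scheme \<Rightarrow> 'a \<Rightarrow> bool" where
  "iso C f \<longleftrightarrow> (\<exists>g. inverse_arrows C f g)"

definition inv_arr :: "('o, 'a, 'm) cat_scheme \<Rightarrow> 'a \<Rightarrow> 'a" where
  "inv_arr C f = (THE g. inverse_arrows C f g)"

record ('o, 'a, 'p, 'b) cfunctor =
  fobj :: "'o \<Rightarrow> 'p"
  farr :: "'a \<Rightarrow> 'b"

locale cat_functor = C: category C + D: category D
  for C :: "('o, 'a, 'm) cat_scheme" and D :: "('p, 'b, 'n) cat_scheme" +
  fixes F :: "('o, 'a, 'p, 'b) cfunctor"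
  assumes fobj_closed: "x \<in> Obj C \<Longrightarrow> fobj F x \<in> Obj D"
    and farr_closed: "f \<in> Hom C x y \<Longrightarrow> farr F f \<in> Hom D (fobj F x) (fobj F y)"
    and farr_Idt: "x \<in> Obj C \<Longrightarrow> farr F (Idt C x) = Idt D (fobj F x)"
    and farr_Comp: "f \<in> Hom C x y \<Longrightarrow> g \<in> Hom C y z \<Longrightarrow>
           farr F (g \<cdot>\<^bsub>C\<^esub> f) = farr F g \<cdot>\<^bsub>D\<^esub> farr F f"

text \<open>An adjunction \<open>F \<stileturn> G\<close> with \<open>F : C \<rightarrow> D\<close>, unit \<open>\<eta>\<close> and counit \<open>\<epsilon>\<close>.\<close>

locale adjunction = F: cat_functor C D F + G: cat_functor D C G
  for C :: "('o, 'a, 'm) cat_scheme" and D :: "('p, 'b, 'n) cat_scheme"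
    and F :: "('o, 'a, 'p, 'b) cfunctor" and G :: "('p, 'b, 'o, 'a) cfunctor" +
  fixes \<eta> :: "'o \<Rightarrow> 'a" and \<epsilon> :: "'p \<Rightarrow> 'b"
  assumes unit_closed: "x \<in> Obj C \<Longrightarrow> \<eta> x \<in> Hom C x (fobj G (fobj F x))"
    and unit_natural: "f \<in> Hom C x y \<Longrightarrow> \<eta> y \<cdot>\<^bsub>C\<^esub> f = farr G (farr F f) \<cdot>\<^bsub>C\<^esub> \<eta> x"
    and counit_closed: "v \<in> Obj D \<Longrightarrow> \<epsilon> v \<in> Hom D (fobj F (fobj G v)) v"
    and counit_natural: "g \<in> Hom D u v \<Longrightarrow> \<epsilon> v \<cdot>\<^bsub>D\<^esub> farr F (farr G g) = g \<cdot>\<^bsub>D\<^esub> \<epsilon> u"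
    and triangle_F: "x \<in> Obj C \<Longrightarrow> \<epsilon> (fobj F x) \<cdot>\<^bsub>D\<^esub> farr F (\<eta> x) = Idt D (fobj F x)"
    and triangle_G: "v \<in> Obj D \<Longrightarrow> farr G (\<epsilon> v) \<cdot>\<^bsub>C\<^esub> \<eta> (fobj G v) = Idt C (fobj G v)"


section \<open>Limits and colimits\<close>

definition initial :: "('o, 'a, 'm) cat_scheme \<Rightarrow> 'o \<Rightarrow> bool" where
  "initial C z \<longleftrightarrow> z \<in> Obj C \<and> (\<forall>x\<in>Obj C. \<exists>!f. f \<in> Hom C z x)"

definition terminal :: "('o, 'a, 'm) cat_scheme \<Rightarrow> 'o \<Rightarrow> bool" where
  "terminal C t \<longleftrightarrow> t \<in> Obj C \<and> (\<forall>x\<in>Obj C. \<exists>!f. f \<in> Hom C x t)"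

definition cone ::
  "('i, 'k, 'l) cat_scheme \<Rightarrow> ('o, 'a, 'm) cat_scheme \<Rightarrow> ('i, 'k, 'o, 'a) cfunctor \<Rightarrow> 'o \<Rightarrow> ('i \<Rightarrow> 'a) \<Rightarrow> bool"
  where
  "cone J C D x p \<longleftrightarrow> x \<in> Obj C \<and> (\<forall>i\<in>Obj J. p i \<in> Hom C x (fobj D i)) \<and>
     (\<forall>k\<in>Arr J. farr D k \<cdot>\<^bsub>C\<^esub> p (Dm J k) = p (Cd J k))"

definition is_limit ::
  "('i, 'k, 'l) cat_scheme \<Rightarrow> ('o, 'a, 'm) cat_scheme \<Rightarrow> ('i, 'k, 'o, 'a) cfunctor \<Rightarrow> 'o \<Rightarrow> ('i \<Rightarrow> 'a) \<Rightarrow> bool"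
  where
  "is_limit J C D x p \<longleftrightarrow> cone J C D x p \<and>
     (\<forall>y q. cone J C D y q \<longrightarrow> (\<exists>!u. u \<in> Hom C y x \<and> (\<forall>i\<in>Obj J. p i \<cdot>\<^bsub>C\<^esub> u = q i)))"

definition cocone ::
  "('i, 'k, 'l) cat_scheme \<Rightarrow> ('o, 'a, 'm) cat_scheme \<Rightarrow> ('i, 'k, 'o, 'a) cfunctor \<Rightarrow> 'o \<Rightarrow> ('i \<Rightarrow> 'a) \<Rightarrow> bool"
  where
  "cocone J C D x p \<longleftrightarrow> x \<in> Obj C \<and> (\<forall>i\<in>Obj J. p i \<in> Hom C (fobj D i) x) \<and>
     (\<forall>k\<in>Arr J. p (Cd J k) \<cdot>\<^bsub>C\<^esub> farr D k = p (Dm J k))"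

definition is_colimit ::
  "('i, 'k, 'l) cat_scheme \<Rightarrow> ('o, 'a, 'm) cat_scheme \<Rightarrow> ('i, 'k, 'o, 'a) cfunctor \<Rightarrow> 'o \<Rightarrow> ('i \<Rightarrow> 'a) \<Rightarrow> bool"
  where
  "is_colimit J C D x p \<longleftrightarrow> cocone J C D x p \<and>
     (\<forall>y q. cocone J C D y q \<longrightarrow> (\<exists>!u. u \<in> Hom C x y \<and> (\<forall>i\<in>Obj J. u \<cdot>\<^bsub>C\<^esub> p i = q i)))"

text \<open>Every finite category is isomorphic to one whose objects and arrows are natural numbers,
  so the shapes below are all the finite ones.\<close>

definition finite_category :: "(nat, nat) cat \<Rightarrow> bool" where
  "finite_category J \<longleftrightarrow> category J \<and> finite (Obj J) \<and> finite (Arr J)"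

definition has_finite_limits :: "('o, 'a, 'm) cat_scheme \<Rightarrow> bool" where
  "has_finite_limits C \<longleftrightarrow>
     (\<forall>J D. finite_category J \<and> cat_functor J C D \<longrightarrow> (\<exists>x p. is_limit J C D x p))"

definition has_finite_colimits :: "('o, 'a, 'm) cat_scheme \<Rightarrow> bool" where
  "has_finite_colimits C \<longleftrightarrow>
     (\<forall>J D. finite_category J \<and> cat_functor J C D \<longrightarrow> (\<exists>x p. is_colimit J C D x p))"

text \<open>\<open>j\<^sub>1\<close>, \<open>j\<^sub>2\<close> with apex \<open>P\<close> form a pushout of the span \<open>f : s \<rightarrow> x\<close>, \<open>g : s \<rightarrow> y\<close>.\<close>

definition is_pushout ::
  "('o, 'a, 'm) cat_scheme \<Rightarrow> 'a \<Rightarrow> 'a \<Rightarrow> 'o \<Rightarrow> 'a \<Rightarrow> 'a \<Rightarrow> bool" where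
  "is_pushout C f g P j\<^sub>1 j\<^sub>2 \<longleftrightarrow>
     f \<in> Arr C \<and> g \<in> Arr C \<and> Dm C f = Dm C g \<and>
     j\<^sub>1 \<in> Hom C (Cd C f) P \<and> j\<^sub>2 \<in> Hom C (Cd C g) P \<and> j\<^sub>1 \<cdot>\<^bsub>C\<^esub> f = j\<^sub>2 \<cdot>\<^bsub>C\<^esub> g \<and>
     (\<forall>z h\<^sub>1 h\<^sub>2. h\<^sub>1 \<in> Hom C (Cd C f) z \<and> h\<^sub>2 \<in> Hom C (Cd C g) z \<and> h\<^sub>1 \<cdot>\<^bsub>C\<^esub> f = h\<^sub>2 \<cdot>\<^bsub>C\<^esub> g \<longrightarrow>
        (\<exists>!u. u \<in> Hom C P z \<and> u \<cdot>\<^bsub>C\<^esub> j\<^sub>1 = h\<^sub>1 \<and> u \<cdot>\<^bsub>C\<^esub> j\<^sub>2 = h\<^sub>2))"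


section \<open>Model categories and Quillen adjunctions\<close>

record 'a model =
  Weq :: "'a set"
  Cof :: "'a set"
  Fib :: "'a set"

definition is_retract :: "('o, 'a, 'm) cat_scheme \<Rightarrow> 'a \<Rightarrow> 'a \<Rightarrow> bool" where
  "is_retract C f g \<longleftrightarrow> f \<in> Arr C \<and> g \<in> Arr C \<and>
     (\<exists>i\<in>Hom C (Dm C f) (Dm C g). \<exists>r\<in>Hom C (Dm C g) (Dm C f).
      \<exists>j\<in>Hom C (Cd C f) (Cd C g). \<exists>s\<in>Hom C (Cd C g) (Cd C f).
        r \<cdot>\<^bsub>C\<^esub> i = Idt C (Dm C f) \<and> s \<cdot>\<^bsub>C\<^esub> j = Idt C (Cd C f) \<and>
        g \<cdot>\<^bsub>C\<^esub> i = j \<cdot>\<^bsub>C\<^esub> f \<and> f \<cdot>\<^bsub>C\<^esub> r = s \<cdot>\<^bsub>C\<^esub> g)"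

definition has_lifting :: "('o, 'a, 'm) cat_scheme \<Rightarrow> 'a \<Rightarrow> 'a \<Rightarrow> bool" where
  "has_lifting C i p \<longleftrightarrow>
     (\<forall>u\<in>Hom C (Dm C i) (Dm C p). \<forall>v\<in>Hom C (Cd C i) (Cd C p).
        p \<cdot>\<^bsub>C\<^esub> u = v \<cdot>\<^bsub>C\<^esub> i \<longrightarrow>
        (\<exists>h\<in>Hom C (Cd C i) (Dm C p). h \<cdot>\<^bsub>C\<^esub> i = u \<and> p \<cdot>\<^bsub>C\<^esub> h = v))"

text \<open>Quillen's closed model categories: only finite limits and colimits are required and the
  factorizations need not be functorial, so that the definitions asking for more are covered.\<close>

locale model_category = category C for C :: "('o, 'a, 'm) cat_scheme" (structure) +
  fixes M :: "'a model"
  assumes finite_limits: "has_finite_limits C"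
    and finite_colimits: "has_finite_colimits C"
    and Weq_Arr: "Weq M \<subseteq> Arr C" and Cof_Arr: "Cof M \<subseteq> Arr C" and Fib_Arr: "Fib M \<subseteq> Arr C"
    and two_of_three_comp: "f \<in> Hom C x y \<Longrightarrow> g \<in> Hom C y z \<Longrightarrow>
           f \<in> Weq M \<Longrightarrow> g \<in> Weq M \<Longrightarrow> g \<cdot> f \<in> Weq M"
    and two_of_three_left: "f \<in> Hom C x y \<Longrightarrow> g \<in> Hom C y z \<Longrightarrow>
           f \<in> Weq M \<Longrightarrow> g \<cdot> f \<in> Weq M \<Longrightarrow> g \<in> Weq M"
    and two_of_three_right: "f \<in> Hom C x y \<Longrightarrow> g \<in> Hom C y z \<Longrightarrow>
           g \<in> Weq M \<Longrightarrow> g \<cdot> f \<in> Weq M \<Longrightarrow> f \<in> Weq M"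
    and Weq_retract: "is_retract C f g \<Longrightarrow> g \<in> Weq M \<Longrightarrow> f \<in> Weq M"
    and Cof_retract: "is_retract C f g \<Longrightarrow> g \<in> Cof M \<Longrightarrow> f \<in> Cof M"
    and Fib_retract: "is_retract C f g \<Longrightarrow> g \<in> Fib M \<Longrightarrow> f \<in> Fib M"
    and lifting_acyclic_Cof: "i \<in> Cof M \<inter> Weq M \<Longrightarrow> p \<in> Fib M \<Longrightarrow> has_lifting C i p"
    and lifting_acyclic_Fib: "i \<in> Cof M \<Longrightarrow> p \<in> Fib M \<inter> Weq M \<Longrightarrow> has_lifting C i p"
    and factor_acyclic_Cof: "f \<in> Hom C x y \<Longrightarrow>
           \<exists>z. \<exists>i\<in>Hom C x z. \<exists>p\<in>Hom C z y. i \<in> Cof M \<inter> Weq M \<and> p \<in> Fib M \<and> p \<cdot> i = f"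
    and factor_acyclic_Fib: "f \<in> Hom C x y \<Longrightarrow>
           \<exists>z. \<exists>i\<in>Hom C x z. \<exists>p\<in>Hom C z y. i \<in> Cof M \<and> p \<in> Fib M \<inter> Weq M \<and> p \<cdot> i = f"

definition cofibrant :: "('o, 'a, 'm) cat_scheme \<Rightarrow> 'a model \<Rightarrow> 'o \<Rightarrow> bool" where
  "cofibrant C M x \<longleftrightarrow> x \<in> Obj C \<and> (\<exists>z f. initial C z \<and> f \<in> Hom C z x \<and> f \<in> Cof M)"

definition fibrant :: "('o, 'a, 'm) cat_scheme \<Rightarrow> 'a model \<Rightarrow> 'o \<Rightarrow> bool" where
  "fibrant C M x \<longleftrightarrow> x \<in> Obj C \<and> (\<exists>t f. terminal C t \<and> f \<in> Hom C x t \<and> f \<in> Fib M)"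

text \<open>The replacement map is only required to be a weak equivalence, not a fibration. By Ken Brown's
  lemma this makes no difference to the axioms below that mention replacements of the unit.\<close>

definition cofibrant_replacement ::
  "('o, 'a, 'm) cat_scheme \<Rightarrow> 'a model \<Rightarrow> 'o \<Rightarrow> 'o \<Rightarrow> 'a \<Rightarrow> bool" where
  "cofibrant_replacement C M x y q \<longleftrightarrow> cofibrant C M y \<and> q \<in> Hom C y x \<and> q \<in> Weq M"

locale Quillen_adjunction =
  adjunction C D F G \<eta> \<epsilon> + C: model_category C MC + D: model_category D MD
  for C :: "('o, 'a, 'm) cat_scheme" and MC :: "'a model"
    and D :: "('p, 'b, 'n) cat_scheme" and MD :: "'b model"
    and F :: "('o, 'a, 'p, 'b) cfunctor" and G :: "('p, 'b, 'o, 'a) cfunctor"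
    and \<eta> :: "'o \<Rightarrow> 'a" and \<epsilon> :: "'p \<Rightarrow> 'b" +
  assumes F_Cof: "i \<in> Cof MC \<Longrightarrow> farr F i \<in> Cof MD"
    and F_acyclic_Cof: "i \<in> Cof MC \<inter> Weq MC \<Longrightarrow> farr F i \<in> Cof MD \<inter> Weq MD"


section \<open>Closed symmetric monoidal categories\<close>

record ('o, 'a) monoidal_cat = "('o, 'a) cat" +
  TensO :: "'o \<Rightarrow> 'o \<Rightarrow> 'o"  (infixr "\<otimes>\<index>" 75)
  TensA :: "'a \<Rightarrow> 'a \<Rightarrow> 'a"  (infixr "\<star>\<index>" 75)
  Unit :: "'o"
  Assoc :: "'o \<Rightarrow> 'o \<Rightarrow> 'o \<Rightarrow> 'a"
  LUnit :: "'o \<Rightarrow> 'a"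
  RUnit :: "'o \<Rightarrow> 'a"

locale monoidal_category = category C for C :: "('o, 'a, 'm) monoidal_cat_scheme" (structure) +
  assumes Unit_closed: "Unit C \<in> Obj C"
    and TensO_closed: "x \<in> Obj C \<Longrightarrow> y \<in> Obj C \<Longrightarrow> x \<otimes> y \<in> Obj C"
    and TensA_closed: "f \<in> Hom C x y \<Longrightarrow> g \<in> Hom C x' y' \<Longrightarrow> f \<star> g \<in> Hom C (x \<otimes> x') (y \<otimes> y')"
    and TensA_Idt: "x \<in> Obj C \<Longrightarrow> y \<in> Obj C \<Longrightarrow> Idt C x \<star> Idt C y = Idt C (x \<otimes> y)"
    and TensA_Comp: "f \<in> Hom C x y \<Longrightarrow> g \<in> Hom C y z \<Longrightarrow> f' \<in> Hom C x' y' \<Longrightarrow> g' \<in> Hom C y' z' \<Longrightarrow>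
           (g \<cdot> f) \<star> (g' \<cdot> f') = (g \<star> g') \<cdot> (f \<star> f')"
    and Assoc_closed: "x \<in> Obj C \<Longrightarrow> y \<in> Obj C \<Longrightarrow> z \<in> Obj C \<Longrightarrow>
           Assoc C x y z \<in> Hom C ((x \<otimes> y) \<otimes> z) (x \<otimes> (y \<otimes> z))"
    and Assoc_iso: "x \<in> Obj C \<Longrightarrow> y \<in> Obj C \<Longrightarrow> z \<in> Obj C \<Longrightarrow> iso C (Assoc C x y z)"
    and Assoc_natural: "f \<in> Hom C x x' \<Longrightarrow> g \<in> Hom C y y' \<Longrightarrow> h \<in> Hom C z z' \<Longrightarrow>
           Assoc C x' y' z' \<cdot> ((f \<star> g) \<star> h) = (f \<star> (g \<star> h)) \<cdot> Assoc C x y z"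
    and LUnit_closed: "x \<in> Obj C \<Longrightarrow> LUnit C x \<in> Hom C (Unit C \<otimes> x) x"
    and LUnit_iso: "x \<in> Obj C \<Longrightarrow> iso C (LUnit C x)"
    and LUnit_natural: "f \<in> Hom C x y \<Longrightarrow> LUnit C y \<cdot> (Idt C (Unit C) \<star> f) = f \<cdot> LUnit C x"
    and RUnit_closed: "x \<in> Obj C \<Longrightarrow> RUnit C x \<in> Hom C (x \<otimes> Unit C) x"
    and RUnit_iso: "x \<in> Obj C \<Longrightarrow> iso C (RUnit C x)"
    and RUnit_natural: "f \<in> Hom C x y \<Longrightarrow> RUnit C y \<cdot> (f \<star> Idt C (Unit C)) = f \<cdot> RUnit C x"
    and triangle: "x \<in> Obj C \<Longrightarrow> y \<in> Obj C \<Longrightarrow>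
           (Idt C x \<star> LUnit C y) \<cdot> Assoc C x (Unit C) y = RUnit C x \<star> Idt C y"
    and pentagon: "w \<in> Obj C \<Longrightarrow> x \<in> Obj C \<Longrightarrow> y \<in> Obj C \<Longrightarrow> z \<in> Obj C \<Longrightarrow>
           (Idt C w \<star> Assoc C x y z) \<cdot> Assoc C w (x \<otimes> y) z \<cdot> (Assoc C w x y \<star> Idt C z)
           = Assoc C w x (y \<otimes> z) \<cdot> Assoc C (w \<otimes> x) y z"

record ('o, 'a) closed_symmetric_monoidal_cat = "('o, 'a) monoidal_cat" +
  Sym :: "'o \<Rightarrow> 'o \<Rightarrow> 'a"
  IHom :: "'o \<Rightarrow> 'o \<Rightarrow> 'o"
  Ev :: "'o \<Rightarrow> 'o \<Rightarrow> 'a"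

locale closed_symmetric_monoidal_category = monoidal_category C
  for C :: "('o, 'a, 'm) closed_symmetric_monoidal_cat_scheme" (structure) +
  assumes Sym_closed: "x \<in> Obj C \<Longrightarrow> y \<in> Obj C \<Longrightarrow> Sym C x y \<in> Hom C (x \<otimes> y) (y \<otimes> x)"
    and Sym_natural: "f \<in> Hom C x x' \<Longrightarrow> g \<in> Hom C y y' \<Longrightarrow>
           Sym C x' y' \<cdot> (f \<star> g) = (g \<star> f) \<cdot> Sym C x y"
    and Sym_Sym: "x \<in> Obj C \<Longrightarrow> y \<in> Obj C \<Longrightarrow> Sym C y x \<cdot> Sym C x y = Idt C (x \<otimes> y)"
    and hexagon: "x \<in> Obj C \<Longrightarrow> y \<in> Obj C \<Longrightarrow> z \<in> Obj C \<Longrightarrow>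
           Assoc C y z x \<cdot> Sym C x (y \<otimes> z) \<cdot> Assoc C x y z
           = (Idt C y \<star> Sym C x z) \<cdot> Assoc C y x z \<cdot> (Sym C x y \<star> Idt C z)"
    and IHom_closed: "x \<in> Obj C \<Longrightarrow> y \<in> Obj C \<Longrightarrow> IHom C x y \<in> Obj C"
    and Ev_closed: "x \<in> Obj C \<Longrightarrow> y \<in> Obj C \<Longrightarrow> Ev C x y \<in> Hom C (IHom C x y \<otimes> x) y"
    and Ev_universal: "x \<in> Obj C \<Longrightarrow> y \<in> Obj C \<Longrightarrow> z \<in> Obj C \<Longrightarrow> f \<in> Hom C (z \<otimes> x) y \<Longrightarrow>
           \<exists>!g. g \<in> Hom C z (IHom C x y) \<and> Ev C x y \<cdot> (g \<star> Idt C x) = f"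

text \<open>The transpose \<open>z \<rightarrow> IHom x y\<close> of \<open>f : z \<otimes> x \<rightarrow> y\<close>.\<close>

definition curry_arr ::
  "('o, 'a, 'm) closed_symmetric_monoidal_cat_scheme \<Rightarrow> 'o \<Rightarrow> 'o \<Rightarrow> 'o \<Rightarrow> 'a \<Rightarrow> 'a" where
  "curry_arr C z x y f = (THE g. g \<in> Hom C z (IHom C x y) \<and> Ev C x y \<cdot>\<^bsub>C\<^esub> (g \<star>\<^bsub>C\<^esub> Idt C x) = f)"

text \<open>Lax monoidal functors, with structure maps \<open>\<mu> x y : F x \<otimes> F y \<rightarrow> F (x \<otimes> y)\<close> and
  \<open>\<iota> : 1 \<rightarrow> F 1\<close>. No compatibility with symmetries is demanded.\<close>

locale lax_monoidal_functor =
  cat_functor C D F + C: monoidal_category C + D: monoidal_category D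
  for C :: "('o, 'a, 'm) monoidal_cat_scheme" and D :: "('p, 'b, 'n) monoidal_cat_scheme"
    and F :: "('o, 'a, 'p, 'b) cfunctor" +
  fixes \<mu> :: "'o \<Rightarrow> 'o \<Rightarrow> 'b" and \<iota> :: "'b"
  assumes mult_closed: "x \<in> Obj C \<Longrightarrow> y \<in> Obj C \<Longrightarrow>
           \<mu> x y \<in> Hom D (fobj F x \<otimes>\<^bsub>D\<^esub> fobj F y) (fobj F (x \<otimes>\<^bsub>C\<^esub> y))"
    and mult_natural: "f \<in> Hom C x x' \<Longrightarrow> g \<in> Hom C y y' \<Longrightarrow>
           \<mu> x' y' \<cdot>\<^bsub>D\<^esub> (farr F f \<star>\<^bsub>D\<^esub> farr F g) = farr F (f \<star>\<^bsub>C\<^esub> g) \<cdot>\<^bsub>D\<^esub> \<mu> x y"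
    and mult_unit_closed: "\<iota> \<in> Hom D (Unit D) (fobj F (Unit C))"
    and mult_Assoc: "x \<in> Obj C \<Longrightarrow> y \<in> Obj C \<Longrightarrow> z \<in> Obj C \<Longrightarrow>
           farr F (Assoc C x y z) \<cdot>\<^bsub>D\<^esub> \<mu> (x \<otimes>\<^bsub>C\<^esub> y) z \<cdot>\<^bsub>D\<^esub> (\<mu> x y \<star>\<^bsub>D\<^esub> Idt D (fobj F z))
           = \<mu> x (y \<otimes>\<^bsub>C\<^esub> z) \<cdot>\<^bsub>D\<^esub> (Idt D (fobj F x) \<star>\<^bsub>D\<^esub> \<mu> y z) \<cdot>\<^bsub>D\<^esub> Assoc D (fobj F x) (fobj F y) (fobj F z)"
    and mult_LUnit: "x \<in> Obj C \<Longrightarrow>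
           farr F (LUnit C x) \<cdot>\<^bsub>D\<^esub> \<mu> (Unit C) x \<cdot>\<^bsub>D\<^esub> (\<iota> \<star>\<^bsub>D\<^esub> Idt D (fobj F x)) = LUnit D (fobj F x)"
    and mult_RUnit: "x \<in> Obj C \<Longrightarrow>
           farr F (RUnit C x) \<cdot>\<^bsub>D\<^esub> \<mu> x (Unit C) \<cdot>\<^bsub>D\<^esub> (Idt D (fobj F x) \<star>\<^bsub>D\<^esub> \<iota>) = RUnit D (fobj F x)"


section \<open>Symmetric monoidal model categories\<close>

locale symmetric_monoidal_model_category =
  closed_symmetric_monoidal_category C + model_category C M
  for C :: "('o, 'a, 'm) closed_symmetric_monoidal_cat_scheme" (structure) and M :: "'a model" +
  assumes pushout_product:
      "i \<in> Hom C a b \<Longrightarrow> k \<in> Hom C x y \<Longrightarrow> i \<in> Cof M \<Longrightarrow> k \<in> Cof M \<Longrightarrow>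
       is_pushout C (Idt C a \<star> k) (i \<star> Idt C x) P j\<^sub>1 j\<^sub>2 \<Longrightarrow>
       h \<in> Hom C P (b \<otimes> y) \<Longrightarrow> h \<cdot> j\<^sub>1 = i \<star> Idt C y \<Longrightarrow> h \<cdot> j\<^sub>2 = Idt C b \<star> k \<Longrightarrow>
       h \<in> Cof M \<and> (i \<in> Weq M \<or> k \<in> Weq M \<longrightarrow> h \<in> Weq M)"
    and unit_axiom:
      "cofibrant C M x \<Longrightarrow> cofibrant_replacement C M (Unit C) Q q \<Longrightarrow>
       RUnit C x \<cdot> (Idt C x \<star> q) \<in> Weq M"

text \<open>The adjunction is \<open>F : W \<rightleftharpoons> V : G\<close>; \<open>(\<mu>, \<iota>)\<close> is the lax monoidal structure of the right
  adjoint \<open>G\<close>, and \<open>oplax_mult\<close>, \<open>oplax_unit\<close> are its mates on \<open>F\<close>.\<close>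

definition oplax_mult ::
  "('p, 'b, 'n) monoidal_cat_scheme \<Rightarrow> ('o, 'a, 'm) monoidal_cat_scheme \<Rightarrow>
   ('p, 'b, 'o, 'a) cfunctor \<Rightarrow> ('p \<Rightarrow> 'b) \<Rightarrow> ('o \<Rightarrow> 'a) \<Rightarrow> ('o \<Rightarrow> 'o \<Rightarrow> 'b) \<Rightarrow> 'p \<Rightarrow> 'p \<Rightarrow> 'a" where
  "oplax_mult W V F \<eta> \<epsilon> \<mu> x y =
     \<epsilon> (fobj F x \<otimes>\<^bsub>V\<^esub> fobj F y) \<cdot>\<^bsub>V\<^esub> farr F (\<mu> (fobj F x) (fobj F y) \<cdot>\<^bsub>W\<^esub> (\<eta> x \<star>\<^bsub>W\<^esub> \<eta> y))"

definition oplax_unit ::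
  "('o, 'a, 'm) monoidal_cat_scheme \<Rightarrow> ('p, 'b, 'o, 'a) cfunctor \<Rightarrow> ('o \<Rightarrow> 'a) \<Rightarrow> 'b \<Rightarrow> 'a" where
  "oplax_unit V F \<epsilon> \<iota> = \<epsilon> (Unit V) \<cdot>\<^bsub>V\<^esub> farr F \<iota>"

locale weak_monoidal_Quillen_adjunction =
  Quillen_adjunction W MW V MV F G \<eta> \<epsilon> + lax_monoidal_functor V W G \<mu> \<iota> +
  W: symmetric_monoidal_model_category W MW + V: symmetric_monoidal_model_category V MV
  for W :: "('p, 'b, 'n) closed_symmetric_monoidal_cat_scheme" and MW :: "'b model"
    and V :: "('o, 'a, 'm) closed_symmetric_monoidal_cat_scheme" and MV :: "'a model"
    and F :: "('p, 'b, 'o, 'a) cfunctor" and G :: "('o, 'a, 'p, 'b) cfunctor"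
    and \<eta> :: "'p \<Rightarrow> 'b" and \<epsilon> :: "'o \<Rightarrow> 'a"
    and \<mu> :: "'o \<Rightarrow> 'o \<Rightarrow> 'b" and \<iota> :: "'b" +
  assumes oplax_mult_Weq: "cofibrant W MW x \<Longrightarrow> cofibrant W MW y \<Longrightarrow>
           oplax_mult W V F \<eta> \<epsilon> \<mu> x y \<in> Weq MV"
    and oplax_unit_Weq: "\<exists>Q q. cofibrant_replacement W MW (Unit W) Q q \<and>
           oplax_unit V F \<epsilon> \<iota> \<cdot>\<^bsub>V\<^esub> farr F q \<in> Weq MV"


section \<open>Enriched categories\<close>

record ('x, 'o, 'a) enriched_cat =
  EObj :: "'x set"
  EHom :: "'x \<Rightarrow> 'x \<Rightarrow> 'o"
  EId :: "'x \<Rightarrow> 'a"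
  EComp :: "'x \<Rightarrow> 'x \<Rightarrow> 'x \<Rightarrow> 'a"

locale enriched_category = W: monoidal_category W
  for W :: "('o, 'a, 'm) monoidal_cat_scheme" (structure) +
  fixes E :: "('x, 'o, 'a) enriched_cat"
  assumes EHom_closed: "x \<in> EObj E \<Longrightarrow> y \<in> EObj E \<Longrightarrow> EHom E x y \<in> Obj W"
    and EId_closed: "x \<in> EObj E \<Longrightarrow> EId E x \<in> Hom W (Unit W) (EHom E x x)"
    and EComp_closed: "x \<in> EObj E \<Longrightarrow> y \<in> EObj E \<Longrightarrow> z \<in> EObj E \<Longrightarrow>
           EComp E x y z \<in> Hom W (EHom E y z \<otimes> EHom E x y) (EHom E x z)"
    and EComp_EId: "x \<in> EObj E \<Longrightarrow> y \<in> EObj E \<Longrightarrow>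
           EComp E x x y \<cdot> (Idt W (EHom E x y) \<star> EId E x) = RUnit W (EHom E x y)"
    and EId_EComp: "x \<in> EObj E \<Longrightarrow> y \<in> EObj E \<Longrightarrow>
           EComp E x y y \<cdot> (EId E y \<star> Idt W (EHom E x y)) = LUnit W (EHom E x y)"
    and EComp_assoc: "w \<in> EObj E \<Longrightarrow> x \<in> EObj E \<Longrightarrow> y \<in> EObj E \<Longrightarrow> z \<in> EObj E \<Longrightarrow>
           EComp E w x z \<cdot> (EComp E x y z \<star> Idt W (EHom E w x))
           = EComp E w y z \<cdot> (Idt W (EHom E y z) \<star> EComp E w x y)
             \<cdot> Assoc W (EHom E y z) (EHom E x y) (EHom E w x)"

text \<open>The underlying ordinary category, whose arrows \<open>x \<rightarrow> y\<close> are the arrows \<open>1 \<rightarrow> E(x, y)\<close>;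
  they carry their end points so that distinct hom-sets are disjoint.\<close>

definition underlying ::
  "('o, 'a, 'm) monoidal_cat_scheme \<Rightarrow> ('x, 'o, 'a) enriched_cat \<Rightarrow> ('x, 'x \<times> 'a \<times> 'x) cat" where
  "underlying W E =
     \<lparr> Obj = EObj E,
       Arr = {(x, e, y). x \<in> EObj E \<and> y \<in> EObj E \<and> e \<in> Hom W (Unit W) (EHom E x y)},
       Dm = (\<lambda>(x, e, y). x),
       Cd = (\<lambda>(x, e, y). y),
       Idt = (\<lambda>x. (x, EId E x, x)),
       Comp = (\<lambda>(y, e', z) (x, e, y').
         (x, EComp E x y z \<cdot>\<^bsub>W\<^esub> (e' \<star>\<^bsub>W\<^esub> e) \<cdot>\<^bsub>W\<^esub> inv_arr W (LUnit W (Unit W)), z)) \<rparr>"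

text \<open>The maps \<open>E(x, y) \<rightarrow> E(x', y)\<close> and \<open>E(x, y) \<rightarrow> E(x, y')\<close> given by composition with
  \<open>e : 1 \<rightarrow> E(x', x)\<close> and \<open>e : 1 \<rightarrow> E(y, y')\<close>, respectively.\<close>

definition precomp ::
  "('o, 'a, 'm) monoidal_cat_scheme \<Rightarrow> ('x, 'o, 'a) enriched_cat \<Rightarrow> 'x \<Rightarrow> 'x \<Rightarrow> 'x \<Rightarrow> 'a \<Rightarrow> 'a" where
  "precomp W E x' x y e =
     EComp E x' x y \<cdot>\<^bsub>W\<^esub> (Idt W (EHom E x y) \<star>\<^bsub>W\<^esub> e) \<cdot>\<^bsub>W\<^esub> inv_arr W (RUnit W (EHom E x y))"

definition postcomp ::
  "('o, 'a, 'm) monoidal_cat_scheme \<Rightarrow> ('x, 'o, 'a) enriched_cat \<Rightarrow> 'x \<Rightarrow> 'x \<Rightarrow> 'x \<Rightarrow> 'a \<Rightarrow> 'a" where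
  "postcomp W E x y y' e =
     EComp E x y y' \<cdot>\<^bsub>W\<^esub> (e \<star>\<^bsub>W\<^esub> Idt W (EHom E x y)) \<cdot>\<^bsub>W\<^esub> inv_arr W (LUnit W (EHom E x y))"

text \<open>A closed symmetric monoidal category as a category enriched in itself, and the name
  \<open>1 \<rightarrow> IHom x y\<close> of an arrow \<open>f : x \<rightarrow> y\<close>.\<close>

definition self_enrichment ::
  "('o, 'a, 'm) closed_symmetric_monoidal_cat_scheme \<Rightarrow> ('o, 'o, 'a) enriched_cat" where
  "self_enrichment V =
     \<lparr> EObj = Obj V,
       EHom = IHom V,
       EId = (\<lambda>x. curry_arr V (Unit V) x x (LUnit V x)),
       EComp = (\<lambda>x y z. curry_arr V (IHom V y z \<otimes>\<^bsub>V\<^esub> IHom V x y) x z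
         (Ev V y z \<cdot>\<^bsub>V\<^esub> (Idt V (IHom V y z) \<star>\<^bsub>V\<^esub> Ev V x y) \<cdot>\<^bsub>V\<^esub> Assoc V (IHom V y z) (IHom V x y) x)) \<rparr>"

definition self_name :: "('o, 'a, 'm) closed_symmetric_monoidal_cat_scheme \<Rightarrow> 'a \<Rightarrow> 'a" where
  "self_name V f = curry_arr V (Unit V) (Dm V f) (Cd V f) (f \<cdot>\<^bsub>V\<^esub> LUnit V (Dm V f))"

text \<open>Change of base along a lax monoidal functor \<open>(G, \<mu>, \<iota>)\<close> with values in \<open>W\<close>: the enriched
  category \<open>G\<^sub>*E\<close>, and the effect on elements \<open>1 \<rightarrow> E(x, y)\<close>.\<close>

definition change_of_base ::
  "('p, 'b, 'n) monoidal_cat_scheme \<Rightarrow> ('o, 'a, 'p, 'b) cfunctor \<Rightarrow> ('o \<Rightarrow> 'o \<Rightarrow> 'b) \<Rightarrow> 'b \<Rightarrow>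
   ('x, 'o, 'a) enriched_cat \<Rightarrow> ('x, 'p, 'b) enriched_cat" where
  "change_of_base W G \<mu> \<iota> E =
     \<lparr> EObj = EObj E,
       EHom = (\<lambda>x y. fobj G (EHom E x y)),
       EId = (\<lambda>x. farr G (EId E x) \<cdot>\<^bsub>W\<^esub> \<iota>),
       EComp = (\<lambda>x y z. farr G (EComp E x y z) \<cdot>\<^bsub>W\<^esub> \<mu> (EHom E y z) (EHom E x y)) \<rparr>"

definition change_of_base_name ::
  "('p, 'b, 'n) monoidal_cat_scheme \<Rightarrow> ('o, 'a, 'p, 'b) cfunctor \<Rightarrow> 'b \<Rightarrow> 'a \<Rightarrow> 'b" where
  "change_of_base_name W G \<iota> e = farr G e \<cdot>\<^bsub>W\<^esub> \<iota>"

text \<open>A \<open>W\<close>-category \<open>E\<close> lying over an ordinary category \<open>C\<close> with the same objects: every arrow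
  \<open>f : x \<rightarrow> y\<close> of \<open>C\<close> has a name \<open>1 \<rightarrow> E(x, y)\<close>, functorially. Naming need not be bijective;
  for \<open>G\<^sub>*V\<close> over \<open>V\<close> it is not in general.\<close>

locale enriched_over = enriched_category W E
  for W :: "('o, 'a, 'm) monoidal_cat_scheme" and E :: "('x, 'o, 'a) enriched_cat" +
  fixes C :: "('x, 'c, 'k) cat_scheme" and nm :: "'c \<Rightarrow> 'a"
  assumes Obj_EObj: "Obj C = EObj E"
    and name_functor: "cat_functor C (underlying W E)
           \<lparr> fobj = (\<lambda>x. x), farr = (\<lambda>f. (Dm C f, nm f, Cd C f)) \<rparr>"

text \<open>A weak \<open>W\<close>-adjunction \<open>F : E \<rightleftharpoons> E' : G\<close>, where \<open>E\<close>, \<open>E'\<close> lie over the model categories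
  \<open>C\<close>, \<open>D\<close> and \<open>F\<close>, \<open>G\<close> are functors between the latter. Naturality is over \<open>C\<close> and \<open>D\<close>.\<close>

locale weak_enriched_adjunction =
  W: model_category W MW + C: model_category C MC + D: model_category D MD +
  E: enriched_over W E C nm + E': enriched_over W E' D nm' +
  F: cat_functor C D F + G: cat_functor D C G
  for W :: "('o, 'a, 'm) monoidal_cat_scheme" and MW :: "'a model"
    and C :: "('x, 'c, 'k) cat_scheme" and MC :: "'c model"
    and E :: "('x, 'o, 'a) enriched_cat" and nm :: "'c \<Rightarrow> 'a"
    and D :: "('y, 'd, 'l) cat_scheme" and MD :: "'d model"
    and E' :: "('y, 'o, 'a) enriched_cat" and nm' :: "'d \<Rightarrow> 'a"
    and F :: "('x, 'c, 'y, 'd) cfunctor" and G :: "('y, 'd, 'x, 'c) cfunctor" +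
  fixes \<phi> :: "'x \<Rightarrow> 'y \<Rightarrow> 'a"
  assumes map_closed: "c \<in> Obj C \<Longrightarrow> d \<in> Obj D \<Longrightarrow>
           \<phi> c d \<in> Hom W (EHom E' (fobj F c) d) (EHom E c (fobj G d))"
    and map_natural_left: "f \<in> Hom C c' c \<Longrightarrow> d \<in> Obj D \<Longrightarrow>
           \<phi> c' d \<cdot>\<^bsub>W\<^esub> precomp W E' (fobj F c') (fobj F c) d (nm' (farr F f))
           = precomp W E c' c (fobj G d) (nm f) \<cdot>\<^bsub>W\<^esub> \<phi> c d"
    and map_natural_right: "c \<in> Obj C \<Longrightarrow> g \<in> Hom D d d' \<Longrightarrow>
           \<phi> c d' \<cdot>\<^bsub>W\<^esub> postcomp W E' (fobj F c) d d' (nm' g)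
           = postcomp W E c (fobj G d) (fobj G d') (nm (farr G g)) \<cdot>\<^bsub>W\<^esub> \<phi> c d"
    and map_Weq: "cofibrant C MC c \<Longrightarrow> fibrant D MD d \<Longrightarrow> \<phi> c d \<in> Weq MW"

end

theory Submission
  imports Defs
begin

text \<open>
  The map \<open>G [F w, v] \<rightarrow> [w, G v]\<close> is the transpose of
  \<open>G [F w, v] \<otimes> w \<rightarrow> G [F w, v] \<otimes> G (F w) \<rightarrow> G ([F w, v] \<otimes> F w) \<rightarrow> G v\<close>, formed with the unit of the adjunction,
  the lax structure of \<open>G\<close> and evaluation (\<open>hom_comparison\<close>).

  Why it is a weak equivalence: for cofibrant \<open>w\<close>, both sides are right adjoints as functors of \<open>v\<close>, with
  left adjoints \<open>F A \<otimes> F w\<close> and \<open>F (A \<otimes> w)\<close> as functors of \<open>A\<close>. These preserve cofibrations, by the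
  pushout-product axiom applied to \<open>0 \<rightarrow> w\<close> (\<open>TensA_Cof\<close>). Transposing along both adjunctions turns the
  comparison map into precomposition with \<open>\<delta> : F (A \<otimes> w) \<rightarrow> F A \<otimes> F w\<close> (\<open>hom_comparison_mate\<close>), which is a
  weak equivalence for cofibrant \<open>A\<close>. The claim is then an instance of a principle about model
  categories (\<open>mate_Weq\<close>): a map of right adjoints is a weak equivalence at fibrant objects if its mate
  between the left adjoints is one at cofibrant objects. For \<open>A\<close> cofibrant and \<open>v\<close> fibrant both adjunctions
  respect homotopy classes, so this is the Yoneda lemma in the homotopy category, carried out
  on the level of maps: the proof works with a single path object of \<open>v\<close>, shows that weak
  equivalences between cofibrant objects induce bijections on right homotopy classes of maps into
  \<open>v\<close>, and replaces the saturation of weak equivalences by the two-out-of-six property, which has a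
  short proof from the retract axiom (\<open>two_of_six\<close>).

  The enriched structure is a matter of coherence. Maps into an internal hom are compared by
  evaluating them (\<open>Ev_cancel\<close>); the laws of the self-enrichment then reduce to the pentagon, the
  triangle and Kelly's consequences of these. Change of base along \<open>G\<close> transports the enriched structure
  and the names of arrows (\<open>enriched_over_change_of_base\<close>), and composition with a name in
  \<open>G\<^sub>*V\<close> is the image under \<open>G\<close> of the action of the internal hom (\<open>precomp_change_of_base\<close>,
  \<open>precomp_self\<close>), which makes the naturality of the comparison map a computation with the naturality of
  \<open>\<eta>\<close> and \<open>\<mu>\<close>.
\<close>


section \<open>Composition of arrows with implicit end points\<close>

text \<open>The axioms of a category speak of hom-sets whose end points are variables, which rewriting cannot
  guess. Read instead as conditions on \<open>Arr\<close>, \<open>Dm\<close> and \<open>Cd\<close>, they become conditional rewrite rules whose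
  side conditions are computed from the shape of the arrows; composites are then kept bracketed to
  the right.\<close>

lemma in_Hom_iff: "f \<in> Hom C x y \<longleftrightarrow> f \<in> Arr C \<and> Dm C f = x \<and> Cd C f = y"
  by (auto simp: Hom_def)

context category
begin

lemma Dm_in [simp]: "f \<in> Arr C \<Longrightarrow> Dm C f \<in> Obj C"
  and Cd_in [simp]: "f \<in> Arr C \<Longrightarrow> Cd C f \<in> Obj C"
  by (simp_all add: Dm_closed Cd_closed)

lemma Idt_simps [simp]:
  assumes "x \<in> Obj C"
  shows "Idt C x \<in> Arr C" "Dm C (Idt C x) = x" "Cd C (Idt C x) = x"
  using Idt_closed[OF assms] by (auto simp: in_Hom_iff)

lemma Comp_simps [simp]:
  assumes "f \<in> Arr C" "g \<in> Arr C" "Cd C f = Dm C g"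
  shows "g \<cdot> f \<in> Arr C" "Dm C (g \<cdot> f) = Dm C f" "Cd C (g \<cdot> f) = Cd C g"
  using Comp_closed[of f "Dm C f" "Dm C g" g "Cd C g"] assms by (auto simp: in_Hom_iff)

lemma Idt_right [simp]: "f \<in> Arr C \<Longrightarrow> Dm C f = x \<Longrightarrow> f \<cdot> Idt C x = f"
  using Comp_Idt[of f x "Cd C f"] by (auto simp: in_Hom_iff)

lemma Idt_left [simp]: "f \<in> Arr C \<Longrightarrow> Cd C f = y \<Longrightarrow> Idt C y \<cdot> f = f"
  using Idt_Comp[of f "Dm C f" y] by (auto simp: in_Hom_iff)

lemma assoc [simp]:
  "f \<in> Arr C \<Longrightarrow> g \<in> Arr C \<Longrightarrow> h \<in> Arr C \<Longrightarrow> Cd C f = Dm C g \<Longrightarrow> Cd C g = Dm C h \<Longrightarrow>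
   (h \<cdot> g) \<cdot> f = h \<cdot> g \<cdot> f"
  using Comp_assoc[of f "Dm C f" "Dm C g" g "Dm C h" h "Cd C h"] by (auto simp: in_Hom_iff)

text \<open>Applies an equation between composites at the left end of a longer composite that is bracketed
  to the right; this is how a commuting square is pasted into the middle of a diagram.\<close>

lemma Comp_prefix:
  assumes "g \<cdot> f = h" "f \<in> Arr C" "g \<in> Arr C" "Cd C f = Dm C g" "k \<in> Arr C" "Cd C k = Dm C f"
  shows "g \<cdot> f \<cdot> k = h \<cdot> k"
  using assms assoc[of k f g] by simp

lemma isoE:
  assumes "iso C f"
  obtains g where "f \<in> Arr C" "g \<in> Arr C" "Dm C g = Cd C f" "Cd C g = Dm C f"
    "g \<cdot> f = Idt C (Dm C f)" "f \<cdot> g = Idt C (Cd C f)"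
  using assms by (auto simp: iso_def inverse_arrows_def in_Hom_iff)

lemma inv_arr_simps:
  assumes "iso C f"
  shows "f \<in> Arr C" "inv_arr C f \<in> Arr C" "Dm C (inv_arr C f) = Cd C f" "Cd C (inv_arr C f) = Dm C f"
    "inv_arr C f \<cdot> f = Idt C (Dm C f)" "f \<cdot> inv_arr C f = Idt C (Cd C f)"
proof -
  obtain g where g: "f \<in> Arr C" "g \<in> Arr C" "Dm C g = Cd C f" "Cd C g = Dm C f"
    "g \<cdot> f = Idt C (Dm C f)" "f \<cdot> g = Idt C (Cd C f)" using assms by (rule isoE)
  have "inverse_arrows C f (inv_arr C f)"
    unfolding inv_arr_def
  proof (rule theI)
    show "inverse_arrows C f g" using g by (simp add: inverse_arrows_def in_Hom_iff)
    fix h assume "inverse_arrows C f h"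
    then have h: "h \<in> Arr C" "Dm C h = Cd C f" "Cd C h = Dm C f" "f \<cdot> h = Idt C (Cd C f)"
      by (auto simp: inverse_arrows_def in_Hom_iff)
    have "h = (g \<cdot> f) \<cdot> h" unfolding g(5) using h by simp
    also have "\<dots> = g \<cdot> f \<cdot> h" using g(1-4) h(1-3) by (intro assoc) simp_all
    also have "\<dots> = g" using g h by simp
    finally show "h = g" .
  qed
  then show "f \<in> Arr C" "inv_arr C f \<in> Arr C" "Dm C (inv_arr C f) = Cd C f" "Cd C (inv_arr C f) = Dm C f"
    "inv_arr C f \<cdot> f = Idt C (Dm C f)" "f \<cdot> inv_arr C f = Idt C (Cd C f)"
    by (auto simp: inverse_arrows_def in_Hom_iff)
qed

lemma iso_cancel_right:
  assumes "iso C i" "f \<in> Arr C" "g \<in> Arr C" "Dm C f = Cd C i" "Dm C g = Cd C i" "f \<cdot> i = g \<cdot> i"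
  shows "f = g"
proof -
  note i = inv_arr_simps[OF assms(1)]
  have "(f \<cdot> i) \<cdot> inv_arr C i = (g \<cdot> i) \<cdot> inv_arr C i" using assms(6) by simp
  then show ?thesis using i assms(2-5) by simp
qed

lemma iso_cancel_left:
  assumes "iso C i" "f \<in> Arr C" "g \<in> Arr C" "Cd C f = Dm C i" "Cd C g = Dm C i" "i \<cdot> f = i \<cdot> g"
  shows "f = g"
proof -
  note i = inv_arr_simps[OF assms(1)]
  have "(inv_arr C i \<cdot> i) \<cdot> f = (inv_arr C i \<cdot> i) \<cdot> g"
    using assms(2-6) i(1-4) by simp
  then show ?thesis using i assms(2-5) by simp
qed

end

section \<open>Coherence in monoidal categories\<close>

context monoidal_category
begin

declare Unit_closed [simp] TensO_closed [simp] TensA_Idt [simp]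

lemma TensA_simps [simp]:
  assumes "f \<in> Arr C" "g \<in> Arr C"
  shows "f \<star> g \<in> Arr C" "Dm C (f \<star> g) = Dm C f \<otimes> Dm C g" "Cd C (f \<star> g) = Cd C f \<otimes> Cd C g"
  using TensA_closed[of f "Dm C f" "Cd C f" g "Dm C g" "Cd C g"] assms by (auto simp: in_Hom_iff)

lemma Assoc_simps [simp]:
  assumes "x \<in> Obj C" "y \<in> Obj C" "z \<in> Obj C"
  shows "Assoc C x y z \<in> Arr C" "Dm C (Assoc C x y z) = (x \<otimes> y) \<otimes> z"
    "Cd C (Assoc C x y z) = x \<otimes> (y \<otimes> z)"
  using Assoc_closed[OF assms] by (auto simp: in_Hom_iff)

lemma LUnit_simps [simp]:
  assumes "x \<in> Obj C"
  shows "LUnit C x \<in> Arr C" "Dm C (LUnit C x) = Unit C \<otimes> x" "Cd C (LUnit C x) = x"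
  using LUnit_closed[OF assms] by (auto simp: in_Hom_iff)

lemma RUnit_simps [simp]:
  assumes "x \<in> Obj C"
  shows "RUnit C x \<in> Arr C" "Dm C (RUnit C x) = x \<otimes> Unit C" "Cd C (RUnit C x) = x"
  using RUnit_closed[OF assms] by (auto simp: in_Hom_iff)

lemma interchange:
  "f \<in> Arr C \<Longrightarrow> g \<in> Arr C \<Longrightarrow> f' \<in> Arr C \<Longrightarrow> g' \<in> Arr C \<Longrightarrow> Cd C f = Dm C g \<Longrightarrow> Cd C f' = Dm C g' \<Longrightarrow>
   (g \<star> g') \<cdot> (f \<star> f') = (g \<cdot> f) \<star> (g' \<cdot> f')"
  using TensA_Comp[of f "Dm C f" "Cd C f" g "Cd C g" f' "Dm C f'" "Cd C f'" g' "Cd C g'"]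
  by (auto simp: in_Hom_iff)

lemma interchange_prefix:
  "f \<in> Arr C \<Longrightarrow> g \<in> Arr C \<Longrightarrow> f' \<in> Arr C \<Longrightarrow> g' \<in> Arr C \<Longrightarrow> Cd C f = Dm C g \<Longrightarrow> Cd C f' = Dm C g' \<Longrightarrow>
   k \<in> Arr C \<Longrightarrow> Cd C k = Dm C f \<otimes> Dm C f' \<Longrightarrow>
   (g \<star> g') \<cdot> (f \<star> f') \<cdot> k = ((g \<cdot> f) \<star> (g' \<cdot> f')) \<cdot> k"
  by (rule Comp_prefix) (simp_all add: interchange)

lemma Assoc_nat:
  "f \<in> Arr C \<Longrightarrow> g \<in> Arr C \<Longrightarrow> h \<in> Arr C \<Longrightarrow> Cd C f = x \<Longrightarrow> Cd C g = y \<Longrightarrow> Cd C h = z \<Longrightarrow>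
   Assoc C x y z \<cdot> ((f \<star> g) \<star> h) = (f \<star> (g \<star> h)) \<cdot> Assoc C (Dm C f) (Dm C g) (Dm C h)"
  using Assoc_natural[of f "Dm C f" x g "Dm C g" y h "Dm C h" z] by (auto simp: in_Hom_iff)

lemma LUnit_nat:
  "f \<in> Arr C \<Longrightarrow> Cd C f = y \<Longrightarrow> LUnit C y \<cdot> (Idt C (Unit C) \<star> f) = f \<cdot> LUnit C (Dm C f)"
  using LUnit_natural[of f "Dm C f" y] by (auto simp: in_Hom_iff)

lemma RUnit_nat:
  "f \<in> Arr C \<Longrightarrow> Cd C f = y \<Longrightarrow> RUnit C y \<cdot> (f \<star> Idt C (Unit C)) = f \<cdot> RUnit C (Dm C f)"
  using RUnit_natural[of f "Dm C f" y] by (auto simp: in_Hom_iff)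

text \<open>Naturality of the unit constraint exhibits \<open>f\<close> as a conjugate of \<open>1 \<otimes> f\<close>.\<close>

lemma Unit_TensA_faithful:
  assumes "f \<in> Arr C" "g \<in> Arr C" "Dm C f = Dm C g" "Cd C f = Cd C g"
    and "Idt C (Unit C) \<star> f = Idt C (Unit C) \<star> g"
  shows "f = g"
  by (rule iso_cancel_right[OF LUnit_iso[of "Dm C f"]])
    (use LUnit_nat[OF assms(1) refl] LUnit_nat[OF assms(2) refl] assms in simp_all)

lemma TensA_Unit_faithful:
  assumes "f \<in> Arr C" "g \<in> Arr C" "Dm C f = Dm C g" "Cd C f = Cd C g"
    and "f \<star> Idt C (Unit C) = g \<star> Idt C (Unit C)"
  shows "f = g"
  by (rule iso_cancel_right[OF RUnit_iso[of "Dm C f"]])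
    (use RUnit_nat[OF assms(1) refl] RUnit_nat[OF assms(2) refl] assms in simp_all)

lemma iso_TensA_Idt:
  assumes "iso C f" "x \<in> Obj C"
  shows "iso C (f \<star> Idt C x)"
proof -
  note i = inv_arr_simps[OF assms(1)]
  have "inverse_arrows C (f \<star> Idt C x) (inv_arr C f \<star> Idt C x)"
    using i assms by (simp add: inverse_arrows_def in_Hom_iff interchange)
  then show ?thesis by (auto simp: iso_def)
qed

text \<open>Kelly's observation that the pentagon and the triangle imply the remaining compatibilities of
  the unit constraints. As tensoring with the unit is faithful, the two sides may be compared after
  tensoring with it on the left, where the pentagon for \<open>1, 1, x, y\<close> turns one triangle into the other.\<close>

lemma LUnit_TensO:
  assumes x: "x \<in> Obj C" and y: "y \<in> Obj C"
  shows "LUnit C (x \<otimes> y) \<cdot> Assoc C (Unit C) x y = LUnit C x \<star> Idt C y"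
proof (rule Unit_TensA_faithful)
  let ?I = "Unit C"
  let ?a = "Assoc C ?I (?I \<otimes> x) y" and ?b = "Assoc C ?I ?I x \<star> Idt C y"
  have "((Idt C ?I \<star> (LUnit C (x \<otimes> y) \<cdot> Assoc C ?I x y)) \<cdot> ?a) \<cdot> ?b
      = (Idt C ?I \<star> LUnit C (x \<otimes> y)) \<cdot> (Idt C ?I \<star> Assoc C ?I x y) \<cdot> ?a \<cdot> ?b"
    using x y by (simp add: interchange_prefix)
  also have "\<dots> = (Idt C ?I \<star> LUnit C (x \<otimes> y)) \<cdot> Assoc C ?I ?I (x \<otimes> y) \<cdot> Assoc C (?I \<otimes> ?I) x y"
    using x y by (simp add: pentagon)
  also have "\<dots> = (RUnit C ?I \<star> (Idt C x \<star> Idt C y)) \<cdot> Assoc C (?I \<otimes> ?I) x y"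
    using x y by (simp add: Comp_prefix[OF triangle])
  also have "\<dots> = Assoc C ?I x y \<cdot> ((RUnit C ?I \<star> Idt C x) \<star> Idt C y)"
    using x y by (subst Assoc_nat) simp_all
  also have "(RUnit C ?I \<star> Idt C x) \<star> Idt C y = ((Idt C ?I \<star> LUnit C x) \<star> Idt C y) \<cdot> ?b"
    using x y by (simp add: interchange triangle)
  also have "Assoc C ?I x y \<cdot> \<dots> = (Assoc C ?I x y \<cdot> ((Idt C ?I \<star> LUnit C x) \<star> Idt C y)) \<cdot> ?b"
    using x y by simp
  also have "\<dots> = ((Idt C ?I \<star> (LUnit C x \<star> Idt C y)) \<cdot> ?a) \<cdot> ?b"
    using x y by (simp add: Assoc_nat)
  finally have "((Idt C ?I \<star> (LUnit C (x \<otimes> y) \<cdot> Assoc C ?I x y)) \<cdot> ?a) \<cdot> ?b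
      = ((Idt C ?I \<star> (LUnit C x \<star> Idt C y)) \<cdot> ?a) \<cdot> ?b" .
  then have "(Idt C ?I \<star> (LUnit C (x \<otimes> y) \<cdot> Assoc C ?I x y)) \<cdot> ?a
      = (Idt C ?I \<star> (LUnit C x \<star> Idt C y)) \<cdot> ?a"
    by (rule iso_cancel_right[rotated -1]) (use x y in \<open>simp_all add: iso_TensA_Idt Assoc_iso\<close>)
  then show "Idt C ?I \<star> (LUnit C (x \<otimes> y) \<cdot> Assoc C ?I x y) = Idt C ?I \<star> (LUnit C x \<star> Idt C y)"
    by (rule iso_cancel_right[rotated -1]) (use x y in \<open>simp_all add: Assoc_iso\<close>)
qed (use x y in simp_all)

lemma LUnit_Unit_TensO:
  assumes "x \<in> Obj C"
  shows "LUnit C (Unit C \<otimes> x) = Idt C (Unit C) \<star> LUnit C x"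
  by (rule iso_cancel_left[OF LUnit_iso[of x]]) (use LUnit_nat[of "LUnit C x" x] assms in simp_all)

text \<open>The two ways to cancel \<open>1\<close> in \<open>(1 \<otimes> 1) \<otimes> 1\<close> agree by \<open>LUnit_TensO\<close> and the triangle, and the
  outer factor can be removed because tensoring with the unit is faithful.\<close>

lemma LUnit_Unit: "LUnit C (Unit C) = RUnit C (Unit C)"
proof (rule TensA_Unit_faithful)
  show "LUnit C (Unit C) \<star> Idt C (Unit C) = RUnit C (Unit C) \<star> Idt C (Unit C)"
    using LUnit_TensO[of "Unit C" "Unit C"] triangle[of "Unit C" "Unit C"]
    by (simp add: LUnit_Unit_TensO)
qed simp_all

end


context monoidal_category
begin

lemma inv_LUnit_simps [simp]:
  assumes "x \<in> Obj C"
  shows "inv_arr C (LUnit C x) \<in> Arr C" "Dm C (inv_arr C (LUnit C x)) = x"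
    "Cd C (inv_arr C (LUnit C x)) = Unit C \<otimes> x"
    "LUnit C x \<cdot> inv_arr C (LUnit C x) = Idt C x"
    "inv_arr C (LUnit C x) \<cdot> LUnit C x = Idt C (Unit C \<otimes> x)"
  using inv_arr_simps[OF LUnit_iso[OF assms]] assms by simp_all

lemma inv_RUnit_simps [simp]:
  assumes "x \<in> Obj C"
  shows "inv_arr C (RUnit C x) \<in> Arr C" "Dm C (inv_arr C (RUnit C x)) = x"
    "Cd C (inv_arr C (RUnit C x)) = x \<otimes> Unit C"
    "RUnit C x \<cdot> inv_arr C (RUnit C x) = Idt C x"
    "inv_arr C (RUnit C x) \<cdot> RUnit C x = Idt C (x \<otimes> Unit C)"
  using inv_arr_simps[OF RUnit_iso[OF assms]] assms by simp_all

lemma inv_LUnit_nat: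
  assumes "f \<in> Arr C" "Dm C f = x"
  shows "(Idt C (Unit C) \<star> f) \<cdot> inv_arr C (LUnit C x) = inv_arr C (LUnit C (Cd C f)) \<cdot> f"
  by (rule iso_cancel_left[OF LUnit_iso[of "Cd C f"]])
    (use assms in \<open>auto simp: Comp_prefix[OF LUnit_nat] Comp_prefix[OF inv_LUnit_simps(4)]\<close>)

text \<open>Both sides are the only canonical map \<open>1 \<rightarrow> 1 \<otimes> (1 \<otimes> 1)\<close>. This is what makes the composition of elements
  \<open>1 \<rightarrow> E(x, y)\<close> associative.\<close>

lemma Assoc_inv_LUnit_Unit:
  "Assoc C (Unit C) (Unit C) (Unit C) \<cdot> (inv_arr C (LUnit C (Unit C)) \<star> Idt C (Unit C)) \<cdot> inv_arr C (LUnit C (Unit C))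
   = (Idt C (Unit C) \<star> inv_arr C (LUnit C (Unit C))) \<cdot> inv_arr C (LUnit C (Unit C))" (is "?l = ?r")
proof (rule iso_cancel_left)
  let ?I = "Unit C"
  show "iso C (LUnit C (?I \<otimes> ?I))" by (simp add: LUnit_iso)
  have "LUnit C (?I \<otimes> ?I) \<cdot> ?l = (LUnit C ?I \<star> Idt C ?I) \<cdot> (inv_arr C (LUnit C ?I) \<star> Idt C ?I) \<cdot> inv_arr C (LUnit C ?I)"
    by (simp add: Comp_prefix[OF LUnit_TensO])
  also have "\<dots> = LUnit C (?I \<otimes> ?I) \<cdot> ?r"
    by (simp add: interchange_prefix LUnit_Unit_TensO)
  finally show "LUnit C (?I \<otimes> ?I) \<cdot> ?l = LUnit C (?I \<otimes> ?I) \<cdot> ?r" .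
qed simp_all

end


section \<open>Elements of enriched categories and change of base\<close>

context enriched_category
begin

declare EHom_closed [simp]

lemma EId_simps [simp]:
  assumes "x \<in> EObj E"
  shows "EId E x \<in> Arr W" "Dm W (EId E x) = Unit W" "Cd W (EId E x) = EHom E x x"
  using EId_closed[OF assms] by (auto simp: in_Hom_iff)

lemma EComp_simps [simp]:
  assumes "x \<in> EObj E" "y \<in> EObj E" "z \<in> EObj E"
  shows "EComp E x y z \<in> Arr W" "Dm W (EComp E x y z) = EHom E y z \<otimes> EHom E x y"
    "Cd W (EComp E x y z) = EHom E x z"
  using EComp_closed[OF assms] by (auto simp: in_Hom_iff)

lemma in_Hom_underlying:
  "a \<in> Hom (underlying W E) x y \<longleftrightarrow>
     (\<exists>e. a = (x, e, y) \<and> x \<in> EObj E \<and> y \<in> EObj E \<and> e \<in> Arr W \<and> Dm W e = Unit W \<and> Cd W e = EHom E x y)"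
  by (auto simp: underlying_def Hom_def)

lemma underlying_simps:
  "Obj (underlying W E) = EObj E" "Idt (underlying W E) x = (x, EId E x, x)"
  "Comp (underlying W E) (y, e', z) (x, e, y') =
     (x, EComp E x y z \<cdot> (e' \<star> e) \<cdot> inv_arr W (LUnit W (Unit W)), z)"
  by (simp_all add: underlying_def)

lemma elements_assoc:
  assumes obj: "w \<in> EObj E" "x \<in> EObj E" "y \<in> EObj E" "z \<in> EObj E"
    and f: "f \<in> Arr W" "Dm W f = Unit W" "Cd W f = EHom E w x"
    and g: "g \<in> Arr W" "Dm W g = Unit W" "Cd W g = EHom E x y"
    and h: "h \<in> Arr W" "Dm W h = Unit W" "Cd W h = EHom E y z"
  defines "l \<equiv> inv_arr W (LUnit W (Unit W))"
  shows "EComp E w x z \<cdot> ((EComp E x y z \<cdot> (h \<star> g) \<cdot> l) \<star> f) \<cdot> l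
       = EComp E w y z \<cdot> (h \<star> (EComp E w x y \<cdot> (g \<star> f) \<cdot> l)) \<cdot> l"
proof -
  let ?I = "Unit W"
  have l: "l \<in> Arr W" "Dm W l = ?I" "Cd W l = ?I \<otimes> ?I" by (simp_all add: l_def)
  have "EComp E w x z \<cdot> ((EComp E x y z \<cdot> (h \<star> g) \<cdot> l) \<star> f) \<cdot> l
      = EComp E w x z \<cdot> (EComp E x y z \<star> Idt W (EHom E w x)) \<cdot> ((h \<star> g) \<star> f) \<cdot> (l \<star> Idt W ?I) \<cdot> l"
    using obj f g h l by (simp add: W.interchange_prefix)
  also have "\<dots> = EComp E w y z \<cdot> (Idt W (EHom E y z) \<star> EComp E w x y)
      \<cdot> Assoc W (EHom E y z) (EHom E x y) (EHom E w x) \<cdot> ((h \<star> g) \<star> f) \<cdot> (l \<star> Idt W ?I) \<cdot> l"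
    using obj f g h l by (simp add: W.Comp_prefix[OF EComp_assoc])
  also have "\<dots> = EComp E w y z \<cdot> (Idt W (EHom E y z) \<star> EComp E w x y)
      \<cdot> (h \<star> (g \<star> f)) \<cdot> Assoc W ?I ?I ?I \<cdot> (l \<star> Idt W ?I) \<cdot> l"
    using obj f g h l by (simp add: W.Comp_prefix[OF W.Assoc_nat])
  also have "\<dots> = EComp E w y z \<cdot> (Idt W (EHom E y z) \<star> EComp E w x y)
      \<cdot> (h \<star> (g \<star> f)) \<cdot> (Idt W ?I \<star> l) \<cdot> l"
    unfolding l_def W.Assoc_inv_LUnit_Unit ..
  also have "\<dots> = EComp E w y z \<cdot> (h \<star> (EComp E w x y \<cdot> (g \<star> f) \<cdot> l)) \<cdot> l"
    using obj f g h l by (simp add: W.interchange_prefix)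
  finally show ?thesis .
qed

lemma element_EId:
  assumes "x \<in> EObj E" "y \<in> EObj E" "e \<in> Arr W" "Dm W e = Unit W" "Cd W e = EHom E x y"
  shows "EComp E x x y \<cdot> (e \<star> EId E x) \<cdot> inv_arr W (LUnit W (Unit W)) = e"
proof -
  have "EComp E x x y \<cdot> (e \<star> EId E x) \<cdot> inv_arr W (LUnit W (Unit W))
     = EComp E x x y \<cdot> (Idt W (EHom E x y) \<star> EId E x) \<cdot> (e \<star> Idt W (Unit W)) \<cdot> inv_arr W (LUnit W (Unit W))"
    using assms by (simp add: W.interchange_prefix)
  also have "\<dots> = RUnit W (EHom E x y) \<cdot> (e \<star> Idt W (Unit W)) \<cdot> inv_arr W (LUnit W (Unit W))"
    using assms by (simp add: W.Comp_prefix[OF EComp_EId])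
  also have "\<dots> = e \<cdot> RUnit W (Unit W) \<cdot> inv_arr W (LUnit W (Unit W))"
    using assms by (simp add: W.Comp_prefix[OF W.RUnit_nat])
  also have "\<dots> = e" using assms by (simp add: W.LUnit_Unit[symmetric])
  finally show ?thesis .
qed

lemma EId_element:
  assumes "x \<in> EObj E" "y \<in> EObj E" "e \<in> Arr W" "Dm W e = Unit W" "Cd W e = EHom E x y"
  shows "EComp E x y y \<cdot> (EId E y \<star> e) \<cdot> inv_arr W (LUnit W (Unit W)) = e"
proof -
  have "EComp E x y y \<cdot> (EId E y \<star> e) \<cdot> inv_arr W (LUnit W (Unit W))
     = EComp E x y y \<cdot> (EId E y \<star> Idt W (EHom E x y)) \<cdot> (Idt W (Unit W) \<star> e) \<cdot> inv_arr W (LUnit W (Unit W))"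
    using assms by (simp add: W.interchange_prefix)
  also have "\<dots> = LUnit W (EHom E x y) \<cdot> (Idt W (Unit W) \<star> e) \<cdot> inv_arr W (LUnit W (Unit W))"
    using assms by (simp add: W.Comp_prefix[OF EId_EComp])
  also have "\<dots> = e"
    using assms by (simp add: W.Comp_prefix[OF W.LUnit_nat])
  finally show ?thesis .
qed

text \<open>Composition of elements inherits its laws from the enriched composition: the enriched axioms are
  evaluated on elements, and the constraints of the unit that appear on both sides cancel.\<close>

lemma category_underlying: "category (underlying W E)"
proof (rule category.intro, goal_cases)
  case (1 f) then show ?case by (auto simp: underlying_def)
next
  case (2 f) then show ?case by (auto simp: underlying_def)
next
  case (3 x) then show ?case by (simp add: underlying_simps in_Hom_underlying)
next
  case (4 f x y g z) then show ?case by (auto simp: underlying_simps in_Hom_underlying)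
next
  case (5 f x y) then show ?case by (auto simp: underlying_simps in_Hom_underlying element_EId)
next
  case (6 f x y) then show ?case by (auto simp: underlying_simps in_Hom_underlying EId_element)
next
  case (7 f w x g y h z) then show ?case
    by (auto simp: underlying_simps in_Hom_underlying elements_assoc)
qed

end

context cat_functor
begin

declare fobj_closed [simp] farr_Idt [simp]

lemma farr_simps [simp]:
  assumes "f \<in> Arr C"
  shows "farr F f \<in> Arr D" "Dm D (farr F f) = fobj F (Dm C f)" "Cd D (farr F f) = fobj F (Cd C f)"
  using farr_closed[of f "Dm C f" "Cd C f"] assms by (auto simp: in_Hom_iff)

lemma farr_comp:
  "f \<in> Arr C \<Longrightarrow> g \<in> Arr C \<Longrightarrow> Cd C f = Dm C g \<Longrightarrow> farr F (g \<cdot>\<^bsub>C\<^esub> f) = farr F g \<cdot>\<^bsub>D\<^esub> farr F f"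
  using farr_Comp[of f "Dm C f" "Cd C f" g "Cd C g"] by (auto simp: in_Hom_iff)

end

context lax_monoidal_functor
begin

lemma mult_simps [simp]:
  assumes "x \<in> Obj C" "y \<in> Obj C"
  shows "\<mu> x y \<in> Arr D" "Dm D (\<mu> x y) = fobj F x \<otimes>\<^bsub>D\<^esub> fobj F y" "Cd D (\<mu> x y) = fobj F (x \<otimes>\<^bsub>C\<^esub> y)"
  using mult_closed[OF assms] by (auto simp: in_Hom_iff)

lemma mult_unit_simps [simp]:
  "\<iota> \<in> Arr D" "Dm D \<iota> = Unit D" "Cd D \<iota> = fobj F (Unit C)"
  using mult_unit_closed by (auto simp: in_Hom_iff)

lemma mult_nat:
  assumes "f \<in> Arr C" "g \<in> Arr C" "Cd C f = x" "Cd C g = y"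
  shows "\<mu> x y \<cdot>\<^bsub>D\<^esub> (farr F f \<star>\<^bsub>D\<^esub> farr F g) = farr F (f \<star>\<^bsub>C\<^esub> g) \<cdot>\<^bsub>D\<^esub> \<mu> (Dm C f) (Dm C g)"
  using mult_natural[of f "Dm C f" x g "Dm C g" y] assms by (auto simp: in_Hom_iff)

lemma mult_nat_left:
  assumes "f \<in> Arr C" "y \<in> Obj C" "Cd C f = x" "y' = fobj F y"
  shows "\<mu> x y \<cdot>\<^bsub>D\<^esub> (farr F f \<star>\<^bsub>D\<^esub> Idt D y') = farr F (f \<star>\<^bsub>C\<^esub> Idt C y) \<cdot>\<^bsub>D\<^esub> \<mu> (Dm C f) y"
  using mult_nat[of f "Idt C y" x y] assms by simp

lemma mult_nat_right:
  assumes "g \<in> Arr C" "x \<in> Obj C" "Cd C g = y" "x' = fobj F x"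
  shows "\<mu> x y \<cdot>\<^bsub>D\<^esub> (Idt D x' \<star>\<^bsub>D\<^esub> farr F g) = farr F (Idt C x \<star>\<^bsub>C\<^esub> g) \<cdot>\<^bsub>D\<^esub> \<mu> x (Dm C g)"
  using mult_nat[of "Idt C x" g x y] assms by simp

text \<open>The unit laws of a lax monoidal functor, solved for the image of the inverted constraint. In this
  form they rewrite the inverted constraints in the composition of elements, \<open>precomp\<close> and \<open>postcomp\<close>.\<close>

lemma mult_inv_LUnit:
  assumes "x \<in> Obj C"
  shows "\<mu> (Unit C) x \<cdot>\<^bsub>D\<^esub> (\<iota> \<star>\<^bsub>D\<^esub> Idt D (fobj F x)) \<cdot>\<^bsub>D\<^esub> inv_arr D (LUnit D (fobj F x))
       = farr F (inv_arr C (LUnit C x))" (is "?l = ?r")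
proof -
  have inv: "farr F (inv_arr C (LUnit C x)) \<cdot>\<^bsub>D\<^esub> farr F (LUnit C x) = Idt D (fobj F (Unit C \<otimes>\<^bsub>C\<^esub> x))"
    using assms by (simp add: farr_comp[symmetric])
  have "?l = farr F (inv_arr C (LUnit C x)) \<cdot>\<^bsub>D\<^esub> (farr F (LUnit C x) \<cdot>\<^bsub>D\<^esub> \<mu> (Unit C) x
       \<cdot>\<^bsub>D\<^esub> (\<iota> \<star>\<^bsub>D\<^esub> Idt D (fobj F x))) \<cdot>\<^bsub>D\<^esub> inv_arr D (LUnit D (fobj F x))"
    using assms by (simp add: D.Comp_prefix[OF inv])
  also have "\<dots> = ?r" unfolding mult_LUnit[OF assms] using assms by simp
  finally show ?thesis .
qed

lemma mult_inv_RUnit: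
  assumes "x \<in> Obj C"
  shows "\<mu> x (Unit C) \<cdot>\<^bsub>D\<^esub> (Idt D (fobj F x) \<star>\<^bsub>D\<^esub> \<iota>) \<cdot>\<^bsub>D\<^esub> inv_arr D (RUnit D (fobj F x))
       = farr F (inv_arr C (RUnit C x))" (is "?l = ?r")
proof -
  have inv: "farr F (inv_arr C (RUnit C x)) \<cdot>\<^bsub>D\<^esub> farr F (RUnit C x) = Idt D (fobj F (x \<otimes>\<^bsub>C\<^esub> Unit C))"
    using assms by (simp add: farr_comp[symmetric])
  have "?l = farr F (inv_arr C (RUnit C x)) \<cdot>\<^bsub>D\<^esub> (farr F (RUnit C x) \<cdot>\<^bsub>D\<^esub> \<mu> x (Unit C)
       \<cdot>\<^bsub>D\<^esub> (Idt D (fobj F x) \<star>\<^bsub>D\<^esub> \<iota>)) \<cdot>\<^bsub>D\<^esub> inv_arr D (RUnit D (fobj F x))"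
    using assms by (simp add: D.Comp_prefix[OF inv])
  also have "\<dots> = ?r" unfolding mult_RUnit[OF assms] using assms by simp
  finally show ?thesis .
qed

end

lemma change_of_base_simps:
  "EObj (change_of_base D F \<mu> \<iota> E) = EObj E"
  "EHom (change_of_base D F \<mu> \<iota> E) x y = fobj F (EHom E x y)"
  "EId (change_of_base D F \<mu> \<iota> E) x = farr F (EId E x) \<cdot>\<^bsub>D\<^esub> \<iota>"
  "EComp (change_of_base D F \<mu> \<iota> E) x y z = farr F (EComp E x y z) \<cdot>\<^bsub>D\<^esub> \<mu> (EHom E y z) (EHom E x y)"
  by (simp_all add: change_of_base_def)

locale enriched_change_of_base = lax_monoidal_functor C D F \<mu> \<iota> + E: enriched_category C E
  for C :: "('o, 'a, 'm) monoidal_cat_scheme" and D :: "('p, 'b, 'n) monoidal_cat_scheme"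
    and F :: "('o, 'a, 'p, 'b) cfunctor" and \<mu> :: "'o \<Rightarrow> 'o \<Rightarrow> 'b" and \<iota> :: "'b"
    and E :: "('x, 'o, 'a) enriched_cat"
begin

abbreviation "FE \<equiv> change_of_base D F \<mu> \<iota> E"

text \<open>Each axiom for the changed category is the image under \<open>F\<close> of the same axiom for \<open>E\<close>, once
  naturality has moved all the maps \<open>\<mu>\<close> to the right, where the coherence of \<open>\<mu>\<close> and \<open>\<iota>\<close> applies.\<close>

lemma enriched_category_change_of_base: "enriched_category D FE"
proof (intro enriched_category.intro enriched_category_axioms.intro, goal_cases)
  case 1 show ?case by (fact D.monoidal_category_axioms)
next
  case (2 x y) then show ?case by (simp add: change_of_base_simps)
next
  case (3 x) then show ?case by (simp add: change_of_base_simps in_Hom_iff)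
next
  case (4 x y z) then show ?case by (simp add: change_of_base_simps in_Hom_iff)
next
  case (5 x y)
  then have xy: "x \<in> EObj E" "y \<in> EObj E" by (simp_all add: change_of_base_simps)
  let ?h = "EHom E x y"
  have "(farr F (EComp E x x y) \<cdot>\<^bsub>D\<^esub> \<mu> ?h (EHom E x x)) \<cdot>\<^bsub>D\<^esub> (Idt D (fobj F ?h) \<star>\<^bsub>D\<^esub> (farr F (EId E x) \<cdot>\<^bsub>D\<^esub> \<iota>))
      = farr F (EComp E x x y) \<cdot>\<^bsub>D\<^esub> \<mu> ?h (EHom E x x) \<cdot>\<^bsub>D\<^esub> (Idt D (fobj F ?h) \<star>\<^bsub>D\<^esub> farr F (EId E x))
          \<cdot>\<^bsub>D\<^esub> (Idt D (fobj F ?h) \<star>\<^bsub>D\<^esub> \<iota>)"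
    using xy by (simp add: D.interchange)
  also have "\<dots> = farr F (EComp E x x y) \<cdot>\<^bsub>D\<^esub> farr F (Idt C ?h \<star>\<^bsub>C\<^esub> EId E x) \<cdot>\<^bsub>D\<^esub> \<mu> ?h (Unit C)
          \<cdot>\<^bsub>D\<^esub> (Idt D (fobj F ?h) \<star>\<^bsub>D\<^esub> \<iota>)"
    using xy by (simp add: D.Comp_prefix[OF mult_nat_right])
  also have "\<dots> = farr F (RUnit C ?h) \<cdot>\<^bsub>D\<^esub> \<mu> ?h (Unit C) \<cdot>\<^bsub>D\<^esub> (Idt D (fobj F ?h) \<star>\<^bsub>D\<^esub> \<iota>)"
    using xy by (simp add: D.Comp_prefix[OF farr_comp[symmetric]] E.EComp_EId)
  also have "\<dots> = RUnit D (fobj F ?h)" using xy by (simp add: mult_RUnit)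
  finally show ?case by (simp add: change_of_base_simps)
next
  case (6 x y)
  then have xy: "x \<in> EObj E" "y \<in> EObj E" by (simp_all add: change_of_base_simps)
  let ?h = "EHom E x y"
  have "(farr F (EComp E x y y) \<cdot>\<^bsub>D\<^esub> \<mu> (EHom E y y) ?h) \<cdot>\<^bsub>D\<^esub> ((farr F (EId E y) \<cdot>\<^bsub>D\<^esub> \<iota>) \<star>\<^bsub>D\<^esub> Idt D (fobj F ?h))
      = farr F (EComp E x y y) \<cdot>\<^bsub>D\<^esub> \<mu> (EHom E y y) ?h \<cdot>\<^bsub>D\<^esub> (farr F (EId E y) \<star>\<^bsub>D\<^esub> Idt D (fobj F ?h))
          \<cdot>\<^bsub>D\<^esub> (\<iota> \<star>\<^bsub>D\<^esub> Idt D (fobj F ?h))"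
    using xy by (simp add: D.interchange)
  also have "\<dots> = farr F (EComp E x y y) \<cdot>\<^bsub>D\<^esub> farr F (EId E y \<star>\<^bsub>C\<^esub> Idt C ?h) \<cdot>\<^bsub>D\<^esub> \<mu> (Unit C) ?h
          \<cdot>\<^bsub>D\<^esub> (\<iota> \<star>\<^bsub>D\<^esub> Idt D (fobj F ?h))"
    using xy by (simp add: D.Comp_prefix[OF mult_nat_left])
  also have "\<dots> = farr F (LUnit C ?h) \<cdot>\<^bsub>D\<^esub> \<mu> (Unit C) ?h \<cdot>\<^bsub>D\<^esub> (\<iota> \<star>\<^bsub>D\<^esub> Idt D (fobj F ?h))"
    using xy by (simp add: D.Comp_prefix[OF farr_comp[symmetric]] E.EId_EComp)
  also have "\<dots> = LUnit D (fobj F ?h)" using xy by (simp add: mult_LUnit)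
  finally show ?case by (simp add: change_of_base_simps)
next
  case (7 w x y z)
  then have o: "w \<in> EObj E" "x \<in> EObj E" "y \<in> EObj E" "z \<in> EObj E" by (simp_all add: change_of_base_simps)
  let ?a = "EHom E y z" and ?b = "EHom E x y" and ?c = "EHom E w x"
  let ?\<alpha> = "Assoc C ?a ?b ?c" and ?\<alpha>' = "Assoc D (fobj F ?a) (fobj F ?b) (fobj F ?c)"
  have "(farr F (EComp E w x z) \<cdot>\<^bsub>D\<^esub> \<mu> (EHom E x z) ?c)
        \<cdot>\<^bsub>D\<^esub> ((farr F (EComp E x y z) \<cdot>\<^bsub>D\<^esub> \<mu> ?a ?b) \<star>\<^bsub>D\<^esub> Idt D (fobj F ?c))
      = farr F (EComp E w x z) \<cdot>\<^bsub>D\<^esub> \<mu> (EHom E x z) ?c \<cdot>\<^bsub>D\<^esub> (farr F (EComp E x y z) \<star>\<^bsub>D\<^esub> Idt D (fobj F ?c))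
        \<cdot>\<^bsub>D\<^esub> (\<mu> ?a ?b \<star>\<^bsub>D\<^esub> Idt D (fobj F ?c))"
    using o by (simp add: D.interchange)
  also have "\<dots> = farr F (EComp E w x z) \<cdot>\<^bsub>D\<^esub> farr F (EComp E x y z \<star>\<^bsub>C\<^esub> Idt C ?c) \<cdot>\<^bsub>D\<^esub> \<mu> (?a \<otimes>\<^bsub>C\<^esub> ?b) ?c
        \<cdot>\<^bsub>D\<^esub> (\<mu> ?a ?b \<star>\<^bsub>D\<^esub> Idt D (fobj F ?c))"
    using o by (simp add: D.Comp_prefix[OF mult_nat_left])
  also have "\<dots> = farr F (EComp E w y z \<cdot>\<^bsub>C\<^esub> (Idt C ?a \<star>\<^bsub>C\<^esub> EComp E w x y) \<cdot>\<^bsub>C\<^esub> ?\<alpha>) \<cdot>\<^bsub>D\<^esub> \<mu> (?a \<otimes>\<^bsub>C\<^esub> ?b) ?c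
        \<cdot>\<^bsub>D\<^esub> (\<mu> ?a ?b \<star>\<^bsub>D\<^esub> Idt D (fobj F ?c))"
    using o by (simp add: D.Comp_prefix[OF farr_comp[symmetric]] E.EComp_assoc)
  also have "\<dots> = farr F (EComp E w y z) \<cdot>\<^bsub>D\<^esub> farr F (Idt C ?a \<star>\<^bsub>C\<^esub> EComp E w x y)
        \<cdot>\<^bsub>D\<^esub> farr F ?\<alpha> \<cdot>\<^bsub>D\<^esub> \<mu> (?a \<otimes>\<^bsub>C\<^esub> ?b) ?c \<cdot>\<^bsub>D\<^esub> (\<mu> ?a ?b \<star>\<^bsub>D\<^esub> Idt D (fobj F ?c))"
    using o by (simp add: farr_comp)
  also have "\<dots> = farr F (EComp E w y z) \<cdot>\<^bsub>D\<^esub> farr F (Idt C ?a \<star>\<^bsub>C\<^esub> EComp E w x y)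
        \<cdot>\<^bsub>D\<^esub> \<mu> ?a (?b \<otimes>\<^bsub>C\<^esub> ?c) \<cdot>\<^bsub>D\<^esub> (Idt D (fobj F ?a) \<star>\<^bsub>D\<^esub> \<mu> ?b ?c) \<cdot>\<^bsub>D\<^esub> ?\<alpha>'"
    using o by (simp add: mult_Assoc)
  also have "\<dots> = farr F (EComp E w y z) \<cdot>\<^bsub>D\<^esub> \<mu> ?a (EHom E w y)
        \<cdot>\<^bsub>D\<^esub> (Idt D (fobj F ?a) \<star>\<^bsub>D\<^esub> farr F (EComp E w x y)) \<cdot>\<^bsub>D\<^esub> (Idt D (fobj F ?a) \<star>\<^bsub>D\<^esub> \<mu> ?b ?c) \<cdot>\<^bsub>D\<^esub> ?\<alpha>'"
    using o by (simp add: D.Comp_prefix[OF mult_nat_right])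
  also have "\<dots> = (farr F (EComp E w y z) \<cdot>\<^bsub>D\<^esub> \<mu> ?a (EHom E w y))
        \<cdot>\<^bsub>D\<^esub> (Idt D (fobj F ?a) \<star>\<^bsub>D\<^esub> (farr F (EComp E w x y) \<cdot>\<^bsub>D\<^esub> \<mu> ?b ?c)) \<cdot>\<^bsub>D\<^esub> ?\<alpha>'"
    using o by (simp add: D.interchange_prefix)
  finally show ?case by (simp add: change_of_base_simps)
qed

lemma change_of_base_name_simps:
  assumes "e \<in> Arr C" "Dm C e = Unit C"
  shows "change_of_base_name D F \<iota> e \<in> Arr D" "Dm D (change_of_base_name D F \<iota> e) = Unit D"
    "Cd D (change_of_base_name D F \<iota> e) = fobj F (Cd C e)"
  using assms by (simp_all add: change_of_base_name_def)

text \<open>Reduces composition with a name in \<open>F\<^sub>*E\<close> to the image of composition in \<open>E\<close>; naturality statements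
  about \<open>F\<^sub>*E\<close> thereby become statements about arrows \<open>F g\<close>.\<close>

lemma precomp_change_of_base:
  assumes "x' \<in> EObj E" "x \<in> EObj E" "y \<in> EObj E" "e \<in> Arr C" "Dm C e = Unit C" "Cd C e = EHom E x' x"
  shows "precomp D FE x' x y (change_of_base_name D F \<iota> e) = farr F (precomp C E x' x y e)"
proof -
  let ?h = "EHom E x y" and ?h' = "EHom E x' x"
  let ?r = "inv_arr D (RUnit D (fobj F ?h))"
  have "precomp D FE x' x y (change_of_base_name D F \<iota> e)
      = farr F (EComp E x' x y) \<cdot>\<^bsub>D\<^esub> \<mu> ?h ?h' \<cdot>\<^bsub>D\<^esub> (Idt D (fobj F ?h) \<star>\<^bsub>D\<^esub> farr F e)
          \<cdot>\<^bsub>D\<^esub> (Idt D (fobj F ?h) \<star>\<^bsub>D\<^esub> \<iota>) \<cdot>\<^bsub>D\<^esub> ?r"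
    using assms by (simp add: precomp_def change_of_base_name_def change_of_base_simps D.interchange_prefix)
  also have "\<dots> = farr F (EComp E x' x y) \<cdot>\<^bsub>D\<^esub> farr F (Idt C ?h \<star>\<^bsub>C\<^esub> e)
          \<cdot>\<^bsub>D\<^esub> \<mu> ?h (Unit C) \<cdot>\<^bsub>D\<^esub> (Idt D (fobj F ?h) \<star>\<^bsub>D\<^esub> \<iota>) \<cdot>\<^bsub>D\<^esub> ?r"
    using assms by (simp add: D.Comp_prefix[OF mult_nat_right])
  also have "\<dots> = farr F (precomp C E x' x y e)"
    using assms by (simp add: mult_inv_RUnit precomp_def farr_comp)
  finally show ?thesis .
qed

lemma postcomp_change_of_base:
  assumes "x \<in> EObj E" "y \<in> EObj E" "y' \<in> EObj E" "e \<in> Arr C" "Dm C e = Unit C" "Cd C e = EHom E y y'"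
  shows "postcomp D FE x y y' (change_of_base_name D F \<iota> e) = farr F (postcomp C E x y y' e)"
proof -
  let ?h = "EHom E x y" and ?h' = "EHom E y y'"
  let ?l = "inv_arr D (LUnit D (fobj F ?h))"
  have "postcomp D FE x y y' (change_of_base_name D F \<iota> e)
      = farr F (EComp E x y y') \<cdot>\<^bsub>D\<^esub> \<mu> ?h' ?h \<cdot>\<^bsub>D\<^esub> (farr F e \<star>\<^bsub>D\<^esub> Idt D (fobj F ?h))
          \<cdot>\<^bsub>D\<^esub> (\<iota> \<star>\<^bsub>D\<^esub> Idt D (fobj F ?h)) \<cdot>\<^bsub>D\<^esub> ?l"
    using assms by (simp add: postcomp_def change_of_base_name_def change_of_base_simps D.interchange_prefix)
  also have "\<dots> = farr F (EComp E x y y') \<cdot>\<^bsub>D\<^esub> farr F (e \<star>\<^bsub>C\<^esub> Idt C ?h)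
          \<cdot>\<^bsub>D\<^esub> \<mu> (Unit C) ?h \<cdot>\<^bsub>D\<^esub> (\<iota> \<star>\<^bsub>D\<^esub> Idt D (fobj F ?h)) \<cdot>\<^bsub>D\<^esub> ?l"
    using assms by (simp add: D.Comp_prefix[OF mult_nat_left])
  also have "\<dots> = farr F (postcomp C E x y y' e)"
    using assms by (simp add: mult_inv_LUnit postcomp_def farr_comp)
  finally show ?thesis .
qed

lemma change_of_base_name_comp:
  assumes "x \<in> EObj E" "y \<in> EObj E" "z \<in> EObj E"
    and "e \<in> Arr C" "Dm C e = Unit C" "Cd C e = EHom E x y"
    and "e' \<in> Arr C" "Dm C e' = Unit C" "Cd C e' = EHom E y z"
  shows "change_of_base_name D F \<iota> (EComp E x y z \<cdot>\<^bsub>C\<^esub> (e' \<star>\<^bsub>C\<^esub> e) \<cdot>\<^bsub>C\<^esub> inv_arr C (LUnit C (Unit C)))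
       = EComp FE x y z \<cdot>\<^bsub>D\<^esub> (change_of_base_name D F \<iota> e' \<star>\<^bsub>D\<^esub> change_of_base_name D F \<iota> e)
           \<cdot>\<^bsub>D\<^esub> inv_arr D (LUnit D (Unit D))"
proof -
  let ?I = "Unit C" and ?J = "Unit D"
  have \<iota>\<iota>: "\<mu> ?I ?I \<cdot>\<^bsub>D\<^esub> (\<iota> \<star>\<^bsub>D\<^esub> \<iota>) \<cdot>\<^bsub>D\<^esub> inv_arr D (LUnit D ?J) = farr F (inv_arr C (LUnit C ?I)) \<cdot>\<^bsub>D\<^esub> \<iota>"
  proof -
    have "\<mu> ?I ?I \<cdot>\<^bsub>D\<^esub> (\<iota> \<star>\<^bsub>D\<^esub> \<iota>) \<cdot>\<^bsub>D\<^esub> inv_arr D (LUnit D ?J)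
        = \<mu> ?I ?I \<cdot>\<^bsub>D\<^esub> (\<iota> \<star>\<^bsub>D\<^esub> Idt D (fobj F ?I)) \<cdot>\<^bsub>D\<^esub> (Idt D ?J \<star>\<^bsub>D\<^esub> \<iota>) \<cdot>\<^bsub>D\<^esub> inv_arr D (LUnit D ?J)"
      by (simp add: D.interchange_prefix)
    also have "\<dots> = (\<mu> ?I ?I \<cdot>\<^bsub>D\<^esub> (\<iota> \<star>\<^bsub>D\<^esub> Idt D (fobj F ?I)) \<cdot>\<^bsub>D\<^esub> inv_arr D (LUnit D (fobj F ?I))) \<cdot>\<^bsub>D\<^esub> \<iota>"
      by (simp add: D.inv_LUnit_nat)
    finally show ?thesis by (simp only: mult_inv_LUnit[OF C.Unit_closed])
  qed
  have "EComp FE x y z \<cdot>\<^bsub>D\<^esub> (change_of_base_name D F \<iota> e' \<star>\<^bsub>D\<^esub> change_of_base_name D F \<iota> e)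
           \<cdot>\<^bsub>D\<^esub> inv_arr D (LUnit D (Unit D))
      = farr F (EComp E x y z) \<cdot>\<^bsub>D\<^esub> \<mu> (EHom E y z) (EHom E x y) \<cdot>\<^bsub>D\<^esub> (farr F e' \<star>\<^bsub>D\<^esub> farr F e)
          \<cdot>\<^bsub>D\<^esub> (\<iota> \<star>\<^bsub>D\<^esub> \<iota>) \<cdot>\<^bsub>D\<^esub> inv_arr D (LUnit D ?J)"
    using assms by (simp add: change_of_base_simps change_of_base_name_def D.interchange_prefix)
  also have "\<dots> = farr F (EComp E x y z) \<cdot>\<^bsub>D\<^esub> farr F (e' \<star>\<^bsub>C\<^esub> e) \<cdot>\<^bsub>D\<^esub> \<mu> ?I ?I
          \<cdot>\<^bsub>D\<^esub> (\<iota> \<star>\<^bsub>D\<^esub> \<iota>) \<cdot>\<^bsub>D\<^esub> inv_arr D (LUnit D ?J)"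
    using assms by (simp add: D.Comp_prefix[OF mult_nat])
  also have "\<dots> = change_of_base_name D F \<iota> (EComp E x y z \<cdot>\<^bsub>C\<^esub> (e' \<star>\<^bsub>C\<^esub> e) \<cdot>\<^bsub>C\<^esub> inv_arr C (LUnit C (Unit C)))"
    using assms by (simp add: \<iota>\<iota> change_of_base_name_def farr_comp)
  finally show ?thesis by simp
qed

end

lemma enriched_over_change_of_base:
  assumes "lax_monoidal_functor C D F \<mu> \<iota>" and "enriched_over C E B nm"
  shows "enriched_over D (change_of_base D F \<mu> \<iota> E) B (\<lambda>f. change_of_base_name D F \<iota> (nm f))"
proof -
  interpret E: enriched_over C E B nm by fact
  interpret lax_monoidal_functor C D F \<mu> \<iota> by fact
  interpret enriched_change_of_base C D F \<mu> \<iota> E ..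
  interpret FE: enriched_category D FE by (rule enriched_category_change_of_base)
  interpret N: cat_functor B "underlying C E" "\<lparr> fobj = (\<lambda>x. x), farr = (\<lambda>f. (Dm B f, nm f, Cd B f)) \<rparr>"
    by (rule E.name_functor)
  have nm: "x \<in> EObj E \<and> y \<in> EObj E \<and> nm f \<in> Arr C \<and> Dm C (nm f) = Unit C \<and> Cd C (nm f) = EHom E x y"
    if "f \<in> Hom B x y" for f x y
    using N.farr_closed[OF that] by (auto simp: E.in_Hom_underlying)
  show ?thesis
  proof (intro enriched_over.intro enriched_over_axioms.intro cat_functor.intro cat_functor_axioms.intro,
      goal_cases)
    case 1 show ?case by (rule enriched_category_change_of_base)
  next
    case 2 show ?case by (simp add: change_of_base_simps E.Obj_EObj)
  next
    case 3 show ?case by (rule N.C.category_axioms)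
  next
    case 4 show ?case by (rule FE.category_underlying)
  next
    case (5 x) then show ?case by (simp add: FE.underlying_simps change_of_base_simps E.Obj_EObj)
  next
    case (6 f x y)
    from nm[OF this] this show ?case
      unfolding FE.in_Hom_underlying
      by (auto simp: change_of_base_simps change_of_base_name_simps in_Hom_iff)
  next
    case (7 x)
    from N.farr_Idt[OF this] this show ?case
      by (simp add: FE.underlying_simps E.underlying_simps change_of_base_simps change_of_base_name_def)
  next
    case (8 f x y g z)
    then have "g \<cdot>\<^bsub>B\<^esub> f \<in> Arr B \<and> Dm B (g \<cdot>\<^bsub>B\<^esub> f) = x \<and> Cd B (g \<cdot>\<^bsub>B\<^esub> f) = z"
      by (auto simp: in_Hom_iff)
    moreover have "Dm B f = x" "Cd B f = y" "Dm B g = y" "Cd B g = z" using 8 by (auto simp: in_Hom_iff)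
    ultimately show ?case
      using N.farr_Comp[OF 8] nm[OF 8(1)] nm[OF 8(2)]
      by (simp add: FE.underlying_simps E.underlying_simps change_of_base_name_comp)
  qed
qed


section \<open>The self-enrichment of a closed category\<close>

context closed_symmetric_monoidal_category
begin

declare IHom_closed [simp]

lemma Ev_simps [simp]:
  assumes "x \<in> Obj C" "y \<in> Obj C"
  shows "Ev C x y \<in> Arr C" "Dm C (Ev C x y) = IHom C x y \<otimes> x" "Cd C (Ev C x y) = y"
  using Ev_closed[OF assms] by (auto simp: in_Hom_iff)

text \<open>Every identity between maps into an internal hom below is proved by comparing transposes, that is,
  after evaluation.\<close>

lemma Ev_cancel:
  assumes "x \<in> Obj C" "y \<in> Obj C"
    and "g \<in> Arr C" "h \<in> Arr C" "Dm C g = Dm C h" "Cd C g = IHom C x y" "Cd C h = IHom C x y"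
    and "Ev C x y \<cdot> (g \<star> Idt C x) = Ev C x y \<cdot> (h \<star> Idt C x)"
  shows "g = h"
proof -
  have "Ev C x y \<cdot> (h \<star> Idt C x) \<in> Hom C (Dm C h \<otimes> x) y" using assms by (simp add: in_Hom_iff)
  from Ev_universal[OF assms(1,2) Dm_in[OF assms(4)] this] show ?thesis
    using assms by (auto simp: in_Hom_iff)
qed

lemma curry_arr_simps:
  assumes "f \<in> Arr C" "Dm C f = z \<otimes> x" "z \<in> Obj C" "x \<in> Obj C" "Cd C f = y"
  shows "curry_arr C z x y f \<in> Arr C" "Dm C (curry_arr C z x y f) = z"
    "Cd C (curry_arr C z x y f) = IHom C x y" "Ev C x y \<cdot> (curry_arr C z x y f \<star> Idt C x) = f"
proof -
  have y: "y \<in> Obj C" using assms by auto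
  have "f \<in> Hom C (z \<otimes> x) y" using assms by (simp add: in_Hom_iff)
  from theI'[OF Ev_universal[OF assms(4) y assms(3) this], folded curry_arr_def]
  show "curry_arr C z x y f \<in> Arr C" "Dm C (curry_arr C z x y f) = z"
    "Cd C (curry_arr C z x y f) = IHom C x y" "Ev C x y \<cdot> (curry_arr C z x y f \<star> Idt C x) = f"
    by (auto simp: in_Hom_iff)
qed

abbreviation "SE \<equiv> self_enrichment C"

lemma self_enrichment_simps:
  "EObj SE = Obj C" "EHom SE x y = IHom C x y"
  by (simp_all add: self_enrichment_def)

lemma self_EId_simps [simp]:
  assumes "x \<in> Obj C"
  shows "EId SE x \<in> Arr C" "Dm C (EId SE x) = Unit C" "Cd C (EId SE x) = IHom C x x"
  using curry_arr_simps[of "LUnit C x" "Unit C" x x] assms by (simp_all add: self_enrichment_def)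

lemma Ev_self_EId: "x \<in> Obj C \<Longrightarrow> Ev C x x \<cdot> (EId SE x \<star> Idt C x) = LUnit C x"
  using curry_arr_simps[of "LUnit C x" "Unit C" x x] by (simp add: self_enrichment_def)

lemma self_EComp:
  assumes "x \<in> Obj C" "y \<in> Obj C" "z \<in> Obj C"
  shows self_EComp_Arr [simp]: "EComp SE x y z \<in> Arr C"
    and self_EComp_Dm [simp]: "Dm C (EComp SE x y z) = IHom C y z \<otimes> IHom C x y"
    and self_EComp_Cd [simp]: "Cd C (EComp SE x y z) = IHom C x z"
    and Ev_self_EComp: "Ev C x z \<cdot> (EComp SE x y z \<star> Idt C x)
      = Ev C y z \<cdot> (Idt C (IHom C y z) \<star> Ev C x y) \<cdot> Assoc C (IHom C y z) (IHom C x y) x"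
  using curry_arr_simps[of "Ev C y z \<cdot> (Idt C (IHom C y z) \<star> Ev C x y) \<cdot> Assoc C (IHom C y z) (IHom C x y) x"
      "IHom C y z \<otimes> IHom C x y" x z] assms
  by (simp_all add: self_enrichment_def)

text \<open>The transpose of a composite of generalized elements is the composite of their transposes. All
  the axioms of the self-enrichment are read off from this formula.\<close>

lemma Ev_self_EComp_TensA:
  assumes "x \<in> Obj C" "y \<in> Obj C" "z \<in> Obj C" "a \<in> Arr C" "b \<in> Arr C"
    "Cd C a = IHom C x y" "Cd C b = IHom C y z"
  shows "Ev C x z \<cdot> ((EComp SE x y z \<cdot> (b \<star> a)) \<star> Idt C x)
    = Ev C y z \<cdot> (b \<star> (Ev C x y \<cdot> (a \<star> Idt C x))) \<cdot> Assoc C (Dm C b) (Dm C a) x"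
proof -
  have "Ev C x z \<cdot> ((EComp SE x y z \<cdot> (b \<star> a)) \<star> Idt C x)
      = Ev C x z \<cdot> (EComp SE x y z \<star> Idt C x) \<cdot> ((b \<star> a) \<star> Idt C x)"
    using assms by (simp add: interchange)
  also have "\<dots> = Ev C y z \<cdot> (Idt C (IHom C y z) \<star> Ev C x y) \<cdot> Assoc C (IHom C y z) (IHom C x y) x
      \<cdot> ((b \<star> a) \<star> Idt C x)"
    using assms by (simp add: Comp_prefix[OF Ev_self_EComp])
  also have "\<dots> = Ev C y z \<cdot> (b \<star> (Ev C x y \<cdot> (a \<star> Idt C x))) \<cdot> Assoc C (Dm C b) (Dm C a) x"
    using assms by (simp add: Assoc_nat interchange_prefix)
  finally show ?thesis .
qed

lemma enriched_category_self: "enriched_category C SE"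
proof (intro enriched_category.intro enriched_category_axioms.intro, goal_cases)
  case 1 show ?case by (fact monoidal_category_axioms)
next
  case (2 x y) then show ?case by (simp add: self_enrichment_simps)
next
  case (3 x) then show ?case by (simp add: self_enrichment_simps in_Hom_iff)
next
  case (4 x y z) then show ?case by (simp add: self_enrichment_simps in_Hom_iff)
next
  case (5 x y)
  then have o: "x \<in> Obj C" "y \<in> Obj C" by (simp_all add: self_enrichment_simps)
  let ?h = "IHom C x y"
  have "Ev C x y \<cdot> ((EComp SE x x y \<cdot> (Idt C ?h \<star> EId SE x)) \<star> Idt C x)
      = Ev C x y \<cdot> (RUnit C ?h \<star> Idt C x)"
    using o by (simp add: Ev_self_EComp_TensA Ev_self_EId triangle)
  then have "EComp SE x x y \<cdot> (Idt C ?h \<star> EId SE x) = RUnit C ?h"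
    by (rule Ev_cancel[rotated -1]) (use o in simp_all)
  then show ?case by (simp add: self_enrichment_simps)
next
  case (6 x y)
  then have o: "x \<in> Obj C" "y \<in> Obj C" by (simp_all add: self_enrichment_simps)
  let ?h = "IHom C x y"
  have "Ev C x y \<cdot> ((EComp SE x y y \<cdot> (EId SE y \<star> Idt C ?h)) \<star> Idt C x)
      = Ev C y y \<cdot> (EId SE y \<star> Idt C y) \<cdot> (Idt C (Unit C) \<star> Ev C x y) \<cdot> Assoc C (Unit C) ?h x"
    using o by (simp add: Ev_self_EComp_TensA interchange_prefix)
  also have "\<dots> = Ev C x y \<cdot> LUnit C (?h \<otimes> x) \<cdot> Assoc C (Unit C) ?h x"
    using o by (simp add: Comp_prefix[OF Ev_self_EId] Comp_prefix[OF LUnit_nat])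
  also have "\<dots> = Ev C x y \<cdot> (LUnit C ?h \<star> Idt C x)"
    using o by (simp add: LUnit_TensO)
  finally have "EComp SE x y y \<cdot> (EId SE y \<star> Idt C ?h) = LUnit C ?h"
    by (rule Ev_cancel[rotated -1]) (use o in simp_all)
  then show ?case by (simp add: self_enrichment_simps)
next
  case (7 w x y z)
  then have o: "w \<in> Obj C" "x \<in> Obj C" "y \<in> Obj C" "z \<in> Obj C" by (simp_all add: self_enrichment_simps)
  let ?a = "IHom C y z" and ?b = "IHom C x y" and ?c = "IHom C w x"
  have "Ev C w z \<cdot> ((EComp SE w x z \<cdot> (EComp SE x y z \<star> Idt C ?c)) \<star> Idt C w)
      = Ev C x z \<cdot> (EComp SE x y z \<star> Idt C x) \<cdot> (Idt C (?a \<otimes> ?b) \<star> Ev C w x) \<cdot> Assoc C (?a \<otimes> ?b) ?c w"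
    using o by (simp add: Ev_self_EComp_TensA interchange_prefix)
  also have "\<dots> = Ev C y z \<cdot> (Idt C ?a \<star> Ev C x y) \<cdot> Assoc C ?a ?b x
      \<cdot> ((Idt C ?a \<star> Idt C ?b) \<star> Ev C w x) \<cdot> Assoc C (?a \<otimes> ?b) ?c w"
    using o by (simp add: Comp_prefix[OF Ev_self_EComp])
  also have "\<dots> = Ev C y z \<cdot> (Idt C ?a \<star> Ev C x y)
      \<cdot> (Idt C ?a \<star> (Idt C ?b \<star> Ev C w x)) \<cdot> Assoc C ?a ?b (?c \<otimes> w) \<cdot> Assoc C (?a \<otimes> ?b) ?c w"
    using o by (simp add: Comp_prefix[OF Assoc_nat] del: TensA_Idt)
  also have "\<dots> = Ev C y z \<cdot> (Idt C ?a \<star> Ev C x y) \<cdot> (Idt C ?a \<star> (Idt C ?b \<star> Ev C w x))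
      \<cdot> (Idt C ?a \<star> Assoc C ?b ?c w) \<cdot> Assoc C ?a (?b \<otimes> ?c) w \<cdot> (Assoc C ?a ?b ?c \<star> Idt C w)"
    using o by (simp add: pentagon)
  also have "\<dots> = (Ev C y z \<cdot> (Idt C ?a \<star> (Ev C w y \<cdot> (EComp SE w x y \<star> Idt C w)))
      \<cdot> Assoc C ?a (?b \<otimes> ?c) w) \<cdot> (Assoc C ?a ?b ?c \<star> Idt C w)"
    using o by (simp add: Ev_self_EComp interchange_prefix)
  also have "\<dots> = (Ev C w z \<cdot> ((EComp SE w y z \<cdot> (Idt C ?a \<star> EComp SE w x y)) \<star> Idt C w))
      \<cdot> (Assoc C ?a ?b ?c \<star> Idt C w)"
    using o by (simp add: Ev_self_EComp_TensA)
  also have "\<dots> = Ev C w z \<cdot> ((EComp SE w y z \<cdot> (Idt C ?a \<star> EComp SE w x y) \<cdot> Assoc C ?a ?b ?c) \<star> Idt C w)"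
    using o by (simp add: interchange)
  finally have "EComp SE w x z \<cdot> (EComp SE x y z \<star> Idt C ?c)
      = EComp SE w y z \<cdot> (Idt C ?a \<star> EComp SE w x y) \<cdot> Assoc C ?a ?b ?c"
    by (rule Ev_cancel[rotated -1]) (use o in simp_all)
  then show ?case by (simp add: self_enrichment_simps)
qed

lemma self_name:
  assumes "f \<in> Arr C" "Dm C f = x" "Cd C f = y"
  shows self_name_Arr: "self_name C f \<in> Arr C" and self_name_Dm: "Dm C (self_name C f) = Unit C"
    and self_name_Cd: "Cd C (self_name C f) = IHom C x y"
    and Ev_self_name: "Ev C x y \<cdot> (self_name C f \<star> Idt C x) = f \<cdot> LUnit C x"
  using curry_arr_simps[of "f \<cdot> LUnit C x" "Unit C" x y] assms by (auto simp: self_name_def)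

lemma self_name_comp:
  assumes f: "f \<in> Arr C" "Dm C f = x" "Cd C f = y" and g: "g \<in> Arr C" "Dm C g = y" "Cd C g = z"
  shows "self_name C (g \<cdot> f)
    = EComp SE x y z \<cdot> (self_name C g \<star> self_name C f) \<cdot> inv_arr C (LUnit C (Unit C))"
proof -
  let ?I = "Unit C" and ?l = "inv_arr C (LUnit C (Unit C))"
  have o: "x \<in> Obj C" "y \<in> Obj C" "z \<in> Obj C" using f g by auto
  note [simp] = self_name_Arr self_name_Dm self_name_Cd[OF f] self_name_Cd[OF g]
  have "Ev C x z \<cdot> ((EComp SE x y z \<cdot> (self_name C g \<star> self_name C f) \<cdot> ?l) \<star> Idt C x)
      = (Ev C x z \<cdot> ((EComp SE x y z \<cdot> (self_name C g \<star> self_name C f)) \<star> Idt C x)) \<cdot> (?l \<star> Idt C x)"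
    using o f g by (simp add: interchange)
  also have "\<dots> = Ev C y z \<cdot> (self_name C g \<star> (f \<cdot> LUnit C x)) \<cdot> Assoc C ?I ?I x \<cdot> (?l \<star> Idt C x)"
    using o f g by (subst Ev_self_EComp_TensA) (simp_all add: Ev_self_name)
  also have "\<dots> = Ev C y z \<cdot> (self_name C g \<star> Idt C y) \<cdot> (Idt C ?I \<star> f) \<cdot> (Idt C ?I \<star> LUnit C x)
      \<cdot> Assoc C ?I ?I x \<cdot> (?l \<star> Idt C x)"
    using o f g by (simp add: interchange_prefix)
  also have "\<dots> = g \<cdot> LUnit C y \<cdot> (Idt C ?I \<star> f) \<cdot> (RUnit C ?I \<star> Idt C x) \<cdot> (?l \<star> Idt C x)"
    using o f g by (simp add: Comp_prefix[OF Ev_self_name] Comp_prefix[OF triangle])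
  also have "\<dots> = g \<cdot> f \<cdot> LUnit C x"
    using o f g by (simp add: interchange LUnit_Unit[symmetric] LUnit_nat)
  also have "\<dots> = Ev C x z \<cdot> (self_name C (g \<cdot> f) \<star> Idt C x)"
    using o f g by (subst Ev_self_name) simp_all
  finally have "EComp SE x y z \<cdot> (self_name C g \<star> self_name C f) \<cdot> ?l = self_name C (g \<cdot> f)"
    by (rule Ev_cancel[rotated -1]) (use o f g self_name_Cd[of "g \<cdot> f"] in simp_all)
  then show ?thesis by simp
qed

lemma enriched_over_self: "enriched_over C SE C (self_name C)"
proof -
  interpret SE: enriched_category C SE by (rule enriched_category_self)
  show ?thesis
  proof (intro enriched_over.intro enriched_over_axioms.intro cat_functor.intro cat_functor_axioms.intro,
      goal_cases)
    case 1 show ?case by (rule enriched_category_self)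
  next
    case 2 show ?case by (simp add: self_enrichment_simps)
  next
    case 3 show ?case by (rule category_axioms)
  next
    case 4 show ?case by (rule SE.category_underlying)
  next
    case (5 x) then show ?case by (simp add: SE.underlying_simps self_enrichment_simps)
  next
    case (6 f x y) then show ?case
      unfolding SE.in_Hom_underlying
      by (auto simp: self_enrichment_simps in_Hom_iff self_name_Arr self_name_Dm self_name_Cd)
  next
    case (7 x) then show ?case
      by (simp add: SE.underlying_simps) (simp add: self_name_def self_enrichment_def)
  next
    case (8 f x y g z)
    then show ?case by (auto simp: SE.underlying_simps in_Hom_iff self_name_comp)
  qed
qed

text \<open>Composition with the name of \<open>f\<close> is the functorial action of the internal hom on \<open>f\<close>, here
  characterized by its transpose.\<close>

lemma precomp_self:
  assumes "f \<in> Arr C" "Dm C f = x'" "Cd C f = x" "y \<in> Obj C"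
  shows precomp_self_Arr: "precomp C SE x' x y (self_name C f) \<in> Arr C"
    and precomp_self_Dm: "Dm C (precomp C SE x' x y (self_name C f)) = IHom C x y"
    and precomp_self_Cd: "Cd C (precomp C SE x' x y (self_name C f)) = IHom C x' y"
    and Ev_precomp_self: "Ev C x' y \<cdot> (precomp C SE x' x y (self_name C f) \<star> Idt C x')
      = Ev C x y \<cdot> (Idt C (IHom C x y) \<star> f)"
proof -
  let ?h = "IHom C x y" and ?n = "self_name C f" and ?r = "inv_arr C (RUnit C (IHom C x y))"
  have o: "x \<in> Obj C" "x' \<in> Obj C" using assms by auto
  note [simp] = self_name_Arr self_name_Dm self_name_Cd[OF assms(1-3)]
  have p: "precomp C SE x' x y ?n = EComp SE x' x y \<cdot> (Idt C ?h \<star> ?n) \<cdot> ?r"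
    by (simp add: precomp_def self_enrichment_simps)
  show "precomp C SE x' x y ?n \<in> Arr C" "Dm C (precomp C SE x' x y ?n) = ?h"
    "Cd C (precomp C SE x' x y ?n) = IHom C x' y"
    using o assms by (simp_all add: p)
  have "Ev C x' y \<cdot> (precomp C SE x' x y ?n \<star> Idt C x')
      = (Ev C x' y \<cdot> ((EComp SE x' x y \<cdot> (Idt C ?h \<star> ?n)) \<star> Idt C x')) \<cdot> (?r \<star> Idt C x')"
    using o assms by (simp add: p interchange)
  also have "\<dots> = Ev C x y \<cdot> (Idt C ?h \<star> (f \<cdot> LUnit C x')) \<cdot> Assoc C ?h (Unit C) x' \<cdot> (?r \<star> Idt C x')"
    using o assms by (subst Ev_self_EComp_TensA) (simp_all add: Ev_self_name)
  also have "\<dots> = Ev C x y \<cdot> (Idt C ?h \<star> f) \<cdot> (Idt C ?h \<star> LUnit C x') \<cdot> Assoc C ?h (Unit C) x' \<cdot> (?r \<star> Idt C x')"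
    using o assms by (simp add: interchange_prefix)
  also have "\<dots> = Ev C x y \<cdot> (Idt C ?h \<star> f)"
    using o assms by (simp add: Comp_prefix[OF triangle] interchange)
  finally show "Ev C x' y \<cdot> (precomp C SE x' x y ?n \<star> Idt C x') = Ev C x y \<cdot> (Idt C ?h \<star> f)" .
qed

lemma postcomp_self:
  assumes "g \<in> Arr C" "Dm C g = y" "Cd C g = y'" "x \<in> Obj C"
  shows postcomp_self_Arr: "postcomp C SE x y y' (self_name C g) \<in> Arr C"
    and postcomp_self_Dm: "Dm C (postcomp C SE x y y' (self_name C g)) = IHom C x y"
    and postcomp_self_Cd: "Cd C (postcomp C SE x y y' (self_name C g)) = IHom C x y'"
    and Ev_postcomp_self: "Ev C x y' \<cdot> (postcomp C SE x y y' (self_name C g) \<star> Idt C x) = g \<cdot> Ev C x y"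
proof -
  let ?h = "IHom C x y" and ?n = "self_name C g" and ?l = "inv_arr C (LUnit C (IHom C x y))"
  have o: "y \<in> Obj C" "y' \<in> Obj C" using assms by auto
  note [simp] = self_name_Arr self_name_Dm self_name_Cd[OF assms(1-3)]
  have p: "postcomp C SE x y y' ?n = EComp SE x y y' \<cdot> (?n \<star> Idt C ?h) \<cdot> ?l"
    by (simp add: postcomp_def self_enrichment_simps)
  show "postcomp C SE x y y' ?n \<in> Arr C" "Dm C (postcomp C SE x y y' ?n) = ?h"
    "Cd C (postcomp C SE x y y' ?n) = IHom C x y'"
    using o assms by (simp_all add: p)
  have "Ev C x y' \<cdot> (postcomp C SE x y y' ?n \<star> Idt C x)
      = (Ev C x y' \<cdot> ((EComp SE x y y' \<cdot> (?n \<star> Idt C ?h)) \<star> Idt C x)) \<cdot> (?l \<star> Idt C x)"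
    using o assms by (simp add: p interchange)
  also have "\<dots> = Ev C y y' \<cdot> (?n \<star> Ev C x y) \<cdot> Assoc C (Unit C) ?h x \<cdot> (?l \<star> Idt C x)"
    using o assms by (subst Ev_self_EComp_TensA) simp_all
  also have "\<dots> = Ev C y y' \<cdot> (?n \<star> Idt C y) \<cdot> (Idt C (Unit C) \<star> Ev C x y) \<cdot> Assoc C (Unit C) ?h x \<cdot> (?l \<star> Idt C x)"
    using o assms by (simp add: interchange_prefix)
  also have "\<dots> = g \<cdot> Ev C x y \<cdot> LUnit C (?h \<otimes> x) \<cdot> Assoc C (Unit C) ?h x \<cdot> (?l \<star> Idt C x)"
    using o assms by (simp add: Comp_prefix[OF Ev_self_name] Comp_prefix[OF LUnit_nat])
  also have "\<dots> = g \<cdot> Ev C x y"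
    using o assms by (simp add: Comp_prefix[OF LUnit_TensO] interchange)
  finally show "Ev C x y' \<cdot> (postcomp C SE x y y' ?n \<star> Idt C x) = g \<cdot> Ev C x y" .
qed

end


section \<open>Adjunctions as natural bijections\<close>

text \<open>An adjunction presented by its bijections \<open>C(A, R v) \<cong> D(L A, v)\<close>. This presentation is closed under
  composition by composing bijections. Naturality determines the functoriality of \<open>L\<close> and \<open>R\<close>, so only
  their actions are recorded.\<close>

locale hom_adjunction = C: category C + D: category D
  for C :: "('o, 'a, 'm) cat_scheme" and D :: "('p, 'b, 'n) cat_scheme" +
  fixes L :: "('o, 'a, 'p, 'b) cfunctor" and R :: "('p, 'b, 'o, 'a) cfunctor"
    and \<tau> :: "'o \<Rightarrow> 'p \<Rightarrow> 'a \<Rightarrow> 'b"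
  assumes L_obj: "A \<in> Obj C \<Longrightarrow> fobj L A \<in> Obj D"
    and L_arr: "f \<in> Hom C A B \<Longrightarrow> farr L f \<in> Hom D (fobj L A) (fobj L B)"
    and R_obj: "v \<in> Obj D \<Longrightarrow> fobj R v \<in> Obj C"
    and R_arr: "g \<in> Hom D u v \<Longrightarrow> farr R g \<in> Hom C (fobj R u) (fobj R v)"
    and transpose_bij: "A \<in> Obj C \<Longrightarrow> v \<in> Obj D \<Longrightarrow>
           bij_betw (\<tau> A v) (Hom C A (fobj R v)) (Hom D (fobj L A) v)"
    and transpose_left: "f \<in> Hom C A B \<Longrightarrow> v \<in> Obj D \<Longrightarrow> a \<in> Hom C B (fobj R v) \<Longrightarrow>
           \<tau> A v (a \<cdot>\<^bsub>C\<^esub> f) = \<tau> B v a \<cdot>\<^bsub>D\<^esub> farr L f"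
    and transpose_right: "A \<in> Obj C \<Longrightarrow> g \<in> Hom D u v \<Longrightarrow> a \<in> Hom C A (fobj R u) \<Longrightarrow>
           \<tau> A v (farr R g \<cdot>\<^bsub>C\<^esub> a) = g \<cdot>\<^bsub>D\<^esub> \<tau> A u a"
begin

lemma transpose_closed:
  "A \<in> Obj C \<Longrightarrow> v \<in> Obj D \<Longrightarrow> a \<in> Hom C A (fobj R v) \<Longrightarrow> \<tau> A v a \<in> Hom D (fobj L A) v"
  using transpose_bij by (auto simp: bij_betw_def)

lemma transpose_cancel:
  "A \<in> Obj C \<Longrightarrow> v \<in> Obj D \<Longrightarrow> a \<in> Hom C A (fobj R v) \<Longrightarrow> b \<in> Hom C A (fobj R v) \<Longrightarrow>
   \<tau> A v a = \<tau> A v b \<Longrightarrow> a = b"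
  using transpose_bij[of A v] by (auto simp: bij_betw_def inj_on_def)

lemma transpose_obtain:
  assumes "A \<in> Obj C" "v \<in> Obj D" "b \<in> Hom D (fobj L A) v"
  obtains a where "a \<in> Hom C A (fobj R v)" "\<tau> A v a = b"
proof -
  from assms(3) have "b \<in> \<tau> A v ` Hom C A (fobj R v)"
    using transpose_bij[OF assms(1,2)] by (simp add: bij_betw_def)
  then show thesis using that by blast
qed

lemma L_initial:
  assumes "initial C z"
  shows "initial D (fobj L z)"
  unfolding initial_def
proof (intro conjI ballI)
  have z: "z \<in> Obj C" using assms by (simp add: initial_def)
  then show "fobj L z \<in> Obj D" by (rule L_obj)
  fix v assume v: "v \<in> Obj D"
  then obtain a where a: "a \<in> Hom C z (fobj R v)" "\<And>b. b \<in> Hom C z (fobj R v) \<Longrightarrow> b = a"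
    using assms R_obj unfolding initial_def by blast
  show "\<exists>!f. f \<in> Hom D (fobj L z) v"
  proof (rule ex1I)
    show "\<tau> z v a \<in> Hom D (fobj L z) v" by (rule transpose_closed[OF z v a(1)])
    fix f assume "f \<in> Hom D (fobj L z) v"
    then show "f = \<tau> z v a" by (metis transpose_obtain[OF z v] a(2))
  qed
qed

text \<open>A lifting problem of \<open>i\<close> against \<open>R p\<close> and its transpose, of \<open>L i\<close> against \<open>p\<close>, have the same solutions.\<close>

lemma has_lifting_transpose:
  assumes i: "i \<in> Arr C" and p: "p \<in> Arr D" and lift: "has_lifting D (farr L i) p"
  shows "has_lifting C i (farr R p)"
  unfolding has_lifting_def
proof (intro ballI impI)
  let ?A = "Dm C i" and ?B = "Cd C i" and ?x = "Dm D p" and ?y = "Cd D p"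
  have A: "?A \<in> Obj C" and B: "?B \<in> Obj C" and x: "?x \<in> Obj D" and y: "?y \<in> Obj D"
    using i p by simp_all
  have iH: "i \<in> Hom C ?A ?B" and pH: "p \<in> Hom D ?x ?y" using i p by (simp_all add: in_Hom_iff)
  have Rp: "farr R p \<in> Hom C (fobj R ?x) (fobj R ?y)" by (rule R_arr[OF pH])
  have Li: "farr L i \<in> Hom D (fobj L ?A) (fobj L ?B)" by (rule L_arr[OF iH])
  fix u v
  assume "u \<in> Hom C ?A (Dm C (farr R p))" "v \<in> Hom C ?B (Cd C (farr R p))"
    and sq: "farr R p \<cdot>\<^bsub>C\<^esub> u = v \<cdot>\<^bsub>C\<^esub> i"
  then have u: "u \<in> Hom C ?A (fobj R ?x)" and v: "v \<in> Hom C ?B (fobj R ?y)"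
    using Rp by (simp_all add: in_Hom_iff)
  have "p \<cdot>\<^bsub>D\<^esub> \<tau> ?A ?x u = \<tau> ?B ?y v \<cdot>\<^bsub>D\<^esub> farr L i"
    using transpose_right[OF A pH u] transpose_left[OF iH y v] sq by simp
  then obtain h where h: "h \<in> Hom D (fobj L ?B) ?x" "h \<cdot>\<^bsub>D\<^esub> farr L i = \<tau> ?A ?x u" "p \<cdot>\<^bsub>D\<^esub> h = \<tau> ?B ?y v"
    using lift transpose_closed[OF A x u] transpose_closed[OF B y v] Li
    unfolding has_lifting_def by (metis (no_types, lifting) in_Hom_iff)
  obtain k where k: "k \<in> Hom C ?B (fobj R ?x)" "\<tau> ?B ?x k = h" by (rule transpose_obtain[OF B x h(1)])
  have "k \<cdot>\<^bsub>C\<^esub> i = u"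
    by (rule transpose_cancel[OF A x]) (use k u h transpose_left[OF iH x k(1)] C.Comp_closed[OF iH k(1)] in auto)
  moreover have "farr R p \<cdot>\<^bsub>C\<^esub> k = v"
    by (rule transpose_cancel[OF B y]) (use k v h transpose_right[OF B pH k(1)] C.Comp_closed[OF k(1) Rp] in auto)
  ultimately show "\<exists>h\<in>Hom C ?B (Dm C (farr R p)). h \<cdot>\<^bsub>C\<^esub> i = u \<and> farr R p \<cdot>\<^bsub>C\<^esub> h = v"
    using k(1) Rp by (auto simp: in_Hom_iff)
qed

end

definition functor_comp ::
  "('p, 'b, 'q, 'c) cfunctor \<Rightarrow> ('o, 'a, 'p, 'b) cfunctor \<Rightarrow> ('o, 'a, 'q, 'c) cfunctor" where
  "functor_comp K H = \<lparr> fobj = (\<lambda>x. fobj K (fobj H x)), farr = (\<lambda>f. farr K (farr H f)) \<rparr>"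

lemma functor_comp_simps [simp]:
  "fobj (functor_comp K H) x = fobj K (fobj H x)" "farr (functor_comp K H) f = farr K (farr H f)"
  by (simp_all add: functor_comp_def)

lemma hom_adjunction_comp:
  assumes "hom_adjunction B C L R \<sigma>" and "hom_adjunction C D L' R' \<tau>"
  shows "hom_adjunction B D (functor_comp L' L) (functor_comp R R') (\<lambda>A v a. \<tau> (fobj L A) v (\<sigma> A (fobj R' v) a))"
proof -
  interpret s: hom_adjunction B C L R \<sigma> by fact
  interpret t: hom_adjunction C D L' R' \<tau> by fact
  show ?thesis
  proof (intro hom_adjunction.intro hom_adjunction_axioms.intro, goal_cases)
    case 1 show ?case by (rule s.C.category_axioms)
  next
    case 2 show ?case by (rule t.D.category_axioms)
  next
    case (3 A) then show ?case by (simp add: s.L_obj t.L_obj)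
  next
    case (4 f A A') then show ?case by (simp add: s.L_arr t.L_arr)
  next
    case (5 v) then show ?case by (simp add: s.R_obj t.R_obj)
  next
    case (6 g u v) then show ?case by (simp add: s.R_arr t.R_arr)
  next
    case (7 A v)
    then show ?case
      using bij_betw_trans[OF s.transpose_bij[of A "fobj R' v"] t.transpose_bij[of "fobj L A" v]]
      by (simp add: s.L_obj t.R_obj comp_def)
  next
    case (8 f A A' v a)
    then have "A' \<in> Obj B" by (auto simp: in_Hom_iff)
    with 8 show ?case
      using t.transpose_left[OF s.L_arr[OF 8(1)] 8(2)]
      by (simp add: s.transpose_left t.R_obj s.transpose_closed)
  next
    case (9 A g u v a)
    then have "u \<in> Obj D" by (auto simp: in_Hom_iff)
    with 9 show ?case
      by (simp add: s.transpose_right[OF _ t.R_arr] t.transpose_right s.transpose_closed s.L_obj t.R_obj)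
  qed
qed

context adjunction
begin

lemma unit_simps [simp]:
  assumes "x \<in> Obj C"
  shows "\<eta> x \<in> Arr C" "Dm C (\<eta> x) = x" "Cd C (\<eta> x) = fobj G (fobj F x)"
  using unit_closed[OF assms] by (auto simp: in_Hom_iff)

lemma counit_simps [simp]:
  assumes "v \<in> Obj D"
  shows "\<epsilon> v \<in> Arr D" "Dm D (\<epsilon> v) = fobj F (fobj G v)" "Cd D (\<epsilon> v) = v"
  using counit_closed[OF assms] by (auto simp: in_Hom_iff)

lemma hom_adjunction:
  "hom_adjunction C D F G (\<lambda>x v a. \<epsilon> v \<cdot>\<^bsub>D\<^esub> farr F a)"
proof (intro hom_adjunction.intro hom_adjunction_axioms.intro, goal_cases)
  case 1 show ?case by (rule F.C.category_axioms)
next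
  case 2 show ?case by (rule F.D.category_axioms)
next
  case (3 x) then show ?case by simp
next
  case (4 f x y) then show ?case by (rule F.farr_closed)
next
  case (5 v) then show ?case by simp
next
  case (6 g u v) then show ?case by (rule G.farr_closed)
next
  case (7 x v)
  show ?case
  proof (rule bij_betw_byWitness[where f' = "\<lambda>b. farr G b \<cdot>\<^bsub>C\<^esub> \<eta> x"])
    show "(\<lambda>a. \<epsilon> v \<cdot>\<^bsub>D\<^esub> farr F a) ` Hom C x (fobj G v) \<subseteq> Hom D (fobj F x) v"
      using 7 by (auto simp: in_Hom_iff)
    show "(\<lambda>b. farr G b \<cdot>\<^bsub>C\<^esub> \<eta> x) ` Hom D (fobj F x) v \<subseteq> Hom C x (fobj G v)"
      using 7 by (auto simp: in_Hom_iff)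
    show "\<forall>a\<in>Hom C x (fobj G v). farr G (\<epsilon> v \<cdot>\<^bsub>D\<^esub> farr F a) \<cdot>\<^bsub>C\<^esub> \<eta> x = a"
    proof
      fix a assume a: "a \<in> Hom C x (fobj G v)"
      have "farr G (\<epsilon> v \<cdot>\<^bsub>D\<^esub> farr F a) \<cdot>\<^bsub>C\<^esub> \<eta> x = farr G (\<epsilon> v) \<cdot>\<^bsub>C\<^esub> farr G (farr F a) \<cdot>\<^bsub>C\<^esub> \<eta> x"
        using 7 a by (simp add: in_Hom_iff G.farr_comp)
      also have "\<dots> = (farr G (\<epsilon> v) \<cdot>\<^bsub>C\<^esub> \<eta> (fobj G v)) \<cdot>\<^bsub>C\<^esub> a"
        using 7 a unit_natural[OF a] by (simp add: in_Hom_iff)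
      also have "\<dots> = a" unfolding triangle_G[OF 7(2)] using 7 a by (simp add: in_Hom_iff)
      finally show "farr G (\<epsilon> v \<cdot>\<^bsub>D\<^esub> farr F a) \<cdot>\<^bsub>C\<^esub> \<eta> x = a" .
    qed
    show "\<forall>b\<in>Hom D (fobj F x) v. \<epsilon> v \<cdot>\<^bsub>D\<^esub> farr F (farr G b \<cdot>\<^bsub>C\<^esub> \<eta> x) = b"
    proof
      fix b assume b: "b \<in> Hom D (fobj F x) v"
      have "\<epsilon> v \<cdot>\<^bsub>D\<^esub> farr F (farr G b \<cdot>\<^bsub>C\<^esub> \<eta> x) = (\<epsilon> v \<cdot>\<^bsub>D\<^esub> farr F (farr G b)) \<cdot>\<^bsub>D\<^esub> farr F (\<eta> x)"
        using 7 b by (simp add: in_Hom_iff F.farr_comp)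
      also have "\<dots> = b \<cdot>\<^bsub>D\<^esub> \<epsilon> (fobj F x) \<cdot>\<^bsub>D\<^esub> farr F (\<eta> x)"
        unfolding counit_natural[OF b] using 7 b by (simp add: in_Hom_iff)
      also have "\<dots> = b" unfolding triangle_F[OF 7(1)] using 7 b by (simp add: in_Hom_iff)
      finally show "\<epsilon> v \<cdot>\<^bsub>D\<^esub> farr F (farr G b \<cdot>\<^bsub>C\<^esub> \<eta> x) = b" .
    qed
  qed
next
  case (8 f x y v a)
  then have "\<epsilon> v \<in> Hom D (fobj F (fobj G v)) v" by (simp add: counit_closed)
  with 8 show ?case by (auto simp: in_Hom_iff F.farr_comp)
next
  case (9 x g u v a)
  then have *: "\<epsilon> v \<in> Hom D (fobj F (fobj G v)) v" "\<epsilon> u \<in> Hom D (fobj F (fobj G u)) u"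
    by (auto simp: counit_closed in_Hom_iff)
  have "\<epsilon> v \<cdot>\<^bsub>D\<^esub> farr F (farr G g \<cdot>\<^bsub>C\<^esub> a) = (\<epsilon> v \<cdot>\<^bsub>D\<^esub> farr F (farr G g)) \<cdot>\<^bsub>D\<^esub> farr F a"
    using 9 * by (auto simp: in_Hom_iff F.farr_comp)
  also have "\<dots> = g \<cdot>\<^bsub>D\<^esub> \<epsilon> u \<cdot>\<^bsub>D\<^esub> farr F a"
    unfolding counit_natural[OF 9(2)] using 9 * by (auto simp: in_Hom_iff)
  finally show ?case .
qed

end

definition (in closed_symmetric_monoidal_category) tensor_functor :: "'o \<Rightarrow> ('o, 'a, 'o, 'a) cfunctor" where
  "tensor_functor w = \<lparr> fobj = (\<lambda>x. x \<otimes> w), farr = (\<lambda>f. f \<star> Idt C w) \<rparr>"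

definition (in closed_symmetric_monoidal_category) hom_functor :: "'o \<Rightarrow> ('o, 'a, 'o, 'a) cfunctor" where
  "hom_functor w = \<lparr> fobj = IHom C w,
     farr = (\<lambda>g. postcomp C (self_enrichment C) w (Dm C g) (Cd C g) (self_name C g)) \<rparr>"

lemma (in closed_symmetric_monoidal_category) hom_adjunction_tensor:
  assumes w: "w \<in> Obj C"
  shows "hom_adjunction C C (tensor_functor w) (hom_functor w) (\<lambda>x y a. Ev C w y \<cdot> (a \<star> Idt C w))"
proof (intro hom_adjunction.intro hom_adjunction_axioms.intro, goal_cases)
  case 1 show ?case by (rule category_axioms)
next
  case 2 show ?case by (rule category_axioms)
next
  case (3 x) then show ?case using w by (simp add: tensor_functor_def)
next
  case (4 f x y) then show ?case using w by (auto simp: tensor_functor_def in_Hom_iff)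
next
  case (5 y) then show ?case using w by (simp add: hom_functor_def)
next
  case (6 g y z) then show ?case
    using w by (auto simp: hom_functor_def in_Hom_iff postcomp_self_Arr postcomp_self_Dm postcomp_self_Cd)
next
  case (7 x y)
  show ?case
  proof (rule bij_betw_byWitness[where f' = "curry_arr C x w y"])
    show "(\<lambda>a. Ev C w y \<cdot> (a \<star> Idt C w)) ` Hom C x (fobj (hom_functor w) y) \<subseteq> Hom C (fobj (tensor_functor w) x) y"
      using 7 w by (auto simp: in_Hom_iff tensor_functor_def hom_functor_def)
    show "curry_arr C x w y ` Hom C (fobj (tensor_functor w) x) y \<subseteq> Hom C x (fobj (hom_functor w) y)"
      using 7 w by (auto simp: in_Hom_iff tensor_functor_def hom_functor_def curry_arr_simps)
    show "\<forall>a\<in>Hom C x (fobj (hom_functor w) y). curry_arr C x w y (Ev C w y \<cdot> (a \<star> Idt C w)) = a"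
      by (rule ballI, rule Ev_cancel[OF w 7(2)]) (use 7 w in \<open>auto simp: in_Hom_iff hom_functor_def curry_arr_simps\<close>)
    show "\<forall>b\<in>Hom C (fobj (tensor_functor w) x) y. Ev C w y \<cdot> (curry_arr C x w y b \<star> Idt C w) = b"
      using 7 w by (auto simp: in_Hom_iff tensor_functor_def curry_arr_simps)
  qed
next
  case (8 f x x' y a)
  then show ?case using w by (auto simp: tensor_functor_def hom_functor_def in_Hom_iff interchange)
next
  case (9 x g y z a)
  then have g: "g \<in> Arr C" "Dm C g = y" "Cd C g = z" and a: "a \<in> Arr C" "Dm C a = x" "Cd C a = IHom C w y"
    by (auto simp: hom_functor_def in_Hom_iff)
  then have o: "y \<in> Obj C" "z \<in> Obj C" by auto
  let ?R = "postcomp C (self_enrichment C) w y z (self_name C g)"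
  note [simp] = postcomp_self_Arr[OF g w] postcomp_self_Dm[OF g w] postcomp_self_Cd[OF g w]
  have "Ev C w z \<cdot> ((?R \<cdot> a) \<star> Idt C w) = (Ev C w z \<cdot> (?R \<star> Idt C w)) \<cdot> (a \<star> Idt C w)"
    using w a o by (simp add: interchange)
  also have "\<dots> = g \<cdot> Ev C w y \<cdot> (a \<star> Idt C w)"
    unfolding Ev_postcomp_self[OF g w] using g w a o by simp
  finally show ?case using g by (simp add: hom_functor_def)
qed


section \<open>Right homotopy in a model category\<close>

text \<open>The lifting property by which cofibrant objects enter the homotopy theory below; the lifting
  axiom propagates it along cofibrations (\<open>projective_Cof\<close>).\<close>

definition projective :: "('o, 'a, 'm) cat_scheme \<Rightarrow> 'a model \<Rightarrow> 'o \<Rightarrow> bool" where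
  "projective C M x \<longleftrightarrow> x \<in> Obj C \<and>
     (\<forall>p\<in>Fib M \<inter> Weq M. \<forall>b\<in>Hom C x (Cd C p). \<exists>a\<in>Hom C x (Dm C p). p \<cdot>\<^bsub>C\<^esub> a = b)"

lemma initialE:
  assumes "initial C z" "x \<in> Obj C"
  obtains f where "f \<in> Hom C z x" "\<And>g. g \<in> Hom C z x \<Longrightarrow> g = f"
  using assms unfolding initial_def by blast

lemma initial_unique: "initial C z \<Longrightarrow> x \<in> Obj C \<Longrightarrow> f \<in> Hom C z x \<Longrightarrow> g \<in> Hom C z x \<Longrightarrow> f = g"
  unfolding initial_def by blast

lemma terminal_unique: "terminal C t \<Longrightarrow> x \<in> Obj C \<Longrightarrow> f \<in> Hom C x t \<Longrightarrow> g \<in> Hom C x t \<Longrightarrow> f = g"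
  unfolding terminal_def by blast

context model_category
begin

lemma Weq_in [simp]: "f \<in> Weq M \<Longrightarrow> f \<in> Arr C" and Cof_in [simp]: "f \<in> Cof M \<Longrightarrow> f \<in> Arr C"
  and Fib_in [simp]: "f \<in> Fib M \<Longrightarrow> f \<in> Arr C"
  using Weq_Arr Cof_Arr Fib_Arr by auto

lemma has_liftingE:
  assumes "has_lifting C i p" "u \<in> Hom C (Dm C i) (Dm C p)" "v \<in> Hom C (Cd C i) (Cd C p)" "p \<cdot> u = v \<cdot> i"
  obtains h where "h \<in> Hom C (Cd C i) (Dm C p)" "h \<cdot> i = u" "p \<cdot> h = v"
  using assms unfolding has_lifting_def by blast

lemma initial_exists: "\<exists>z. initial C z"
proof -
  let ?J = "\<lparr> Obj = {}, Arr = {}, Dm = id, Cd = id, Idt = id, Comp = (\<lambda>f g. f) \<rparr> :: (nat, nat) cat"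
  let ?D = "\<lparr> fobj = (\<lambda>_. undefined), farr = (\<lambda>_. undefined) \<rparr> :: (nat, nat, 'o, 'a) cfunctor"
  have J: "category ?J" by unfold_locales (simp_all add: Hom_def)
  have "cat_functor ?J C ?D"
    by (intro cat_functor.intro cat_functor_axioms.intro J category_axioms) (simp_all add: Hom_def)
  with J obtain x p where "is_colimit ?J C ?D x p"
    using finite_colimits unfolding has_finite_colimits_def finite_category_def by force
  then have "initial C x"
    unfolding initial_def is_colimit_def cocone_def by simp
  then show ?thesis ..
qed

text \<open>The product of \<open>v\<close> with itself, as the limit of the constant diagram on two objects.\<close>

lemma square_exists:
  assumes v: "v \<in> Obj C"
  obtains P p q where "p \<in> Hom C P v" "q \<in> Hom C P v"
    "\<And>x a b. x \<in> Obj C \<Longrightarrow> a \<in> Hom C x v \<Longrightarrow> b \<in> Hom C x v \<Longrightarrow> \<exists>u\<in>Hom C x P. p \<cdot> u = a \<and> q \<cdot> u = b"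
    "\<And>x u u'. u \<in> Hom C x P \<Longrightarrow> u' \<in> Hom C x P \<Longrightarrow> p \<cdot> u = p \<cdot> u' \<Longrightarrow> q \<cdot> u = q \<cdot> u' \<Longrightarrow> u = u'"
proof -
  let ?J = "\<lparr> Obj = {0, 1}, Arr = {0, 1}, Dm = id, Cd = id, Idt = id, Comp = (\<lambda>f g. f) \<rparr> :: (nat, nat) cat"
  let ?D = "\<lparr> fobj = (\<lambda>_. v), farr = (\<lambda>_. Idt C v) \<rparr> :: (nat, nat, 'o, 'a) cfunctor"
  have J: "category ?J" by unfold_locales (auto simp: Hom_def)
  have "cat_functor ?J C ?D"
    by (intro cat_functor.intro cat_functor_axioms.intro J category_axioms) (use v in \<open>auto simp: in_Hom_iff\<close>)
  with J obtain P p where lim: "is_limit ?J C ?D P p"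
    using finite_limits unfolding has_finite_limits_def finite_category_def by force
  have cone: "cone ?J C ?D x r \<longleftrightarrow> x \<in> Obj C \<and> r 0 \<in> Hom C x v \<and> r 1 \<in> Hom C x v" for x and r :: "nat \<Rightarrow> 'a"
    unfolding cone_def using v by (auto simp: in_Hom_iff)
  from lim have P: "p 0 \<in> Hom C P v" "p 1 \<in> Hom C P v"
    unfolding is_limit_def cone by blast+
  have univ: "\<exists>!u. u \<in> Hom C x P \<and> p 0 \<cdot> u = r 0 \<and> p 1 \<cdot> u = r 1"
    if "x \<in> Obj C" "r 0 \<in> Hom C x v" "r 1 \<in> Hom C x v" for x and r :: "nat \<Rightarrow> 'a"
  proof -
    from that have "cone ?J C ?D x r" by (simp only: cone)
    with lim have "\<exists>!u. u \<in> Hom C x P \<and> (\<forall>i\<in>Obj ?J. p i \<cdot> u = r i)"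
      unfolding is_limit_def by blast
    then show ?thesis by (simp del: One_nat_def)
  qed
  show thesis
  proof (rule that)
    show "p 0 \<in> Hom C P v" "p 1 \<in> Hom C P v" by fact+
    show "\<exists>u\<in>Hom C x P. p 0 \<cdot> u = a \<and> p 1 \<cdot> u = b"
      if "x \<in> Obj C" "a \<in> Hom C x v" "b \<in> Hom C x v" for x a b
      using univ[of x "\<lambda>i. if i = 0 then a else b"] that by auto
    show "u = u'" if u: "u \<in> Hom C x P" "u' \<in> Hom C x P" "p 0 \<cdot> u = p 0 \<cdot> u'" "p 1 \<cdot> u = p 1 \<cdot> u'" for x u u'
    proof -
      have "x \<in> Obj C" using u(1) by (auto simp: in_Hom_iff)
      then show ?thesis
        using univ[of x "\<lambda>i. p i \<cdot> u"] Comp_closed[OF u(1) P(1)] Comp_closed[OF u(1) P(2)] u by auto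
    qed
  qed
qed

text \<open>The retract argument: a lift of \<open>i\<close> against \<open>q i\<close> retracts \<open>q\<close> onto \<open>q i\<close>. Applied to the factorizations,
  it shows that fibrations and acyclic fibrations are determined by their lifting properties.\<close>

lemma retract_of_lifting:
  assumes i: "i \<in> Hom C x z" and q: "q \<in> Hom C z y" and lift: "has_lifting C i (q \<cdot> i)"
  shows "is_retract C (q \<cdot> i) q"
proof -
  have *: "i \<in> Arr C" "q \<in> Arr C" "Cd C i = Dm C q" using i q by (auto simp: in_Hom_iff)
  obtain r where "r \<in> Hom C z x" "r \<cdot> i = Idt C x" "(q \<cdot> i) \<cdot> r = q"
    by (rule has_liftingE[OF lift, of "Idt C x" q]) (use i q * in \<open>auto simp: in_Hom_iff\<close>)
  then show ?thesis
    unfolding is_retract_def using i q *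
    by (intro conjI bexI[of _ i] bexI[of _ r] bexI[of _ "Idt C y"]) (auto simp: in_Hom_iff)
qed

lemma acyclic_FibI:
  assumes "p \<in> Arr C" and lift: "\<And>i. i \<in> Cof M \<Longrightarrow> has_lifting C i p"
  shows "p \<in> Fib M \<inter> Weq M"
proof -
  have "p \<in> Hom C (Dm C p) (Cd C p)" using assms by (simp add: in_Hom_iff)
  from factor_acyclic_Fib[OF this] obtain z i q where
    "i \<in> Hom C (Dm C p) z" "q \<in> Hom C z (Cd C p)" "i \<in> Cof M" "q \<in> Fib M \<inter> Weq M" "q \<cdot> i = p" by blast
  with retract_of_lifting[of i _ z q] lift[of i] have "is_retract C p q" "q \<in> Fib M" "q \<in> Weq M"
    by auto
  then show ?thesis using Fib_retract Weq_retract by blast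
qed

lemma FibI:
  assumes "p \<in> Arr C" and lift: "\<And>i. i \<in> Cof M \<inter> Weq M \<Longrightarrow> has_lifting C i p"
  shows "p \<in> Fib M"
proof -
  have "p \<in> Hom C (Dm C p) (Cd C p)" using assms by (simp add: in_Hom_iff)
  from factor_acyclic_Cof[OF this] obtain z i q where
    "i \<in> Hom C (Dm C p) z" "q \<in> Hom C z (Cd C p)" "i \<in> Cof M \<inter> Weq M" "q \<in> Fib M" "q \<cdot> i = p" by blast
  with retract_of_lifting[of i _ z q] lift[of i] have "is_retract C p q" "q \<in> Fib M"
    by auto
  then show ?thesis by (rule Fib_retract)
qed

lemma Idt_Weq:
  assumes x: "x \<in> Obj C"
  shows "Idt C x \<in> Weq M"
proof -
  have "Idt C x \<in> Hom C x x" using x by (simp add: in_Hom_iff)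
  from factor_acyclic_Cof[OF this] obtain z i p where
    *: "i \<in> Hom C x z" "p \<in> Hom C z x" "i \<in> Weq M" "p \<cdot> i = Idt C x" by blast
  \<comment> \<open>An identity is a retract of every arrow that has a retraction.\<close>
  have "is_retract C (Idt C x) i"
    unfolding is_retract_def using x *
    by (intro conjI bexI[of _ "Idt C x"] bexI[of _ i] bexI[of _ p]) (auto simp: in_Hom_iff)
  with * show ?thesis by (rule_tac Weq_retract)
qed

lemma Weq_section:
  assumes "p \<in> Hom C x y" "p \<in> Weq M" "s \<in> Hom C y x" "p \<cdot> s = Idt C y"
  shows "s \<in> Weq M"
proof (rule two_of_three_right[OF assms(3,1,2)])
  have "y \<in> Obj C" using assms by (auto simp: in_Hom_iff)
  then show "p \<cdot> s \<in> Weq M" by (simp add: assms(4) Idt_Weq)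
qed

lemma projectiveE:
  assumes "projective C M x" "p \<in> Fib M" "p \<in> Weq M" "p \<in> Hom C e y" "b \<in> Hom C x y"
  obtains a where "a \<in> Hom C x e" "p \<cdot> a = b"
proof -
  have "Dm C p = e" "Cd C p = y" using assms(4) by (simp_all add: in_Hom_iff)
  then show thesis using assms that unfolding projective_def by blast
qed

lemma projective_section:
  assumes "projective C M y" "p \<in> Fib M" "p \<in> Weq M" "p \<in> Hom C x y"
  obtains s where "s \<in> Hom C y x" "p \<cdot> s = Idt C y"
proof (rule projectiveE[OF assms])
  show "Idt C y \<in> Hom C y y" using assms by (auto simp: in_Hom_iff)
qed (rule that)

lemma projective_Cof:
  assumes x: "projective C M x" and i: "i \<in> Hom C x z" "i \<in> Cof M"
  shows "projective C M z"
  unfolding projective_def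
proof (intro conjI ballI)
  show "z \<in> Obj C" using i by (auto simp: in_Hom_iff)
  fix p b assume p: "p \<in> Fib M \<inter> Weq M" and b: "b \<in> Hom C z (Cd C p)"
  have pH: "p \<in> Hom C (Dm C p) (Cd C p)" using p by (auto simp: in_Hom_iff)
  obtain a where a: "a \<in> Hom C x (Dm C p)" "p \<cdot> a = b \<cdot> i"
    by (rule projectiveE[OF x _ _ pH Comp_closed[OF i(1) b]]) (use p in auto)
  show "\<exists>a\<in>Hom C z (Dm C p). p \<cdot> a = b"
    by (rule has_liftingE[OF lifting_acyclic_Fib[OF i(2) p], of a b]) (use a b i in \<open>auto simp: in_Hom_iff\<close>)
qed

lemma projective_initial:
  assumes z: "initial C z"
  shows "projective C M z"
  unfolding projective_def
proof (intro conjI ballI)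
  show "z \<in> Obj C" using z by (simp add: initial_def)
  fix p b assume p: "p \<in> Fib M \<inter> Weq M" and b: "b \<in> Hom C z (Cd C p)"
  have pH: "p \<in> Hom C (Dm C p) (Cd C p)" using p by (auto simp: in_Hom_iff)
  obtain a where a: "a \<in> Hom C z (Dm C p)" by (rule initialE[OF z, of "Dm C p"]) (use p in auto)
  have "p \<cdot> a = b" by (rule initial_unique[OF z _ Comp_closed[OF a pH] b]) (use p in auto)
  with a show "\<exists>a\<in>Hom C z (Dm C p). p \<cdot> a = b" by blast
qed

lemma cofibrant_projective: "cofibrant C M x \<Longrightarrow> projective C M x"
  unfolding cofibrant_def using projective_initial projective_Cof by blast

lemma cofibrant_replacement_exists:
  assumes "x \<in> Obj C"
  obtains Q q where "cofibrant C M Q" "q \<in> Hom C Q x" "q \<in> Fib M" "q \<in> Weq M"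
proof -
  obtain z where z: "initial C z" using initial_exists by blast
  obtain f where f: "f \<in> Hom C z x" by (rule initialE[OF z assms])
  from factor_acyclic_Fib[OF this] obtain Q i q where
    *: "i \<in> Hom C z Q" "q \<in> Hom C Q x" "i \<in> Cof M" "q \<in> Fib M \<inter> Weq M" by blast
  then have "Q \<in> Obj C" by (auto simp: in_Hom_iff)
  with * z have "cofibrant C M Q" unfolding cofibrant_def by blast
  with * that show thesis by blast
qed

text \<open>The reason is that \<open>h\<close> is a retract of a weak equivalence. Factor \<open>g = p j\<close> and \<open>p j f = q c\<close> with \<open>j\<close>, \<open>c\<close> acyclic
  cofibrations and \<open>p\<close>, \<open>q\<close> fibrations; then \<open>h p\<close> and \<open>q\<close> are weak equivalences by two out of three.
  Lifting \<open>c\<close> against \<open>p\<close> yields \<open>r\<close> with \<open>p r = q\<close>, and \<open>q\<close> has a section \<open>s\<close> because \<open>z\<close> is projective. Thus \<open>r s\<close>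
  is a section of \<open>p\<close>, and \<open>h\<close> is a retract of \<open>h p\<close>.\<close>

lemma two_of_six:
  assumes z: "projective C M z"
    and f: "f \<in> Hom C x y" and g: "g \<in> Hom C y z" and h: "h \<in> Hom C z w"
    and gf: "g \<cdot> f \<in> Weq M" and hg: "h \<cdot> g \<in> Weq M"
  shows "h \<in> Weq M"
proof -
  obtain u j p where j: "j \<in> Hom C y u" "j \<in> Cof M" "j \<in> Weq M"
    and p: "p \<in> Hom C u z" "p \<in> Fib M" "p \<cdot> j = g"
    using factor_acyclic_Cof[OF g] by blast
  have hp: "h \<cdot> p \<in> Weq M"
    by (rule two_of_three_left[OF j(1) Comp_closed[OF p(1) h] j(3)])
      (use hg Comp_assoc[OF j(1) p(1) h] p in simp)
  obtain t c q where c: "c \<in> Hom C x t" "c \<in> Cof M \<inter> Weq M"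
    and q: "q \<in> Hom C t z" "q \<in> Fib M" "q \<cdot> c = g \<cdot> f"
    using factor_acyclic_Cof[OF Comp_closed[OF f g]] by blast
  have qW: "q \<in> Weq M" by (rule two_of_three_left[OF c(1) q(1)]) (use c q gf in auto)
  have sq: "p \<cdot> j \<cdot> f = q \<cdot> c"
    using Comp_assoc[OF f j(1) p(1)] p(3) q(3) by simp
  obtain r where r: "r \<in> Hom C t u" "p \<cdot> r = q"
    by (rule has_liftingE[OF lifting_acyclic_Cof[OF c(2) p(2)], of "j \<cdot> f" q])
      (use sq f j p q c in \<open>auto simp: in_Hom_iff\<close>)
  obtain s where s: "s \<in> Hom C z t" "q \<cdot> s = Idt C z"
    by (rule projective_section[OF z q(2) qW q(1)])
  have prs: "p \<cdot> r \<cdot> s = Idt C z" using Comp_assoc[OF s(1) r(1) p(1)] r(2) s(2) by simp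
  have "is_retract C h (h \<cdot> p)"
    unfolding is_retract_def
    using h p r s prs
    by (intro conjI bexI[of _ "r \<cdot> s"] bexI[of _ p] bexI[of _ "Idt C w"]) (auto simp: in_Hom_iff)
  then show ?thesis using hp by (rule Weq_retract)
qed

lemma fibrant_extension:
  assumes v: "fibrant C M v" and i: "i \<in> Cof M \<inter> Weq M" "i \<in> Hom C x z" and a: "a \<in> Hom C x v"
  obtains b where "b \<in> Hom C z v" "b \<cdot> i = a"
proof -
  obtain t e where t: "terminal C t" and e: "e \<in> Hom C v t" "e \<in> Fib M"
    using v unfolding fibrant_def by blast
  have o: "x \<in> Obj C" "z \<in> Obj C" using i by (auto simp: in_Hom_iff)
  obtain k where k: "k \<in> Hom C z t" using t o unfolding terminal_def by blast
  have "e \<cdot> a = k \<cdot> i"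
    by (rule terminal_unique[OF t o(1)]) (use Comp_closed[OF a e(1)] Comp_closed[OF i(2) k] in auto)
  then show thesis
    by (rule_tac has_liftingE[OF lifting_acyclic_Cof[OF i(1) e(2)], of a k])
      (use a e k i that in \<open>auto simp: in_Hom_iff\<close>)
qed

end

text \<open>The condition \<open>homotopy_lifting\<close> follows when \<open>(d\<^sub>0, d\<^sub>1) : P \<rightarrow> v \<times> v\<close> is a fibration; it is
  stated through \<open>d\<^sub>0\<close> and \<open>d\<^sub>1\<close> so that the product need not be carried along.\<close>

locale path_object = model_category C M
  for C :: "('o, 'a, 'm) cat_scheme" (structure) and M :: "'a model" +
  fixes v P :: 'o and d\<^sub>0 d\<^sub>1 s :: 'a
  assumes v_fibrant: "fibrant C M v"
    and d\<^sub>0: "d\<^sub>0 \<in> Hom C P v" "d\<^sub>0 \<in> Fib M" "d\<^sub>0 \<in> Weq M"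
    and d\<^sub>1: "d\<^sub>1 \<in> Hom C P v" "d\<^sub>1 \<in> Fib M" "d\<^sub>1 \<in> Weq M"
    and s: "s \<in> Hom C v P" "d\<^sub>0 \<cdot> s = Idt C v" "d\<^sub>1 \<cdot> s = Idt C v"
    and homotopy_lifting: "i \<in> Cof M \<inter> Weq M \<Longrightarrow> u \<in> Hom C (Dm C i) P \<Longrightarrow>
           a \<in> Hom C (Cd C i) v \<Longrightarrow> b \<in> Hom C (Cd C i) v \<Longrightarrow> d\<^sub>0 \<cdot> u = a \<cdot> i \<Longrightarrow> d\<^sub>1 \<cdot> u = b \<cdot> i \<Longrightarrow>
           \<exists>h\<in>Hom C (Cd C i) P. d\<^sub>0 \<cdot> h = a \<and> d\<^sub>1 \<cdot> h = b"

context model_category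
begin

text \<open>Factor the diagonal of \<open>v\<close> as an acyclic cofibration \<open>s\<close> followed by a fibration \<open>d\<close>. The two ends of
  \<open>d\<close> are weak equivalences since \<open>s\<close> is one. They are fibrations: a lifting problem against one end
  becomes a lifting problem against \<open>d\<close> once the other coordinate is extended along the acyclic
  cofibration, which is possible because \<open>v\<close> is fibrant.\<close>

lemma path_object_exists:
  assumes v: "fibrant C M v"
  obtains P d\<^sub>0 d\<^sub>1 s where "path_object C M v P d\<^sub>0 d\<^sub>1 s"
proof -
  have vo: "v \<in> Obj C" using v by (simp add: fibrant_def)
  obtain Q p q where pq: "p \<in> Hom C Q v" "q \<in> Hom C Q v"
    and pair: "\<And>x a b. x \<in> Obj C \<Longrightarrow> a \<in> Hom C x v \<Longrightarrow> b \<in> Hom C x v \<Longrightarrow> \<exists>u\<in>Hom C x Q. p \<cdot> u = a \<and> q \<cdot> u = b"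
    and pair_unique: "\<And>x u u'. u \<in> Hom C x Q \<Longrightarrow> u' \<in> Hom C x Q \<Longrightarrow> p \<cdot> u = p \<cdot> u' \<Longrightarrow> q \<cdot> u = q \<cdot> u' \<Longrightarrow> u = u'"
    by (rule square_exists[OF vo]) blast
  have id: "Idt C v \<in> Hom C v v" using vo by (simp add: in_Hom_iff)
  obtain \<Delta> where \<Delta>: "\<Delta> \<in> Hom C v Q" "p \<cdot> \<Delta> = Idt C v" "q \<cdot> \<Delta> = Idt C v"
    using pair[OF vo id id] by blast
  obtain P s d where s: "s \<in> Hom C v P" "s \<in> Cof M \<inter> Weq M" and d: "d \<in> Hom C P Q" "d \<in> Fib M" "d \<cdot> s = \<Delta>"
    using factor_acyclic_Cof[OF \<Delta>(1)] by blast
  have ds: "(p \<cdot> d) \<cdot> s = Idt C v" "(q \<cdot> d) \<cdot> s = Idt C v"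
    using Comp_assoc[OF s(1) d(1) pq(1)] Comp_assoc[OF s(1) d(1) pq(2)] d(3) \<Delta> by simp_all
  have ends: "p \<cdot> d \<in> Hom C P v" "q \<cdot> d \<in> Hom C P v" using pq d by (auto intro: Comp_closed)
  have weq: "p \<cdot> d \<in> Weq M" "q \<cdot> d \<in> Weq M"
    by (rule two_of_three_left[OF s(1)]; use s ds ends Idt_Weq[OF vo] in simp)+
  have fillers: "\<exists>h\<in>Hom C (Cd C i) P. h \<cdot> i = u \<and> (p \<cdot> d) \<cdot> h = a \<and> (q \<cdot> d) \<cdot> h = b"
    if i: "i \<in> Cof M \<inter> Weq M" and u: "u \<in> Hom C (Dm C i) P"
      and ab: "a \<in> Hom C (Cd C i) v" "b \<in> Hom C (Cd C i) v" "(p \<cdot> d) \<cdot> u = a \<cdot> i" "(q \<cdot> d) \<cdot> u = b \<cdot> i"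
    for i u a b
  proof -
    have iH: "i \<in> Hom C (Dm C i) (Cd C i)" "Cd C i \<in> Obj C" using i by (auto simp: in_Hom_iff)
    obtain k where k: "k \<in> Hom C (Cd C i) Q" "p \<cdot> k = a" "q \<cdot> k = b" using pair[OF iH(2) ab(1,2)] by blast
    have "d \<cdot> u = k \<cdot> i"
    proof (rule pair_unique)
      show "d \<cdot> u \<in> Hom C (Dm C i) Q" "k \<cdot> i \<in> Hom C (Dm C i) Q" using u d k iH by (auto intro: Comp_closed)
      show "p \<cdot> d \<cdot> u = p \<cdot> k \<cdot> i"
        using Comp_assoc[OF u d(1) pq(1)] Comp_assoc[OF iH(1) k(1) pq(1)] ab(3) k(2) by simp
      show "q \<cdot> d \<cdot> u = q \<cdot> k \<cdot> i"
        using Comp_assoc[OF u d(1) pq(2)] Comp_assoc[OF iH(1) k(1) pq(2)] ab(4) k(3) by simp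
    qed
    moreover have "Dm C d = P" "Cd C d = Q" using d(1) by (auto simp: in_Hom_iff)
    ultimately obtain h where h: "h \<in> Hom C (Cd C i) P" "h \<cdot> i = u" "d \<cdot> h = k"
      using has_liftingE[OF lifting_acyclic_Cof[OF i d(2)], of u k] u k(1) by metis
    then show ?thesis
      using Comp_assoc[OF h(1) d(1) pq(1)] Comp_assoc[OF h(1) d(1) pq(2)] k by auto
  qed
  have fib: "p \<cdot> d \<in> Fib M" "q \<cdot> d \<in> Fib M"
  proof -
    have "has_lifting C i (p \<cdot> d) \<and> has_lifting C i (q \<cdot> d)" if i: "i \<in> Cof M \<inter> Weq M" for i
    proof -
      have iH: "i \<in> Hom C (Dm C i) (Cd C i)" using i by (auto simp: in_Hom_iff)
      have *: "Dm C (p \<cdot> d) = P" "Cd C (p \<cdot> d) = v" "Dm C (q \<cdot> d) = P" "Cd C (q \<cdot> d) = v"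
        using ends by (auto simp: in_Hom_iff)
      show ?thesis unfolding has_lifting_def *
      proof (intro conjI ballI impI)
        fix u a assume u: "u \<in> Hom C (Dm C i) P" and a: "a \<in> Hom C (Cd C i) v" and sq: "(p \<cdot> d) \<cdot> u = a \<cdot> i"
        obtain b where "b \<in> Hom C (Cd C i) v" "b \<cdot> i = (q \<cdot> d) \<cdot> u"
          by (rule fibrant_extension[OF v i iH Comp_closed[OF u ends(2)]])
        then show "\<exists>h\<in>Hom C (Cd C i) P. h \<cdot> i = u \<and> (p \<cdot> d) \<cdot> h = a"
          using fillers[OF i u a _ sq, of b] by auto
      next
        fix u a assume u: "u \<in> Hom C (Dm C i) P" and a: "a \<in> Hom C (Cd C i) v" and sq: "(q \<cdot> d) \<cdot> u = a \<cdot> i"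
        obtain b where "b \<in> Hom C (Cd C i) v" "b \<cdot> i = (p \<cdot> d) \<cdot> u"
          by (rule fibrant_extension[OF v i iH Comp_closed[OF u ends(1)]])
        then show "\<exists>h\<in>Hom C (Cd C i) P. h \<cdot> i = u \<and> (q \<cdot> d) \<cdot> h = a"
          using fillers[OF i u _ a _ sq, of b] by auto
      qed
    qed
    then show "p \<cdot> d \<in> Fib M" "q \<cdot> d \<in> Fib M" using ends by (auto intro!: FibI simp: in_Hom_iff)
  qed
  have "path_object C M v P (p \<cdot> d) (q \<cdot> d) s"
  proof (intro path_object.intro path_object_axioms.intro model_category_axioms)
    fix i u a b
    assume "i \<in> Cof M \<inter> Weq M" "u \<in> Hom C (Dm C i) P" "a \<in> Hom C (Cd C i) v" "b \<in> Hom C (Cd C i) v"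
      "(p \<cdot> d) \<cdot> u = a \<cdot> i" "(q \<cdot> d) \<cdot> u = b \<cdot> i"
    from fillers[OF this] show "\<exists>h\<in>Hom C (Cd C i) P. (p \<cdot> d) \<cdot> h = a \<and> (q \<cdot> d) \<cdot> h = b" by blast
  qed (use v ends fib weq s ds in auto)
  then show thesis by (rule that)
qed

end

context path_object
begin

definition homotopic :: "'a \<Rightarrow> 'a \<Rightarrow> bool" where
  "homotopic a b \<longleftrightarrow> (\<exists>H\<in>Hom C (Dm C a) P. d\<^sub>0 \<cdot> H = a \<and> d\<^sub>1 \<cdot> H = b)"

lemma homotopicI: "H \<in> Hom C x P \<Longrightarrow> d\<^sub>0 \<cdot> H = a \<Longrightarrow> d\<^sub>1 \<cdot> H = b \<Longrightarrow> homotopic a b"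
  using d\<^sub>0(1) by (auto simp: homotopic_def in_Hom_iff)

lemma homotopicE:
  assumes "homotopic a b" "a \<in> Hom C x v"
  obtains H where "H \<in> Hom C x P" "d\<^sub>0 \<cdot> H = a" "d\<^sub>1 \<cdot> H = b"
  using assms by (auto simp: homotopic_def in_Hom_iff)

lemma homotopic_refl: "a \<in> Hom C x v \<Longrightarrow> homotopic a a"
  using Comp_assoc[of a x v s P d\<^sub>0 v] Comp_assoc[of a x v s P d\<^sub>1 v] s d\<^sub>0 d\<^sub>1
  by (intro homotopicI[of "s \<cdot> a" x]) (auto intro: Comp_closed simp: Idt_Comp)

lemma homotopic_precompose:
  assumes "homotopic a b" "a \<in> Hom C y v" "f \<in> Hom C x y"
  shows "homotopic (a \<cdot> f) (b \<cdot> f)"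
proof -
  obtain H where H: "H \<in> Hom C y P" "d\<^sub>0 \<cdot> H = a" "d\<^sub>1 \<cdot> H = b" by (rule homotopicE[OF assms(1,2)])
  then show ?thesis
    using Comp_assoc[OF assms(3) H(1) d\<^sub>0(1)] Comp_assoc[OF assms(3) H(1) d\<^sub>1(1)] assms(3)
    by (intro homotopicI[of "H \<cdot> f" x]) (auto intro: Comp_closed)
qed

lemma homotopic_acyclic_Cof_cancel:
  assumes i: "i \<in> Cof M \<inter> Weq M" "i \<in> Hom C x z" and ab: "a \<in> Hom C z v" "b \<in> Hom C z v"
    and "homotopic (a \<cdot> i) (b \<cdot> i)"
  shows "homotopic a b"
proof -
  obtain H where H: "H \<in> Hom C x P" "d\<^sub>0 \<cdot> H = a \<cdot> i" "d\<^sub>1 \<cdot> H = b \<cdot> i"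
    by (rule homotopicE[OF assms(5) Comp_closed[OF i(2) ab(1)]])
  then show ?thesis
    using homotopy_lifting[OF i(1), of H a b] i(2) ab homotopicI by (auto simp: in_Hom_iff)
qed

text \<open>A section \<open>\<sigma>\<close> of a weak equivalence \<open>p\<close> is a homotopy inverse, as seen by maps into \<open>v\<close>. Factor
  \<open>\<sigma> = t c\<close> with \<open>c\<close> an acyclic cofibration and \<open>t\<close> an acyclic fibration, which has a section \<open>u\<close>. The maps
  \<open>a \<sigma> p t\<close> and \<open>a t\<close> agree after composition with \<open>c\<close>, hence are homotopic, and precomposition with \<open>u\<close>
  removes \<open>t\<close>.\<close>

lemma homotopic_section:
  assumes z: "projective C M z" and p: "p \<in> Hom C z y" "p \<in> Weq M"
    and \<sigma>: "\<sigma> \<in> Hom C y z" "p \<cdot> \<sigma> = Idt C y" and a: "a \<in> Hom C z v"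
  shows "homotopic (a \<cdot> \<sigma> \<cdot> p) a"
proof -
  have \<sigma>W: "\<sigma> \<in> Weq M" by (rule Weq_section[OF p \<sigma>])
  obtain T c t where c: "c \<in> Hom C y T" "c \<in> Cof M \<inter> Weq M" and t: "t \<in> Hom C T z" "t \<in> Fib M" "t \<cdot> c = \<sigma>"
    using factor_acyclic_Cof[OF \<sigma>(1)] by blast
  have tW: "t \<in> Weq M" by (rule two_of_three_left[OF c(1) t(1)]) (use c t \<sigma>W in auto)
  obtain u where u: "u \<in> Hom C z T" "t \<cdot> u = Idt C z" by (rule projective_section[OF z t(2) tW t(1)])
  have A: "c \<in> Arr C" "Dm C c = y" "Cd C c = T" "t \<in> Arr C" "Dm C t = T" "Cd C t = z"
    "p \<in> Arr C" "Dm C p = z" "Cd C p = y" "\<sigma> \<in> Arr C" "Dm C \<sigma> = y" "Cd C \<sigma> = z"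
    "a \<in> Arr C" "Dm C a = z" "Cd C a = v" "u \<in> Arr C" "Dm C u = z" "Cd C u = T"
    using c t p \<sigma> a u by (auto simp: in_Hom_iff)
  have agree: "(a \<cdot> \<sigma> \<cdot> p \<cdot> t) \<cdot> c = (a \<cdot> t) \<cdot> c"
    using A t(3) \<sigma>(2) by simp
  have "homotopic (a \<cdot> \<sigma> \<cdot> p \<cdot> t) (a \<cdot> t)"
  proof (rule homotopic_acyclic_Cof_cancel[OF c(2,1)])
    show "homotopic ((a \<cdot> \<sigma> \<cdot> p \<cdot> t) \<cdot> c) ((a \<cdot> t) \<cdot> c)"
      unfolding agree by (rule homotopic_refl[of _ y]) (use A in \<open>auto simp: in_Hom_iff\<close>)
  qed (use A in \<open>auto simp: in_Hom_iff\<close>)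
  then have "homotopic ((a \<cdot> \<sigma> \<cdot> p \<cdot> t) \<cdot> u) ((a \<cdot> t) \<cdot> u)"
    by (rule homotopic_precompose[where y = T and x = z]) (use A in \<open>auto simp: in_Hom_iff\<close>)
  then show ?thesis using A u(2) by simp
qed

text \<open>In the factorization of \<open>\<theta>\<close> as an acyclic cofibration and a fibration \<open>p\<close>, two out of three makes \<open>p\<close>
  acyclic, so projectivity of \<open>y\<close> gives it a section.\<close>

lemma Weq_factorization:
  assumes \<theta>: "\<theta> \<in> Hom C x y" "\<theta> \<in> Weq M" and x: "projective C M x" and y: "projective C M y"
  obtains z i p \<sigma> where "projective C M z" "i \<in> Hom C x z" "i \<in> Cof M \<inter> Weq M"
    "p \<in> Hom C z y" "p \<in> Weq M" "p \<cdot> i = \<theta>" "\<sigma> \<in> Hom C y z" "p \<cdot> \<sigma> = Idt C y"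
proof -
  obtain z i p where i: "i \<in> Hom C x z" "i \<in> Cof M \<inter> Weq M" and p: "p \<in> Hom C z y" "p \<in> Fib M" "p \<cdot> i = \<theta>"
    using factor_acyclic_Cof[OF \<theta>(1)] by blast
  have pW: "p \<in> Weq M" by (rule two_of_three_left[OF i(1) p(1)]) (use i p \<theta> in auto)
  obtain \<sigma> where \<sigma>: "\<sigma> \<in> Hom C y z" "p \<cdot> \<sigma> = Idt C y" by (rule projective_section[OF y p(2) pW p(1)])
  have "projective C M z" using projective_Cof[OF x i(1)] i by simp
  then show thesis using that i p pW \<sigma> by blast
qed

text \<open>With \<open>homotopic_Weq_cancel\<close>: a weak equivalence between cofibrant objects induces a bijection on
  homotopy classes of maps into a fibrant object. Here \<open>a\<close> is extended along the acyclic cofibration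
  \<open>i\<close> and then restricted along the section \<open>\<sigma>\<close>.\<close>

lemma homotopic_extension_along_Weq:
  assumes \<theta>: "\<theta> \<in> Hom C x y" "\<theta> \<in> Weq M" "projective C M x" "projective C M y" and a: "a \<in> Hom C x v"
  obtains b where "b \<in> Hom C y v" "homotopic (b \<cdot> \<theta>) a"
proof -
  obtain z i p \<sigma> where *: "projective C M z" "i \<in> Hom C x z" "i \<in> Cof M \<inter> Weq M"
    "p \<in> Hom C z y" "p \<in> Weq M" "p \<cdot> i = \<theta>" "\<sigma> \<in> Hom C y z" "p \<cdot> \<sigma> = Idt C y"
    by (rule Weq_factorization[OF \<theta>])
  obtain a' where a': "a' \<in> Hom C z v" "a' \<cdot> i = a" by (rule fibrant_extension[OF v_fibrant *(3,2) a])
  have "homotopic ((a' \<cdot> \<sigma> \<cdot> p) \<cdot> i) (a' \<cdot> i)"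
    by (rule homotopic_precompose[OF homotopic_section[OF *(1,4,5,7,8) a'(1)] _ *(2)])
      (use * a' in \<open>auto simp: in_Hom_iff\<close>)
  moreover have "(a' \<cdot> \<sigma> \<cdot> p) \<cdot> i = (a' \<cdot> \<sigma>) \<cdot> \<theta>" "a' \<cdot> \<sigma> \<in> Hom C y v" using * a' by (auto simp: in_Hom_iff)
  ultimately show thesis using that[of "a' \<cdot> \<sigma>"] a' by simp
qed

text \<open>A homotopy can be extended along the acyclic cofibration \<open>i\<close> and then restricted along \<open>\<sigma>\<close>.\<close>

lemma homotopic_Weq_cancel:
  assumes \<theta>: "\<theta> \<in> Hom C x y" "\<theta> \<in> Weq M" "projective C M x" "projective C M y"
    and ab: "a \<in> Hom C y v" "b \<in> Hom C y v" and H: "homotopic (a \<cdot> \<theta>) (b \<cdot> \<theta>)"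
  shows "homotopic a b"
proof -
  obtain z i p \<sigma> where *: "projective C M z" "i \<in> Hom C x z" "i \<in> Cof M \<inter> Weq M"
    "p \<in> Hom C z y" "p \<in> Weq M" "p \<cdot> i = \<theta>" "\<sigma> \<in> Hom C y z" "p \<cdot> \<sigma> = Idt C y"
    by (rule Weq_factorization[OF \<theta>])
  have eq: "a \<cdot> \<theta> = (a \<cdot> p) \<cdot> i" "b \<cdot> \<theta> = (b \<cdot> p) \<cdot> i"
    using Comp_assoc[OF *(2,4) ab(1)] Comp_assoc[OF *(2,4) ab(2)] *(6) by simp_all
  have "homotopic (a \<cdot> p) (b \<cdot> p)"
    by (rule homotopic_acyclic_Cof_cancel[OF *(3,2)]) (use * ab H eq in \<open>auto intro: Comp_closed\<close>)
  then have "homotopic ((a \<cdot> p) \<cdot> \<sigma>) ((b \<cdot> p) \<cdot> \<sigma>)"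
    by (rule homotopic_precompose) (use * ab in \<open>auto intro: Comp_closed\<close>)
  moreover have "(a \<cdot> p) \<cdot> \<sigma> = a" "(b \<cdot> p) \<cdot> \<sigma> = b"
    using Comp_assoc[OF *(7,4) ab(1)] Comp_assoc[OF *(7,4) ab(2)] *(8) ab by (simp_all add: Comp_Idt)
  ultimately show ?thesis by simp
qed

end

section \<open>Weak equivalences between right adjoints\<close>

locale model_hom_adjunction = hom_adjunction C D L R \<tau> + C: model_category C MC + D: model_category D MD
  for C :: "('o, 'a, 'm) cat_scheme" and MC :: "'a model"
    and D :: "('p, 'b, 'n) cat_scheme" and MD :: "'b model"
    and L :: "('o, 'a, 'p, 'b) cfunctor" and R :: "('p, 'b, 'o, 'a) cfunctor"
    and \<tau> :: "'o \<Rightarrow> 'p \<Rightarrow> 'a \<Rightarrow> 'b" +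
  assumes L_Cof: "i \<in> Cof MC \<Longrightarrow> farr L i \<in> Cof MD"
begin

lemma R_acyclic_Fib:
  assumes "p \<in> Fib MD" "p \<in> Weq MD"
  shows "farr R p \<in> Fib MC" "farr R p \<in> Weq MC"
proof -
  have "p \<in> Hom D (Dm D p) (Cd D p)" using assms by (simp add: in_Hom_iff)
  from R_arr[OF this] have Rp: "farr R p \<in> Arr C" by (simp add: in_Hom_iff)
  have "farr R p \<in> Fib MC \<inter> Weq MC"
  proof (rule C.acyclic_FibI[OF Rp])
    fix i assume i: "i \<in> Cof MC"
    have "has_lifting D (farr L i) p"
      by (rule D.lifting_acyclic_Fib) (use i L_Cof assms in auto)
    then show "has_lifting C i (farr R p)"
      by (rule has_lifting_transpose[rotated 2]) (use i assms in auto)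
  qed
  then show "farr R p \<in> Fib MC" "farr R p \<in> Weq MC" by auto
qed

lemma L_cofibrant:
  assumes "cofibrant C MC A"
  shows "cofibrant D MD (fobj L A)"
proof -
  obtain z f where "A \<in> Obj C" "initial C z" "f \<in> Hom C z A" "f \<in> Cof MC"
    using assms unfolding cofibrant_def by blast
  then show ?thesis
    unfolding cofibrant_def using L_obj L_initial L_arr L_Cof by blast
qed

end

text \<open>This is the Yoneda lemma in the homotopy category, written out for maps: the hypothesis \<open>mate\<close> identifies
  composition with \<open>\<phi>\<close> on \<open>C(A, R\<^sub>1 v)\<close> with precomposition with \<open>\<theta>\<^sub>A\<close>, and cofibrant \<open>A\<close> suffice as test objects.

  Homotopies of maps \<open>L\<^sub>i A \<rightarrow> v\<close> through a path object \<open>P\<close> of \<open>v\<close> transpose to maps \<open>A \<rightarrow> R\<^sub>i P\<close>, and the ends of \<open>P\<close>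
  are carried by \<open>R\<^sub>i\<close> to weak equivalences; so if one of two homotopic maps \<open>A \<rightarrow> R\<^sub>i v\<close> is a weak equivalence,
  the other is as well. Since \<open>\<theta>\<^sub>A\<close> induces bijections on homotopy classes, so does \<open>\<phi>\<close>. With cofibrant
  replacements \<open>q\<^sub>i : Q\<^sub>i \<rightarrow> R\<^sub>i v\<close> and a lift \<open>f : Q\<^sub>1 \<rightarrow> Q\<^sub>2\<close> of \<open>\<phi> q\<^sub>1\<close>, surjectivity yields \<open>k : Q\<^sub>2 \<rightarrow> R\<^sub>1 v\<close>
  with \<open>\<phi> k\<close> homotopic to \<open>q\<^sub>2\<close>, and injectivity shows that \<open>k f\<close> is homotopic to \<open>q\<^sub>1\<close>. Lifting \<open>k\<close> to
  \<open>g : Q\<^sub>2 \<rightarrow> Q\<^sub>1\<close>, both \<open>g f\<close> and \<open>\<phi> q\<^sub>1 g\<close> are weak equivalences, so \<open>\<phi> q\<^sub>1\<close> is one by \<open>two_of_six\<close>.\<close>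

theorem mate_Weq:
  assumes 1: "model_hom_adjunction C MC D MD L\<^sub>1 R\<^sub>1 \<tau>\<^sub>1" and 2: "model_hom_adjunction C MC D MD L\<^sub>2 R\<^sub>2 \<tau>\<^sub>2"
    and v: "fibrant D MD v"
    and \<theta>: "\<And>A. cofibrant C MC A \<Longrightarrow> \<theta> A \<in> Hom D (fobj L\<^sub>2 A) (fobj L\<^sub>1 A)"
      "\<And>A. cofibrant C MC A \<Longrightarrow> \<theta> A \<in> Weq MD"
    and \<phi>: "\<phi> \<in> Hom C (fobj R\<^sub>1 v) (fobj R\<^sub>2 v)"
    and mate: "\<And>A a. cofibrant C MC A \<Longrightarrow> a \<in> Hom C A (fobj R\<^sub>1 v) \<Longrightarrow>
           \<tau>\<^sub>2 A v (\<phi> \<cdot>\<^bsub>C\<^esub> a) = \<tau>\<^sub>1 A v a \<cdot>\<^bsub>D\<^esub> \<theta> A"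
  shows "\<phi> \<in> Weq MC"
proof -
  interpret A1: model_hom_adjunction C MC D MD L\<^sub>1 R\<^sub>1 \<tau>\<^sub>1 by fact
  interpret A2: model_hom_adjunction C MC D MD L\<^sub>2 R\<^sub>2 \<tau>\<^sub>2 by fact
  obtain P d\<^sub>0 d\<^sub>1 s where "path_object D MD v P d\<^sub>0 d\<^sub>1 s" by (rule A1.D.path_object_exists[OF v])
  then interpret P: path_object D MD v P d\<^sub>0 d\<^sub>1 s .
  have vo: "v \<in> Obj D" and Po: "P \<in> Obj D" using P.s(1) by (auto simp: in_Hom_iff)
  have obj: "A \<in> Obj C" if "cofibrant C MC A" for A using that by (simp add: cofibrant_def)
  have proj: "projective D MD (fobj L\<^sub>1 A)" "projective D MD (fobj L\<^sub>2 A)" if "cofibrant C MC A" for A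
    using that A1.L_cofibrant A2.L_cofibrant A1.D.cofibrant_projective by blast+
  obtain Q\<^sub>1 q\<^sub>1 where Q\<^sub>1: "cofibrant C MC Q\<^sub>1" and q\<^sub>1: "q\<^sub>1 \<in> Hom C Q\<^sub>1 (fobj R\<^sub>1 v)" "q\<^sub>1 \<in> Fib MC" "q\<^sub>1 \<in> Weq MC"
    by (rule A1.C.cofibrant_replacement_exists[OF A1.R_obj[OF vo]])
  obtain Q\<^sub>2 q\<^sub>2 where Q\<^sub>2: "cofibrant C MC Q\<^sub>2" and q\<^sub>2: "q\<^sub>2 \<in> Hom C Q\<^sub>2 (fobj R\<^sub>2 v)" "q\<^sub>2 \<in> Fib MC" "q\<^sub>2 \<in> Weq MC"
    by (rule A1.C.cofibrant_replacement_exists[OF A2.R_obj[OF vo]])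
  note Q1o = obj[OF Q\<^sub>1] and Q2o = obj[OF Q\<^sub>2]
  note p1 = A1.C.cofibrant_projective[OF Q\<^sub>1]
  obtain f where f: "f \<in> Hom C Q\<^sub>1 Q\<^sub>2" "q\<^sub>2 \<cdot>\<^bsub>C\<^esub> f = \<phi> \<cdot>\<^bsub>C\<^esub> q\<^sub>1"
    by (rule A1.C.projectiveE[OF p1 q\<^sub>2(2,3,1) A1.C.Comp_closed[OF q\<^sub>1(1) \<phi>]])
  \<comment> \<open>Surjectivity on homotopy classes, applied to \<open>q\<^sub>2\<close>.\<close>
  obtain b where b: "b \<in> Hom D (fobj L\<^sub>1 Q\<^sub>2) v" "P.homotopic (b \<cdot>\<^bsub>D\<^esub> \<theta> Q\<^sub>2) (\<tau>\<^sub>2 Q\<^sub>2 v q\<^sub>2)"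
    by (rule P.homotopic_extension_along_Weq[OF \<theta>(1,2)[OF Q\<^sub>2] proj(2,1)[OF Q\<^sub>2] A2.transpose_closed[OF Q2o vo q\<^sub>2(1)]])
  obtain k where k: "k \<in> Hom C Q\<^sub>2 (fobj R\<^sub>1 v)" "\<tau>\<^sub>1 Q\<^sub>2 v k = b" by (rule A1.transpose_obtain[OF Q2o vo b(1)])
  obtain K where K: "K \<in> Hom D (fobj L\<^sub>2 Q\<^sub>2) P" "d\<^sub>0 \<cdot>\<^bsub>D\<^esub> K = b \<cdot>\<^bsub>D\<^esub> \<theta> Q\<^sub>2" "d\<^sub>1 \<cdot>\<^bsub>D\<^esub> K = \<tau>\<^sub>2 Q\<^sub>2 v q\<^sub>2"
    by (rule P.homotopicE[OF b(2) A1.D.Comp_closed[OF \<theta>(1)[OF Q\<^sub>2] b(1)]])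
  obtain H where H: "H \<in> Hom C Q\<^sub>2 (fobj R\<^sub>2 P)" "\<tau>\<^sub>2 Q\<^sub>2 P H = K" by (rule A2.transpose_obtain[OF Q2o Po K(1)])
  have \<phi>k: "\<phi> \<cdot>\<^bsub>C\<^esub> k \<in> Hom C Q\<^sub>2 (fobj R\<^sub>2 v)" by (rule A1.C.Comp_closed[OF k(1) \<phi>])
  have H0: "farr R\<^sub>2 d\<^sub>0 \<cdot>\<^bsub>C\<^esub> H = \<phi> \<cdot>\<^bsub>C\<^esub> k"
    by (rule A2.transpose_cancel[OF Q2o vo A1.C.Comp_closed[OF H(1) A2.R_arr[OF P.d\<^sub>0(1)]] \<phi>k])
      (simp add: A2.transpose_right[OF Q2o P.d\<^sub>0(1) H(1)] H(2) K(2) mate[OF Q\<^sub>2 k(1)] k(2))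
  have H1: "farr R\<^sub>2 d\<^sub>1 \<cdot>\<^bsub>C\<^esub> H = q\<^sub>2"
    by (rule A2.transpose_cancel[OF Q2o vo A1.C.Comp_closed[OF H(1) A2.R_arr[OF P.d\<^sub>1(1)]] q\<^sub>2(1)])
      (simp add: A2.transpose_right[OF Q2o P.d\<^sub>1(1) H(1)] H(2) K(3))
  have HW: "H \<in> Weq MC"
    by (rule A1.C.two_of_three_right[OF H(1) A2.R_arr[OF P.d\<^sub>1(1)] A2.R_acyclic_Fib(2)[OF P.d\<^sub>1(2,3)]])
      (simp add: H1 q\<^sub>2)
  \<comment> \<open>\<open>\<phi> k\<close> is homotopic to the weak equivalence \<open>q\<^sub>2\<close>.\<close>
  have \<phi>kW: "\<phi> \<cdot>\<^bsub>C\<^esub> k \<in> Weq MC"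
    using A1.C.two_of_three_comp[OF H(1) A2.R_arr[OF P.d\<^sub>0(1)] HW A2.R_acyclic_Fib(2)[OF P.d\<^sub>0(2,3)]]
    by (simp add: H0)
  obtain g where g: "g \<in> Hom C Q\<^sub>2 Q\<^sub>1" "q\<^sub>1 \<cdot>\<^bsub>C\<^esub> g = k"
    by (rule A1.C.projectiveE[OF A1.C.cofibrant_projective[OF Q\<^sub>2] q\<^sub>1(2,3,1) k(1)])
  have kf: "k \<cdot>\<^bsub>C\<^esub> f \<in> Hom C Q\<^sub>1 (fobj R\<^sub>1 v)" by (rule A1.C.Comp_closed[OF f(1) k(1)])
  have Hf: "H \<cdot>\<^bsub>C\<^esub> f \<in> Hom C Q\<^sub>1 (fobj R\<^sub>2 P)" by (rule A1.C.Comp_closed[OF f(1) H(1)])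
  \<comment> \<open>Injectivity on homotopy classes, applied to \<open>k f\<close> and \<open>q\<^sub>1\<close>; the homotopy is \<open>H f\<close>, as \<open>q\<^sub>2 f = \<phi> q\<^sub>1\<close>.\<close>
  have "P.homotopic (\<tau>\<^sub>1 Q\<^sub>1 v (k \<cdot>\<^bsub>C\<^esub> f) \<cdot>\<^bsub>D\<^esub> \<theta> Q\<^sub>1) (\<tau>\<^sub>1 Q\<^sub>1 v q\<^sub>1 \<cdot>\<^bsub>D\<^esub> \<theta> Q\<^sub>1)"
  proof (rule P.homotopicI[OF A2.transpose_closed[OF Q1o Po Hf]])
    show "d\<^sub>0 \<cdot>\<^bsub>D\<^esub> \<tau>\<^sub>2 Q\<^sub>1 P (H \<cdot>\<^bsub>C\<^esub> f) = \<tau>\<^sub>1 Q\<^sub>1 v (k \<cdot>\<^bsub>C\<^esub> f) \<cdot>\<^bsub>D\<^esub> \<theta> Q\<^sub>1"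
      unfolding A2.transpose_right[OF Q1o P.d\<^sub>0(1) Hf, symmetric] mate[OF Q\<^sub>1 kf, symmetric]
      using A1.C.Comp_assoc[OF f(1) H(1) A2.R_arr[OF P.d\<^sub>0(1)]] A1.C.Comp_assoc[OF f(1) k(1) \<phi>] H0 by simp
    show "d\<^sub>1 \<cdot>\<^bsub>D\<^esub> \<tau>\<^sub>2 Q\<^sub>1 P (H \<cdot>\<^bsub>C\<^esub> f) = \<tau>\<^sub>1 Q\<^sub>1 v q\<^sub>1 \<cdot>\<^bsub>D\<^esub> \<theta> Q\<^sub>1"
      unfolding A2.transpose_right[OF Q1o P.d\<^sub>1(1) Hf, symmetric] mate[OF Q\<^sub>1 q\<^sub>1(1), symmetric]
      using A1.C.Comp_assoc[OF f(1) H(1) A2.R_arr[OF P.d\<^sub>1(1)]] H1 f(2) by simp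
  qed
  then have "P.homotopic (\<tau>\<^sub>1 Q\<^sub>1 v (k \<cdot>\<^bsub>C\<^esub> f)) (\<tau>\<^sub>1 Q\<^sub>1 v q\<^sub>1)"
    by (rule P.homotopic_Weq_cancel[OF \<theta>(1,2)[OF Q\<^sub>1] proj(2,1)[OF Q\<^sub>1]
      A1.transpose_closed[OF Q1o vo kf] A1.transpose_closed[OF Q1o vo q\<^sub>1(1)]])
  then obtain K' where K': "K' \<in> Hom D (fobj L\<^sub>1 Q\<^sub>1) P"
    "d\<^sub>0 \<cdot>\<^bsub>D\<^esub> K' = \<tau>\<^sub>1 Q\<^sub>1 v (k \<cdot>\<^bsub>C\<^esub> f)" "d\<^sub>1 \<cdot>\<^bsub>D\<^esub> K' = \<tau>\<^sub>1 Q\<^sub>1 v q\<^sub>1"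
    by (rule P.homotopicE[OF _ A1.transpose_closed[OF Q1o vo kf]])
  obtain H' where H': "H' \<in> Hom C Q\<^sub>1 (fobj R\<^sub>1 P)" "\<tau>\<^sub>1 Q\<^sub>1 P H' = K'" by (rule A1.transpose_obtain[OF Q1o Po K'(1)])
  have H'0: "farr R\<^sub>1 d\<^sub>0 \<cdot>\<^bsub>C\<^esub> H' = k \<cdot>\<^bsub>C\<^esub> f"
    by (rule A1.transpose_cancel[OF Q1o vo A1.C.Comp_closed[OF H'(1) A1.R_arr[OF P.d\<^sub>0(1)]] kf])
      (simp add: A1.transpose_right[OF Q1o P.d\<^sub>0(1) H'(1)] H'(2) K'(2))
  have H'1: "farr R\<^sub>1 d\<^sub>1 \<cdot>\<^bsub>C\<^esub> H' = q\<^sub>1"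
    by (rule A1.transpose_cancel[OF Q1o vo A1.C.Comp_closed[OF H'(1) A1.R_arr[OF P.d\<^sub>1(1)]] q\<^sub>1(1)])
      (simp add: A1.transpose_right[OF Q1o P.d\<^sub>1(1) H'(1)] H'(2) K'(3))
  have H'W: "H' \<in> Weq MC"
    by (rule A1.C.two_of_three_right[OF H'(1) A1.R_arr[OF P.d\<^sub>1(1)] A1.R_acyclic_Fib(2)[OF P.d\<^sub>1(2,3)]])
      (simp add: H'1 q\<^sub>1)
  \<comment> \<open>\<open>k f\<close> is homotopic to the weak equivalence \<open>q\<^sub>1\<close>.\<close>
  have kfW: "k \<cdot>\<^bsub>C\<^esub> f \<in> Weq MC"
    using A1.C.two_of_three_comp[OF H'(1) A1.R_arr[OF P.d\<^sub>0(1)] H'W A1.R_acyclic_Fib(2)[OF P.d\<^sub>0(2,3)]]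
    by (simp add: H'0)
  have gf: "g \<cdot>\<^bsub>C\<^esub> f \<in> Weq MC"
    by (rule A1.C.two_of_three_right[OF A1.C.Comp_closed[OF f(1) g(1)] q\<^sub>1(1,3)])
      (use A1.C.Comp_assoc[OF f(1) g(1) q\<^sub>1(1)] g(2) kfW in simp)
  have "\<phi> \<cdot>\<^bsub>C\<^esub> q\<^sub>1 \<in> Weq MC"
    by (rule A1.C.two_of_six[OF p1 f(1) g(1) A1.C.Comp_closed[OF q\<^sub>1(1) \<phi>] gf])
      (use A1.C.Comp_assoc[OF g(1) q\<^sub>1(1) \<phi>] g(2) \<phi>kW in simp)
  then show ?thesis by (rule A1.C.two_of_three_left[OF q\<^sub>1(1) \<phi> q\<^sub>1(3)])
qed


section \<open>The comparison of hom-objects\<close>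

context closed_symmetric_monoidal_category
begin

text \<open>\<open>z \<otimes> a\<close> is initial because tensoring with \<open>a\<close> on the right is a left adjoint; the symmetry moves \<open>a\<close> to the
  other side.\<close>

lemma initial_TensO:
  assumes z: "initial C z" and a: "a \<in> Obj C"
  shows "initial C (a \<otimes> z)"
  unfolding initial_def
proof (intro conjI ballI)
  interpret T: hom_adjunction C C "tensor_functor a" "hom_functor a" "\<lambda>x y g. Ev C a y \<cdot> (g \<star> Idt C a)"
    by (rule hom_adjunction_tensor[OF a])
  have za: "initial C (z \<otimes> a)" using T.L_initial[OF z] by (simp add: tensor_functor_def)
  have zo: "z \<in> Obj C" using z by (simp add: initial_def)
  have S: "Sym C a z \<in> Hom C (a \<otimes> z) (z \<otimes> a)" "Sym C z a \<in> Hom C (z \<otimes> a) (a \<otimes> z)"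
    using Sym_closed zo a by auto
  show "a \<otimes> z \<in> Obj C" using zo a by simp
  fix x assume x: "x \<in> Obj C"
  obtain g where g: "g \<in> Hom C (z \<otimes> a) x" by (rule initialE[OF za x])
  show "\<exists>!f. f \<in> Hom C (a \<otimes> z) x"
  proof (rule ex1I)
    show "g \<cdot> Sym C a z \<in> Hom C (a \<otimes> z) x" by (rule Comp_closed[OF S(1) g])
    fix f assume f: "f \<in> Hom C (a \<otimes> z) x"
    have "f = (f \<cdot> Sym C z a) \<cdot> Sym C a z"
      unfolding Comp_assoc[OF S f] Sym_Sym[OF a zo] using f by (simp add: Comp_Idt)
    also have "f \<cdot> Sym C z a = g" by (rule initial_unique[OF za x Comp_closed[OF S(2) f] g])
    finally show "f = g \<cdot> Sym C a z" .
  qed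
qed

end

context symmetric_monoidal_model_category
begin

text \<open>The pushout-product of \<open>i : a \<rightarrow> b\<close> with \<open>0 \<rightarrow> w\<close> is \<open>i \<otimes> w\<close> itself: as \<open>a \<otimes> 0\<close> and \<open>b \<otimes> 0\<close> are initial, the
  pushout is \<open>a \<otimes> w\<close>.\<close>

lemma TensA_Cof:
  assumes w: "cofibrant C M w" and i: "i \<in> Cof M"
  shows "i \<star> Idt C w \<in> Cof M"
proof -
  obtain z k where wo: "w \<in> Obj C" and z: "initial C z" and k: "k \<in> Hom C z w" "k \<in> Cof M"
    using w unfolding cofibrant_def by blast
  have zo: "z \<in> Obj C" using z by (simp add: initial_def)
  let ?a = "Dm C i" and ?b = "Cd C i"
  have iH: "i \<in> Hom C ?a ?b" and io: "i \<in> Arr C" "?a \<in> Obj C" "?b \<in> Obj C" using i by (simp_all add: in_Hom_iff)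
  have kA: "k \<in> Arr C" "Dm C k = z" "Cd C k = w" using k by (simp_all add: in_Hom_iff)
  have az: "initial C (?a \<otimes> z)" and bz: "initial C (?b \<otimes> z)" using initial_TensO z io by simp_all
  obtain j where j: "j \<in> Hom C (?b \<otimes> z) (?a \<otimes> w)" by (rule initialE[OF bz, of "?a \<otimes> w"]) (use io wo in auto)
  then have jA: "j \<in> Arr C" "Dm C j = ?b \<otimes> z" "Cd C j = ?a \<otimes> w" by (simp_all add: in_Hom_iff)
  have "is_pushout C (Idt C ?a \<star> k) (i \<star> Idt C z) (?a \<otimes> w) (Idt C (?a \<otimes> w)) j"
    unfolding is_pushout_def
  proof (intro conjI allI impI)
    show "Idt C (?a \<otimes> w) \<cdot> (Idt C ?a \<star> k) = j \<cdot> (i \<star> Idt C z)"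
      by (rule initial_unique[OF az, of "?a \<otimes> w"]) (use io wo zo kA jA in \<open>simp_all add: in_Hom_iff\<close>)
    fix x h h'
    assume "h \<in> Hom C (Cd C (Idt C ?a \<star> k)) x \<and> h' \<in> Hom C (Cd C (i \<star> Idt C z)) x \<and>
      h \<cdot> (Idt C ?a \<star> k) = h' \<cdot> (i \<star> Idt C z)"
    then have h: "h \<in> Hom C (?a \<otimes> w) x" "h' \<in> Hom C (?b \<otimes> z) x" using io kA zo by simp_all
    from h have "x \<in> Obj C" by (auto simp: in_Hom_iff)
    then have "h \<cdot> j = h'" by (rule initial_unique[OF bz _ Comp_closed[OF j h(1)] h(2)])
    then show "\<exists>!u. u \<in> Hom C (?a \<otimes> w) x \<and> u \<cdot> Idt C (?a \<otimes> w) = h \<and> u \<cdot> j = h'"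
      using h by (metis Comp_Idt)
  qed (use io kA zo wo jA in \<open>simp_all add: in_Hom_iff\<close>)
  moreover have "(i \<star> Idt C w) \<cdot> j = Idt C ?b \<star> k"
    by (rule initial_unique[OF bz, of "?b \<otimes> w"]) (use io wo zo kA jA in \<open>simp_all add: in_Hom_iff\<close>)
  ultimately show ?thesis
    using pushout_product[OF iH k(1) i k(2), of "?a \<otimes> w" "Idt C (?a \<otimes> w)" j "i \<star> Idt C w"] io wo
    by (simp add: in_Hom_iff)
qed

lemma model_hom_adjunction_tensor:
  assumes "cofibrant C M w"
  shows "model_hom_adjunction C M C M (tensor_functor w) (hom_functor w) (\<lambda>x y a. Ev C w y \<cdot> (a \<star> Idt C w))"
proof -
  have "w \<in> Obj C" using assms by (simp add: cofibrant_def)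
  then show ?thesis
    by (intro model_hom_adjunction.intro model_hom_adjunction_axioms.intro hom_adjunction_tensor
      model_category_axioms) (simp_all add: tensor_functor_def TensA_Cof[OF assms])
qed

end

lemma (in Quillen_adjunction) model_hom_adjunction:
  "model_hom_adjunction C MC D MD F G (\<lambda>x v a. \<epsilon> v \<cdot>\<^bsub>D\<^esub> farr F a)"
  by (intro model_hom_adjunction.intro model_hom_adjunction_axioms.intro hom_adjunction
      C.model_category_axioms D.model_category_axioms F_Cof)

lemma model_hom_adjunction_comp:
  assumes "model_hom_adjunction B MB C MC L R \<sigma>" and "model_hom_adjunction C MC D MD L' R' \<tau>"
  shows "model_hom_adjunction B MB D MD (functor_comp L' L) (functor_comp R R')
    (\<lambda>A v a. \<tau> (fobj L A) v (\<sigma> A (fobj R' v) a))"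
proof -
  interpret s: model_hom_adjunction B MB C MC L R \<sigma> by fact
  interpret t: model_hom_adjunction C MC D MD L' R' \<tau> by fact
  show ?thesis
    by (intro model_hom_adjunction.intro model_hom_adjunction_axioms.intro
        hom_adjunction_comp[OF s.hom_adjunction_axioms t.hom_adjunction_axioms]
        s.C.model_category_axioms t.D.model_category_axioms)
      (simp add: s.L_Cof t.L_Cof)
qed

context weak_monoidal_Quillen_adjunction
begin

lemmas W_interchange = D.interchange and W_Comp_prefix = F.C.Comp_prefix

text \<open>The transpose of \<open>G [F w, v] \<otimes> w \<rightarrow> G [F w, v] \<otimes> G (F w) \<rightarrow> G ([F w, v] \<otimes> F w) \<rightarrow> G v\<close>, built from the unit,
  the lax structure of \<open>G\<close> and evaluation.\<close>

definition hom_comparison :: "'p \<Rightarrow> 'o \<Rightarrow> 'b" where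
  "hom_comparison w v = curry_arr W (fobj G (IHom V (fobj F w) v)) w (fobj G v)
     (farr G (Ev V (fobj F w) v) \<cdot>\<^bsub>W\<^esub> \<mu> (IHom V (fobj F w) v) (fobj F w)
        \<cdot>\<^bsub>W\<^esub> (Idt W (fobj G (IHom V (fobj F w) v)) \<star>\<^bsub>W\<^esub> \<eta> w))"

lemma hom_comparison:
  assumes "w \<in> Obj W" "v \<in> Obj V"
  shows hom_comparison_Arr: "hom_comparison w v \<in> Arr W"
    and hom_comparison_Dm: "Dm W (hom_comparison w v) = fobj G (IHom V (fobj F w) v)"
    and hom_comparison_Cd: "Cd W (hom_comparison w v) = IHom W w (fobj G v)"
    and Ev_hom_comparison: "Ev W w (fobj G v) \<cdot>\<^bsub>W\<^esub> (hom_comparison w v \<star>\<^bsub>W\<^esub> Idt W w)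
      = farr G (Ev V (fobj F w) v) \<cdot>\<^bsub>W\<^esub> \<mu> (IHom V (fobj F w) v) (fobj F w)
        \<cdot>\<^bsub>W\<^esub> (Idt W (fobj G (IHom V (fobj F w) v)) \<star>\<^bsub>W\<^esub> \<eta> w)"
  unfolding hom_comparison_def by (rule W.curry_arr_simps; use assms in simp)+

lemma Ev_hom_comparison_prefix:
  assumes "w \<in> Obj W" "v \<in> Obj V" "a \<in> Arr W" "Cd W a = fobj G (IHom V (fobj F w) v)"
  shows "Ev W w (fobj G v) \<cdot>\<^bsub>W\<^esub> ((hom_comparison w v \<cdot>\<^bsub>W\<^esub> a) \<star>\<^bsub>W\<^esub> Idt W w)
      = farr G (Ev V (fobj F w) v) \<cdot>\<^bsub>W\<^esub> \<mu> (IHom V (fobj F w) v) (fobj F w) \<cdot>\<^bsub>W\<^esub> (a \<star>\<^bsub>W\<^esub> \<eta> w)"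
proof -
  have "Ev W w (fobj G v) \<cdot>\<^bsub>W\<^esub> ((hom_comparison w v \<cdot>\<^bsub>W\<^esub> a) \<star>\<^bsub>W\<^esub> Idt W w)
      = (Ev W w (fobj G v) \<cdot>\<^bsub>W\<^esub> (hom_comparison w v \<star>\<^bsub>W\<^esub> Idt W w)) \<cdot>\<^bsub>W\<^esub> (a \<star>\<^bsub>W\<^esub> Idt W w)"
    using assms by (simp add: W_interchange hom_comparison_Arr hom_comparison_Dm hom_comparison_Cd)
  also have "\<dots> = farr G (Ev V (fobj F w) v) \<cdot>\<^bsub>W\<^esub> \<mu> (IHom V (fobj F w) v) (fobj F w) \<cdot>\<^bsub>W\<^esub> (a \<star>\<^bsub>W\<^esub> \<eta> w)"
    unfolding Ev_hom_comparison[OF assms(1,2)] using assms by (simp add: W_interchange)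
  finally show ?thesis .
qed

lemma hom_comparison_natural_left:
  assumes f: "f \<in> Arr W" "Dm W f = w'" "Cd W f = w" and v: "v \<in> Obj V"
  shows "hom_comparison w' v
      \<cdot>\<^bsub>W\<^esub> farr G (precomp V (self_enrichment V) (fobj F w') (fobj F w) v (self_name V (farr F f)))
    = precomp W (self_enrichment W) w' w (fobj G v) (self_name W f) \<cdot>\<^bsub>W\<^esub> hom_comparison w v" (is "?l = ?r")
proof (rule W.Ev_cancel)
  have o: "w' \<in> Obj W" "w \<in> Obj W" using f by auto
  let ?p = "precomp V (self_enrichment V) (fobj F w') (fobj F w) v (self_name V (farr F f))"
  let ?q = "precomp W (self_enrichment W) w' w (fobj G v) (self_name W f)"
  let ?H = "IHom V (fobj F w) v" and ?H' = "IHom V (fobj F w') v"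
  have Ff: "farr F f \<in> Arr V" "Dm V (farr F f) = fobj F w'" "Cd V (farr F f) = fobj F w" using f by simp_all
  have Gv: "fobj G v \<in> Obj W" using v by simp
  note [simp] = V.precomp_self_Arr[OF Ff v] V.precomp_self_Dm[OF Ff v] V.precomp_self_Cd[OF Ff v]
    W.precomp_self_Arr[OF f Gv] W.precomp_self_Dm[OF f Gv] W.precomp_self_Cd[OF f Gv]
    hom_comparison_Arr hom_comparison_Dm hom_comparison_Cd
  show "w' \<in> Obj W" "fobj G v \<in> Obj W" "?l \<in> Arr W" "?r \<in> Arr W" "Dm W ?l = Dm W ?r"
    "Cd W ?l = IHom W w' (fobj G v)" "Cd W ?r = IHom W w' (fobj G v)"
    using o v by simp_all
  have "Ev W w' (fobj G v) \<cdot>\<^bsub>W\<^esub> (?l \<star>\<^bsub>W\<^esub> Idt W w')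
      = farr G (Ev V (fobj F w') v) \<cdot>\<^bsub>W\<^esub> \<mu> ?H' (fobj F w') \<cdot>\<^bsub>W\<^esub> (farr G ?p \<star>\<^bsub>W\<^esub> \<eta> w')"
    using o v by (subst Ev_hom_comparison_prefix) simp_all
  also have "\<dots> = farr G (Ev V (fobj F w') v) \<cdot>\<^bsub>W\<^esub> \<mu> ?H' (fobj F w')
      \<cdot>\<^bsub>W\<^esub> (farr G ?p \<star>\<^bsub>W\<^esub> Idt W (fobj G (fobj F w'))) \<cdot>\<^bsub>W\<^esub> (Idt W (fobj G ?H) \<star>\<^bsub>W\<^esub> \<eta> w')"
    using o v by (simp add: W_interchange)
  also have "\<dots> = farr G (Ev V (fobj F w') v \<cdot>\<^bsub>V\<^esub> (?p \<star>\<^bsub>V\<^esub> Idt V (fobj F w'))) \<cdot>\<^bsub>W\<^esub> \<mu> ?H (fobj F w')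
      \<cdot>\<^bsub>W\<^esub> (Idt W (fobj G ?H) \<star>\<^bsub>W\<^esub> \<eta> w')"
    using o v by (simp add: W_Comp_prefix[OF mult_nat_left] G.farr_comp)
  also have "\<dots> = farr G (Ev V (fobj F w) v) \<cdot>\<^bsub>W\<^esub> farr G (Idt V ?H \<star>\<^bsub>V\<^esub> farr F f) \<cdot>\<^bsub>W\<^esub> \<mu> ?H (fobj F w')
      \<cdot>\<^bsub>W\<^esub> (Idt W (fobj G ?H) \<star>\<^bsub>W\<^esub> \<eta> w')"
    unfolding V.Ev_precomp_self[OF Ff v] using o f v by (simp add: G.farr_comp)
  also have "\<dots> = farr G (Ev V (fobj F w) v) \<cdot>\<^bsub>W\<^esub> \<mu> ?H (fobj F w)
      \<cdot>\<^bsub>W\<^esub> (Idt W (fobj G ?H) \<star>\<^bsub>W\<^esub> farr G (farr F f)) \<cdot>\<^bsub>W\<^esub> (Idt W (fobj G ?H) \<star>\<^bsub>W\<^esub> \<eta> w')"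
    using o f v by (simp add: W_Comp_prefix[OF mult_nat_right])
  also have "\<dots> = farr G (Ev V (fobj F w) v) \<cdot>\<^bsub>W\<^esub> \<mu> ?H (fobj F w)
      \<cdot>\<^bsub>W\<^esub> (Idt W (fobj G ?H) \<star>\<^bsub>W\<^esub> (\<eta> w \<cdot>\<^bsub>W\<^esub> f))"
    using o f v unit_natural[of f w' w] by (simp add: W_interchange in_Hom_iff)
  also have "\<dots> = (Ev W w (fobj G v) \<cdot>\<^bsub>W\<^esub> (hom_comparison w v \<star>\<^bsub>W\<^esub> Idt W w)) \<cdot>\<^bsub>W\<^esub> (Idt W (fobj G ?H) \<star>\<^bsub>W\<^esub> f)"
    unfolding Ev_hom_comparison[OF o(2) v] using o f v by (simp add: W_interchange)
  also have "\<dots> = (Ev W w (fobj G v) \<cdot>\<^bsub>W\<^esub> (Idt W (IHom W w (fobj G v)) \<star>\<^bsub>W\<^esub> f)) \<cdot>\<^bsub>W\<^esub> (hom_comparison w v \<star>\<^bsub>W\<^esub> Idt W w')"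
    using o f v by (simp add: W_interchange)
  also have "\<dots> = Ev W w' (fobj G v) \<cdot>\<^bsub>W\<^esub> (?r \<star>\<^bsub>W\<^esub> Idt W w')"
    unfolding W.Ev_precomp_self[OF f Gv, symmetric] using o f v by (simp add: W_interchange)
  finally show "Ev W w' (fobj G v) \<cdot>\<^bsub>W\<^esub> (?l \<star>\<^bsub>W\<^esub> Idt W w') = Ev W w' (fobj G v) \<cdot>\<^bsub>W\<^esub> (?r \<star>\<^bsub>W\<^esub> Idt W w')" .
qed

lemma hom_comparison_natural_right:
  assumes w: "w \<in> Obj W" and g: "g \<in> Arr V" "Dm V g = v" "Cd V g = v'"
  shows "hom_comparison w v'
      \<cdot>\<^bsub>W\<^esub> farr G (postcomp V (self_enrichment V) (fobj F w) v v' (self_name V g))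
    = postcomp W (self_enrichment W) w (fobj G v) (fobj G v') (self_name W (farr G g)) \<cdot>\<^bsub>W\<^esub> hom_comparison w v"
    (is "?l = ?r")
proof (rule W.Ev_cancel)
  have o: "v \<in> Obj V" "v' \<in> Obj V" using g by auto
  let ?p = "postcomp V (self_enrichment V) (fobj F w) v v' (self_name V g)"
  let ?H = "IHom V (fobj F w) v" and ?H' = "IHom V (fobj F w) v'"
  have Gg: "farr G g \<in> Arr W" "Dm W (farr G g) = fobj G v" "Cd W (farr G g) = fobj G v'" using g by simp_all
  have Fw: "fobj F w \<in> Obj V" using w by simp
  note [simp] = V.postcomp_self_Arr[OF g Fw] V.postcomp_self_Dm[OF g Fw] V.postcomp_self_Cd[OF g Fw]
    W.postcomp_self_Arr[OF Gg w] W.postcomp_self_Dm[OF Gg w] W.postcomp_self_Cd[OF Gg w]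
    hom_comparison_Arr hom_comparison_Dm hom_comparison_Cd
  show "w \<in> Obj W" "fobj G v' \<in> Obj W" "?l \<in> Arr W" "?r \<in> Arr W" "Dm W ?l = Dm W ?r"
    "Cd W ?l = IHom W w (fobj G v')" "Cd W ?r = IHom W w (fobj G v')"
    using o w by simp_all
  have "Ev W w (fobj G v') \<cdot>\<^bsub>W\<^esub> (?l \<star>\<^bsub>W\<^esub> Idt W w)
      = farr G (Ev V (fobj F w) v') \<cdot>\<^bsub>W\<^esub> \<mu> ?H' (fobj F w) \<cdot>\<^bsub>W\<^esub> (farr G ?p \<star>\<^bsub>W\<^esub> \<eta> w)"
    using o w by (subst Ev_hom_comparison_prefix) simp_all
  also have "\<dots> = farr G (Ev V (fobj F w) v') \<cdot>\<^bsub>W\<^esub> \<mu> ?H' (fobj F w)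
      \<cdot>\<^bsub>W\<^esub> (farr G ?p \<star>\<^bsub>W\<^esub> Idt W (fobj G (fobj F w))) \<cdot>\<^bsub>W\<^esub> (Idt W (fobj G ?H) \<star>\<^bsub>W\<^esub> \<eta> w)"
    using o w by (simp add: W_interchange)
  also have "\<dots> = farr G (Ev V (fobj F w) v' \<cdot>\<^bsub>V\<^esub> (?p \<star>\<^bsub>V\<^esub> Idt V (fobj F w))) \<cdot>\<^bsub>W\<^esub> \<mu> ?H (fobj F w)
      \<cdot>\<^bsub>W\<^esub> (Idt W (fobj G ?H) \<star>\<^bsub>W\<^esub> \<eta> w)"
    using o w by (simp add: W_Comp_prefix[OF mult_nat_left] G.farr_comp)
  also have "\<dots> = farr G g \<cdot>\<^bsub>W\<^esub> farr G (Ev V (fobj F w) v) \<cdot>\<^bsub>W\<^esub> \<mu> ?H (fobj F w)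
      \<cdot>\<^bsub>W\<^esub> (Idt W (fobj G ?H) \<star>\<^bsub>W\<^esub> \<eta> w)"
    unfolding V.Ev_postcomp_self[OF g Fw] using o g w by (simp add: G.farr_comp)
  also have "\<dots> = (farr G g \<cdot>\<^bsub>W\<^esub> Ev W w (fobj G v)) \<cdot>\<^bsub>W\<^esub> (hom_comparison w v \<star>\<^bsub>W\<^esub> Idt W w)"
    using o g w by (simp add: Ev_hom_comparison)
  also have "\<dots> = Ev W w (fobj G v') \<cdot>\<^bsub>W\<^esub> (?r \<star>\<^bsub>W\<^esub> Idt W w)"
    unfolding W.Ev_postcomp_self[OF Gg w, symmetric] using o g w by (simp add: W_interchange)
  finally show "Ev W w (fobj G v') \<cdot>\<^bsub>W\<^esub> (?l \<star>\<^bsub>W\<^esub> Idt W w) = Ev W w (fobj G v') \<cdot>\<^bsub>W\<^esub> (?r \<star>\<^bsub>W\<^esub> Idt W w)" .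
qed

text \<open>Under the bijections \<open>W(A, G [F w, v]) \<cong> V(F A \<otimes> F w, v)\<close> and \<open>W(A, [w, G v]) \<cong> V(F (A \<otimes> w), v)\<close>, composition
  with the comparison map becomes precomposition with \<open>\<delta> : F (A \<otimes> w) \<rightarrow> F A \<otimes> F w\<close>. This holds because \<open>\<delta>\<close> is
  by definition the mate of \<open>\<mu>\<close>: naturality of the counit moves the transpose of \<open>a\<close> inside \<open>G\<close>, naturality
  of \<open>\<mu>\<close> moves it past \<open>\<mu>\<close>, and there a triangle identity restores \<open>a\<close>.\<close>

lemma hom_comparison_mate:
  assumes o: "A \<in> Obj W" "w \<in> Obj W" "v \<in> Obj V"
    and a: "a \<in> Arr W" "Dm W a = A" "Cd W a = fobj G (IHom V (fobj F w) v)"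
  shows "\<epsilon> v \<cdot>\<^bsub>V\<^esub> farr F (Ev W w (fobj G v) \<cdot>\<^bsub>W\<^esub> ((hom_comparison w v \<cdot>\<^bsub>W\<^esub> a) \<star>\<^bsub>W\<^esub> Idt W w))
    = (Ev V (fobj F w) v \<cdot>\<^bsub>V\<^esub> ((\<epsilon> (IHom V (fobj F w) v) \<cdot>\<^bsub>V\<^esub> farr F a) \<star>\<^bsub>V\<^esub> Idt V (fobj F w)))
      \<cdot>\<^bsub>V\<^esub> oplax_mult W V F \<eta> \<epsilon> \<mu> A w"
proof -
  let ?H = "IHom V (fobj F w) v" and ?x = "fobj F A" and ?y = "fobj F w"
  let ?b = "\<epsilon> ?H \<cdot>\<^bsub>V\<^esub> farr F a"
  let ?g = "Ev V ?y v \<cdot>\<^bsub>V\<^esub> (?b \<star>\<^bsub>V\<^esub> Idt V ?y)"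
  have g: "?g \<in> Hom V (?x \<otimes>\<^bsub>V\<^esub> ?y) v" using o a by (simp add: in_Hom_iff)
  have tr: "farr G ?b \<cdot>\<^bsub>W\<^esub> \<eta> A = a"
  proof -
    have "farr G ?b \<cdot>\<^bsub>W\<^esub> \<eta> A = farr G (\<epsilon> ?H) \<cdot>\<^bsub>W\<^esub> farr G (farr F a) \<cdot>\<^bsub>W\<^esub> \<eta> A"
      using o a by (simp add: G.farr_comp)
    also have "\<dots> = (farr G (\<epsilon> ?H) \<cdot>\<^bsub>W\<^esub> \<eta> (fobj G ?H)) \<cdot>\<^bsub>W\<^esub> a"
      using o a unit_natural[of a A "fobj G ?H"] by (simp add: in_Hom_iff)
    also have "\<dots> = a" using o a by (subst triangle_G) simp_all
    finally show ?thesis .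
  qed
  have "?g \<cdot>\<^bsub>V\<^esub> oplax_mult W V F \<eta> \<epsilon> \<mu> A w
      = (?g \<cdot>\<^bsub>V\<^esub> \<epsilon> (?x \<otimes>\<^bsub>V\<^esub> ?y)) \<cdot>\<^bsub>V\<^esub> farr F (\<mu> ?x ?y \<cdot>\<^bsub>W\<^esub> (\<eta> A \<star>\<^bsub>W\<^esub> \<eta> w))"
    unfolding oplax_mult_def using o g by (simp add: in_Hom_iff)
  also have "\<dots> = \<epsilon> v \<cdot>\<^bsub>V\<^esub> farr F (farr G ?g \<cdot>\<^bsub>W\<^esub> \<mu> ?x ?y \<cdot>\<^bsub>W\<^esub> (\<eta> A \<star>\<^bsub>W\<^esub> \<eta> w))"
    unfolding counit_natural[OF g, symmetric] using o g by (simp add: in_Hom_iff F.farr_comp)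
  also have "farr G ?g \<cdot>\<^bsub>W\<^esub> \<mu> ?x ?y \<cdot>\<^bsub>W\<^esub> (\<eta> A \<star>\<^bsub>W\<^esub> \<eta> w)
      = farr G (Ev V ?y v) \<cdot>\<^bsub>W\<^esub> farr G (?b \<star>\<^bsub>V\<^esub> Idt V ?y) \<cdot>\<^bsub>W\<^esub> \<mu> ?x ?y \<cdot>\<^bsub>W\<^esub> (\<eta> A \<star>\<^bsub>W\<^esub> \<eta> w)"
    using o a by (simp add: G.farr_comp)
  also have "\<dots> = farr G (Ev V ?y v) \<cdot>\<^bsub>W\<^esub> \<mu> ?H ?y
      \<cdot>\<^bsub>W\<^esub> (farr G ?b \<star>\<^bsub>W\<^esub> Idt W (fobj G ?y)) \<cdot>\<^bsub>W\<^esub> (\<eta> A \<star>\<^bsub>W\<^esub> \<eta> w)"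
    using o a by (simp add: W_Comp_prefix[OF mult_nat_left])
  also have "\<dots> = farr G (Ev V ?y v) \<cdot>\<^bsub>W\<^esub> \<mu> ?H ?y \<cdot>\<^bsub>W\<^esub> (a \<star>\<^bsub>W\<^esub> \<eta> w)"
    using o a tr by (simp add: W_interchange)
  also have "\<dots> = Ev W w (fobj G v) \<cdot>\<^bsub>W\<^esub> ((hom_comparison w v \<cdot>\<^bsub>W\<^esub> a) \<star>\<^bsub>W\<^esub> Idt W w)"
    using o a by (simp add: Ev_hom_comparison_prefix)
  finally show ?thesis by simp
qed

text \<open>For fixed \<open>w\<close> the functors \<open>G [F w, -]\<close> and \<open>[w, G -]\<close> are right adjoint to \<open>F - \<otimes> F w\<close> and \<open>F (- \<otimes> w)\<close>,
  which preserve cofibrations since \<open>w\<close>, and therefore \<open>F w\<close>, is cofibrant.\<close>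

lemma hom_comparison_Weq:
  assumes w: "cofibrant W MW w" and v: "fibrant V MV v"
  shows "hom_comparison w v \<in> Weq MW"
proof -
  have wo: "w \<in> Obj W" and vo: "v \<in> Obj V" using w v by (simp_all add: cofibrant_def fibrant_def)
  interpret Q: model_hom_adjunction W MW V MV F G "\<lambda>x v a. \<epsilon> v \<cdot>\<^bsub>V\<^esub> farr F a"
    by (rule model_hom_adjunction)
  have Fw: "cofibrant V MV (fobj F w)" by (rule Q.L_cofibrant[OF w])
  note T\<^sub>1 = model_hom_adjunction_comp[OF model_hom_adjunction V.model_hom_adjunction_tensor[OF Fw]]
  note T\<^sub>2 = model_hom_adjunction_comp[OF W.model_hom_adjunction_tensor[OF w] model_hom_adjunction]
  show ?thesis
  proof (rule mate_Weq[OF T\<^sub>1 T\<^sub>2 v, where \<theta> = "\<lambda>A. oplax_mult W V F \<eta> \<epsilon> \<mu> A w"], goal_cases)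
    case (1 A)
    then have "A \<in> Obj W" by (simp add: cofibrant_def)
    then show ?case
      using wo by (simp add: oplax_mult_def in_Hom_iff V.tensor_functor_def W.tensor_functor_def)
  next
    case (2 A) then show ?case by (rule oplax_mult_Weq[OF _ w])
  next
    case 3 show ?case
      using wo vo by (simp add: in_Hom_iff V.hom_functor_def W.hom_functor_def
        hom_comparison_Arr hom_comparison_Dm hom_comparison_Cd)
  next
    case (4 A a)
    then have "A \<in> Obj W" "a \<in> Arr W" "Dm W a = A" "Cd W a = fobj G (IHom V (fobj F w) v)"
      by (simp_all add: cofibrant_def in_Hom_iff V.hom_functor_def)
    from hom_comparison_mate[OF this(1) wo vo this(2-4)] show ?case
      by (simp add: V.hom_functor_def W.hom_functor_def V.tensor_functor_def W.tensor_functor_def)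
  qed
qed

lemma weak_enriched_adjunction_hom_comparison:
  "weak_enriched_adjunction W MW
     W MW (self_enrichment W) (self_name W)
     V MV (change_of_base W G \<mu> \<iota> (self_enrichment V)) (\<lambda>f. change_of_base_name W G \<iota> (self_name V f))
     F G hom_comparison"
proof -
  interpret SV: enriched_category V "self_enrichment V" by (rule V.enriched_category_self)
  interpret B: enriched_change_of_base V W G \<mu> \<iota> "self_enrichment V" ..
  show ?thesis
  proof (intro weak_enriched_adjunction.intro weak_enriched_adjunction_axioms.intro, goal_cases)
    case 1 show ?case by (rule C.model_category_axioms)
  next
    case 2 show ?case by (rule C.model_category_axioms)
  next
    case 3 show ?case by (rule D.model_category_axioms)
  next
    case 4 show ?case by (rule W.enriched_over_self)
  next
    case 5 show ?case
      by (rule enriched_over_change_of_base[OF lax_monoidal_functor_axioms V.enriched_over_self])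
  next
    case 6 show ?case by (rule F.cat_functor_axioms)
  next
    case 7 show ?case by (rule G.cat_functor_axioms)
  next
    case (8 w v) then show ?case
      by (simp add: in_Hom_iff change_of_base_simps V.self_enrichment_simps W.self_enrichment_simps
        hom_comparison_Arr hom_comparison_Dm hom_comparison_Cd)
  next
    case (9 f w' w v)
    then have f: "f \<in> Arr W" "Dm W f = w'" "Cd W f = w" and o: "w' \<in> Obj W" "w \<in> Obj W"
      by (auto simp: in_Hom_iff)
    have "precomp W B.FE (fobj F w') (fobj F w) v (change_of_base_name W G \<iota> (self_name V (farr F f)))
      = farr G (precomp V (self_enrichment V) (fobj F w') (fobj F w) v (self_name V (farr F f)))"
      by (rule B.precomp_change_of_base)
        (use f o 9 in \<open>simp_all add: V.self_enrichment_simps V.self_name_Arr V.self_name_Dm V.self_name_Cd\<close>)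
    then show ?case using hom_comparison_natural_left[OF f 9(2)] by simp
  next
    case (10 w g v v')
    then have g: "g \<in> Arr V" "Dm V g = v" "Cd V g = v'" and o: "v \<in> Obj V" "v' \<in> Obj V"
      by (auto simp: in_Hom_iff)
    have "postcomp W B.FE (fobj F w) v v' (change_of_base_name W G \<iota> (self_name V g))
      = farr G (postcomp V (self_enrichment V) (fobj F w) v v' (self_name V g))"
      by (rule B.postcomp_change_of_base)
        (use g o 10 in \<open>simp_all add: V.self_enrichment_simps V.self_name_Arr V.self_name_Dm V.self_name_Cd\<close>)
    then show ?case using hom_comparison_natural_right[OF 10(1) g] by simp
  next
    case (11 w v) then show ?case by (rule hom_comparison_Weq)
  qed
qed

end

theorem proposition4p3:
  fixes V :: "('o, 'a) closed_symmetric_monoidal_cat" and MV :: "'a model"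
    and W :: "('p, 'b) closed_symmetric_monoidal_cat" and MW :: "'b model"
    and F :: "('p, 'b, 'o, 'a) cfunctor" and G :: "('o, 'a, 'p, 'b) cfunctor"
    and \<eta> :: "'p \<Rightarrow> 'b" and \<epsilon> :: "'o \<Rightarrow> 'a"
    and \<mu> :: "'o \<Rightarrow> 'o \<Rightarrow> 'b" and \<iota> :: "'b"
  assumes "symmetric_monoidal_model_category V MV"
    and "symmetric_monoidal_model_category W MW"
    and "weak_monoidal_Quillen_adjunction W MW V MV F G \<eta> \<epsilon> \<mu> \<iota>"
  shows "\<exists>\<phi>. weak_enriched_adjunction W MW
           W MW (self_enrichment W) (self_name W)
           V MV (change_of_base W G \<mu> \<iota> (self_enrichment V))
             (\<lambda>f. change_of_base_name W G \<iota> (self_name V f))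
           F G \<phi>"
  using weak_monoidal_Quillen_adjunction.weak_enriched_adjunction_hom_comparison[OF assms(3)] by blast

end
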